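(* Consider the sequence of empirical risk minimization problems described in the context, and assume that the regime, constraint-set, penalty, restricted-subgaussianity and loss assumptions listed there all hold. Let $\mathbf X\in\mathbb R^{n\times p}$ have i.i.d. rows $\mathbf x_1,\dots,\mathbf x_n$ distributed as $\mathbf x$, let $\mathbf G\in\mathbb R^{n\times p}$ have i.i.d. rows $\mathbf g_1,\dots,\mathbf g_n\sim\mathcal N(\boldsymbol\mu_{\mathbf g},\boldsymbol\Sigma_{\mathbf g})$, and let $\varepsilon_1,\dots,\varepsilon_n$ be i.i.d. real random variables, independent of $\mathbf X$ and of $\mathbf G$, with $\max_{i\le n}\|\varepsilon_i\|_{\psi_2}\le K$ for a constant $K$ independent of $n$. Let $\mathcal S_p$ be a domain of Gaussianity for $\mathbf x$ (with respect to $\mathcal N(\boldsymbol\mu_{\mathbf g},\boldsymbol\Sigma_{\mathbf g})$). If $\mathcal C_{j,p}\subseteq\mathcal S_p$ for all $j\le k$, then for every bounded Lipschitz function $\psi:\mathbb R\to\mathbb R$, $$\lim_{n\to\infty}\Big|\mathbb E\big[\psi\big(\widehat R_n^\star(\mathbf X)\big)\big]-\mathbb E\big[\psi\big(\widehat R_n^\star(\mathbf G)\big)\big]\Big|=0 .$$ Consequently, for all $\rho\in\mathbb R$, $\widehat R_n^\star(\mathbf X)\to\rho$ in probability if and only if $\widehat R_n^\star(\mathbf G)\to\rho$ in probability.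
   Context: **Problem.** We consider a sequence of problems indexed by $n$, with $p=p(n)$, and a fixed integer $k\ge1$. The sets $\mathcal C_{j,p}$, the domain $\mathcal S_p$, the penalty $r$, the laws of $\mathbf x$ and of $\varepsilon_i$, and $\boldsymbol\mu_{\mathbf g}\in\mathbb R^p$, $\boldsymbol\Sigma_{\mathbf g}\in\mathbb R^{p\times p}$ may depend on $n$; the loss $\ell$ and all constants below do not. Let $\ell:\mathbb R^k\times\mathbb R\to\mathbb R_{\ge0}$ and $r:\mathbb R^{p\times k}\to\mathbb R_{\ge 0}$ be continuous. For a matrix $\mathbf M\in\mathbb R^{n\times p}$ with rows $\mathbf m_1,\dots,\mathbf m_n$ and $\boldsymbol\Theta\in\mathbb R^{p\times k}$ let $$\widehat R_n(\boldsymbol\Theta;\mathbf M)=\frac1n\sum_{i=1}^n\ell(\boldsymbol\Theta^{\top}\mathbf m_i,\varepsilon_i)+r(\boldsymbol\Theta),\qquad \widehat R^\star_n(\mathbf M)=\min_{\boldsymbol\Theta\in\mathcal C_p^k}\widehat R_n(\boldsymbol\Theta;\mathbf M),$$ where $\mathcal C_p^k=\mathcal C_{1,p}\times\cdots\times\mathcal C_{k,p}$ is the set of matrices whose $j$-th column lies in $\mathcal C_{j,p}\subseteq\mathbb R^p$. $\|\cdot\|_{\psi_2}$ denotes the subgaussian norm. **Regime.** There is a constant $C_0>0$ with $C_0^{-1}\le p(n)/n\le C_0$ for all $n$. **Constraint sets.** The sets $\mathcal C_{j,p}$, $j\le k$, are compact with $\ell_2$ radius bounded by $R$, i.e. contained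 in the Euclidean ball of radius $R$ centered at $0$ ($R$ a constant). **Penalty.** For every $B>0$ there is $K_r(B)>0$ (independent of $p$) such that $|r(\boldsymbol\Theta)-r(\widetilde{\boldsymbol\Theta})|\le K_r(B)\|\boldsymbol\Theta-\widetilde{\boldsymbol\Theta}\|_F$ whenever $\|\boldsymbol\Theta\|_F,\|\widetilde{\boldsymbol\Theta}\|_F\le B$. **Domain of Gaussianity.** A sequence of symmetric convex sets $\mathcal S_p\subseteq\mathbb R^p$ is a domain of Gaussianity for $\mathbf x$ (with respect to $\mathbf g\sim\mathcal N(\boldsymbol\mu_{\mathbf g},\boldsymbol\Sigma_{\mathbf g})$) if for every bounded Lipschitz $\varphi:\mathbb R\to\mathbb R$, $\lim_{p\to\infty}\sup_{\boldsymbol\theta\in\mathcal S_p}|\mathbb E[\varphi(\boldsymbol\theta^\top\mathbf g)]-\mathbb E[\varphi(\boldsymbol\theta^\top\mathbf x)]|=0$. **Restricted subgaussianity.** For a constant $K$ independent of $n,p$, and for the constraint sets $\mathcal C_{j,p}$, $j\le k$, $$\sup_{\{\boldsymbol\theta\in\mathcal C_{j,p}:\|\boldsymbol\theta\|_2\le1\}}\|\mathbf x^\top\boldsymbol\theta\|_{\psi_2}\le K,\quad \sup_{\{\boldsymbol\theta\in\mathcal C_{j,p}:\|\boldsymbol\theta\|_2\le1\}}\|\boldsymbol\Sigma_{\mathbf g}^{1/2}\boldsymbol\theta\|_2\le K,\quad\|\boldsymbol\mu_{\mathbf g}\|_2\le K.$$ **Loss.** $\ell$ is non-negative and satisfies one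 of the following. (1) Lipschitz: $|\ell(\mathbf v,\varepsilon)-\ell(\tilde{\mathbf v},\tilde\varepsilon)|\le K(\|\mathbf v-\tilde{\mathbf v}\|_2+|\varepsilon-\tilde\varepsilon|)$ for all arguments, for some $K>0$. (2) Locally Lipschitz with polynomial growth: for every $B>0$ there is $K_\ell(B)>0$ such that $|\ell(\mathbf v,\varepsilon)-\ell(\tilde{\mathbf v},\tilde\varepsilon)|\le K_\ell(B)(\|\mathbf v-\tilde{\mathbf v}\|_2+|\varepsilon-\tilde\varepsilon|)$ whenever $\|(\mathbf v,\varepsilon)\|_2,\|(\tilde{\mathbf v},\tilde\varepsilon)\|_2\le B$; and for some constants $K_0,K_1,K$ (with $K_1>0$) and $b\ge a>0$, $-K_0+K_1(\|\mathbf v\|_2^a+|\varepsilon|^a)\le\ell(\mathbf v,\varepsilon)\le K(1+\|\mathbf v\|_2^b+|\varepsilon|^b)$ for all $(\mathbf v,\varepsilon)$.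
   Formalization: The restricted subgaussianity suprema are taken over all tθ with θ in C_{j,p}, 0≤t≤1 and ‖tθ‖₂≤1, instead of only θ in C_{j,p} with ‖θ‖₂≤1; otherwise vectors of norm above 1 carry no bound and the claim fails. *)

theory Defs
  imports "HOL-Probability.Probability"
begin

text \<open>Since the dimension varies along the sequence of problems, a vector of \<open>\<real>\<^sup>p\<close> is a function on
  \<open>nat\<close> that is extensional on \<open>{..<p}\<close>, i.e. a point of \<open>Pi\<^sub>M {..<p} (\<lambda>_. borel)\<close>. On
  \<open>Rvec p\<close> the product topology of \<open>nat \<Rightarrow> real\<close> is the Euclidean one, and
  \<open>L2_set \<theta> {..<p}\<close> is the Euclidean norm.\<close>

definition Rvec :: "nat \<Rightarrow> (nat \<Rightarrow> real) set"
  where "Rvec p = (\<Pi>\<^sub>E i\<in>{..<p}. UNIV)"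

abbreviation borel_vec :: "nat \<Rightarrow> (nat \<Rightarrow> real) measure"
  where "borel_vec p \<equiv> Pi\<^sub>M {..<p} (\<lambda>_. borel)"

definition dot :: "nat \<Rightarrow> (nat \<Rightarrow> real) \<Rightarrow> (nat \<Rightarrow> real) \<Rightarrow> real"
  where "dot p u v = (\<Sum>i<p. u i * v i)"

definition mat_vec :: "nat \<Rightarrow> (nat \<Rightarrow> nat \<Rightarrow> real) \<Rightarrow> (nat \<Rightarrow> real) \<Rightarrow> nat \<Rightarrow> real"
  where "mat_vec p A v = (\<lambda>i\<in>{..<p}. \<Sum>j<p. A i j * v j)"

definition psd :: "nat \<Rightarrow> (nat \<Rightarrow> nat \<Rightarrow> real) \<Rightarrow> bool"
  where "psd p A \<longleftrightarrow> (\<forall>i<p. \<forall>j<p. A i j = A j i) \<and> (\<forall>v. 0 \<le> dot p v (mat_vec p A v))"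

text \<open>For positive semidefinite \<open>A\<close> the entries of the square root with indices below \<open>p\<close>, which are
  the only ones ever used, are uniquely determined.\<close>

definition psd_sqrt :: "nat \<Rightarrow> (nat \<Rightarrow> nat \<Rightarrow> real) \<Rightarrow> nat \<Rightarrow> nat \<Rightarrow> real"
  where "psd_sqrt p A = (SOME B. psd p B \<and> (\<forall>i<p. \<forall>j<p. (\<Sum>l<p. B i l * B l j) = A i j))"

text \<open>The law of \<open>\<mu> + \<Sigma>\<^sup>1\<^sup>/\<^sup>2 z\<close> with \<open>z\<close> standard Gaussian; \<open>\<Sigma>\<close> may be singular.\<close>

definition mv_normal :: "nat \<Rightarrow> (nat \<Rightarrow> real) \<Rightarrow> (nat \<Rightarrow> nat \<Rightarrow> real) \<Rightarrow> (nat \<Rightarrow> real) measure"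
  where "mv_normal p \<mu> \<Sigma> =
    distr (Pi\<^sub>M {..<p} (\<lambda>_. std_normal_distribution)) (borel_vec p)
      (\<lambda>z. \<lambda>i\<in>{..<p}. \<mu> i + mat_vec p (psd_sqrt p \<Sigma>) z i)"

text \<open>The value is \<open>\<infinity>\<close> if no \<open>t\<close> is admissible.\<close>

definition psi2_norm :: "'a measure \<Rightarrow> ('a \<Rightarrow> real) \<Rightarrow> ennreal"
  where "psi2_norm M Z =
    Inf {ennreal t | t. 0 < t \<and> (\<integral>\<^sup>+ \<omega>. ennreal (exp ((Z \<omega>)\<^sup>2 / t\<^sup>2)) \<partial>M) \<le> 2}"

definition symmetric_convex :: "nat \<Rightarrow> (nat \<Rightarrow> real) set \<Rightarrow> bool"
  where "symmetric_convex p S \<longleftrightarrow>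
    (\<forall>u\<in>S. (\<lambda>i\<in>{..<p}. - u i) \<in> S) \<and>
    (\<forall>u\<in>S. \<forall>v\<in>S. \<forall>t\<in>{0..1}. (\<lambda>i\<in>{..<p}. (1 - t) * u i + t * v i) \<in> S)"

text \<open>Everything is indexed by the sample size \<open>n \<ge> 1\<close>, with dimension \<open>p n\<close>; when \<open>p n / n\<close> is
  bounded away from \<open>0\<close>, the limit over \<open>n\<close> is the limit as the dimension tends to infinity along
  the sequence.\<close>

definition domain_of_gaussianity ::
    "(nat \<Rightarrow> nat) \<Rightarrow> (nat \<Rightarrow> (nat \<Rightarrow> real) set) \<Rightarrow> (nat \<Rightarrow> (nat \<Rightarrow> real) measure) \<Rightarrow>
     (nat \<Rightarrow> nat \<Rightarrow> real) \<Rightarrow> (nat \<Rightarrow> nat \<Rightarrow> nat \<Rightarrow> real) \<Rightarrow> bool"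
  where "domain_of_gaussianity p S law_x \<mu> \<Sigma> \<longleftrightarrow>
    (\<forall>n\<ge>1. S n \<subseteq> Rvec (p n) \<and> symmetric_convex (p n) (S n)) \<and>
    (\<forall>\<phi> :: real \<Rightarrow> real. bounded (range \<phi>) \<longrightarrow> (\<exists>L. L-lipschitz_on UNIV \<phi>) \<longrightarrow>
      (\<lambda>n. SUP \<theta>\<in>S n. ennreal \<bar>(\<integral>g. \<phi> (dot (p n) \<theta> g) \<partial>mv_normal (p n) (\<mu> n) (\<Sigma> n))
                              - (\<integral>x. \<phi> (dot (p n) \<theta> x) \<partial>law_x n)\<bar>) \<longlonglongrightarrow> 0)"

text \<open>The union of the segments \<open>[0, \<theta>]\<close>, \<open>\<theta> \<in> A\<close>; equal to \<open>A\<close> if \<open>A\<close> is star-shaped about \<open>0\<close>,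
  in particular if \<open>A\<close> is nonempty, symmetric and convex.

  The restricted subgaussianity bounds are imposed on the part of this hull, rather than of the
  constraint set itself, that lies in the unit ball. The bounds are thereby meant up to scaling and
  also control constraint vectors of norm greater than one: a set contained in a sphere of radius two
  would otherwise be subject to no bound at all, and for such a set universality fails.\<close>

definition star_hull :: "nat \<Rightarrow> (nat \<Rightarrow> real) set \<Rightarrow> (nat \<Rightarrow> real) set"
  where "star_hull p A = {(\<lambda>i\<in>{..<p}. t * \<theta> i) | t \<theta>. \<theta> \<in> A \<and> 0 \<le> t \<and> t \<le> 1}"

text \<open>A \<open>p \<times> k\<close> matrix is the family of its columns, indexed by a type with \<open>k\<close> elements.\<close>

definition frob_norm :: "nat \<Rightarrow> ('k::finite \<Rightarrow> nat \<Rightarrow> real) \<Rightarrow> real"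
  where "frob_norm p \<Theta> = sqrt (\<Sum>j\<in>UNIV. \<Sum>i<p. (\<Theta> j i)\<^sup>2)"

definition tmat_vec :: "nat \<Rightarrow> ('k::finite \<Rightarrow> nat \<Rightarrow> real) \<Rightarrow> (nat \<Rightarrow> real) \<Rightarrow> real ^ 'k"
  where "tmat_vec p \<Theta> m = (\<chi> j. dot p (\<Theta> j) m)"

definition emp_risk ::
    "nat \<Rightarrow> nat \<Rightarrow> (real ^ 'k::finite \<Rightarrow> real \<Rightarrow> real) \<Rightarrow> (('k \<Rightarrow> nat \<Rightarrow> real) \<Rightarrow> real) \<Rightarrow>
     (nat \<Rightarrow> real) \<Rightarrow> (nat \<Rightarrow> nat \<Rightarrow> real) \<Rightarrow> ('k \<Rightarrow> nat \<Rightarrow> real) \<Rightarrow> real"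
  where "emp_risk n p l r e A \<Theta> = (\<Sum>i<n. l (tmat_vec p \<Theta> (A i)) (e i)) / real n + r \<Theta>"

definition min_risk ::
    "nat \<Rightarrow> nat \<Rightarrow> (real ^ 'k::finite \<Rightarrow> real \<Rightarrow> real) \<Rightarrow> (('k \<Rightarrow> nat \<Rightarrow> real) \<Rightarrow> real) \<Rightarrow>
     ('k \<Rightarrow> (nat \<Rightarrow> real) set) \<Rightarrow> (nat \<Rightarrow> real) \<Rightarrow> (nat \<Rightarrow> nat \<Rightarrow> real) \<Rightarrow> real"
  where "min_risk n p l r C e A = (LEAST v. v \<in> emp_risk n p l r e A ` {\<Theta>. \<forall>j. \<Theta> j \<in> C j})"

definition opt_risk ::
    "(nat \<Rightarrow> nat) \<Rightarrow> (real ^ 'k::finite \<Rightarrow> real \<Rightarrow> real) \<Rightarrow> (nat \<Rightarrow> ('k \<Rightarrow> nat \<Rightarrow> real) \<Rightarrow> real) \<Rightarrow>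
     (nat \<Rightarrow> 'k \<Rightarrow> (nat \<Rightarrow> real) set) \<Rightarrow> (nat \<Rightarrow> nat \<Rightarrow> 'a \<Rightarrow> real) \<Rightarrow>
     (nat \<Rightarrow> nat \<Rightarrow> 'a \<Rightarrow> nat \<Rightarrow> real) \<Rightarrow> nat \<Rightarrow> 'a \<Rightarrow> real"
  where "opt_risk p l r C eps A n \<omega> =
    min_risk n (p n) l (r n) (C n) (\<lambda>i. eps n i \<omega>) (\<lambda>i. A n i \<omega>)"

definition lipschitz_loss :: "(real ^ 'k::finite \<Rightarrow> real \<Rightarrow> real) \<Rightarrow> bool"
  where "lipschitz_loss l \<longleftrightarrow>
    (\<exists>K>0. \<forall>v e v' e'. \<bar>l v e - l v' e'\<bar> \<le> K * (norm (v - v') + \<bar>e - e'\<bar>))"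

definition poly_growth_loss :: "(real ^ 'k::finite \<Rightarrow> real \<Rightarrow> real) \<Rightarrow> bool"
  where "poly_growth_loss l \<longleftrightarrow>
    (\<forall>B>0. \<exists>K>0. \<forall>v e v' e'. norm (v, e) \<le> B \<longrightarrow> norm (v', e') \<le> B \<longrightarrow>
       \<bar>l v e - l v' e'\<bar> \<le> K * (norm (v - v') + \<bar>e - e'\<bar>)) \<and>
    (\<exists>K0 K1 K a b :: real. 0 < K1 \<and> 0 < a \<and> a \<le> b \<and>
       (\<forall>v e. - K0 + K1 * (norm v powr a + \<bar>e\<bar> powr a) \<le> l v e \<and>
              l v e \<le> K * (1 + norm v powr b + \<bar>e\<bar> powr b)))"

text \<open>\<open>prob_space.indep_var\<close> requires both variables to take values in the same type.\<close>

definition indep_rv ::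
    "'a measure \<Rightarrow> 'b measure \<Rightarrow> ('a \<Rightarrow> 'b) \<Rightarrow> 'c measure \<Rightarrow> ('a \<Rightarrow> 'c) \<Rightarrow> bool"
  where "indep_rv M N1 Y1 N2 Y2 \<longleftrightarrow>
    Y1 \<in> measurable M N1 \<and> Y2 \<in> measurable M N2 \<and>
    prob_space.indep_set M {Y1 -` A \<inter> space M | A. A \<in> sets N1} {Y2 -` A \<inter> space M | A. A \<in> sets N2}"

text \<open>The \<open>n\<close>-th variable lives on its own probability space \<open>M n\<close>.\<close>

definition converges_in_prob :: "(nat \<Rightarrow> 'a measure) \<Rightarrow> (nat \<Rightarrow> 'a \<Rightarrow> real) \<Rightarrow> real \<Rightarrow> bool"
  where "converges_in_prob M Z c \<longleftrightarrow>
    (\<forall>\<delta>>0. (\<lambda>n. measure (M n) {\<omega> \<in> space (M n). \<delta> < \<bar>Z n \<omega> - c\<bar>}) \<longlonglongrightarrow> 0)"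

end

theory Submission
  imports Defs
begin

text \<open>
  The loss is first truncated at a level \<open>B\<close>. Replacing the loss of one sample at a time, and comparing
  with the minimizer of the risk without that sample (which is independent of it), shows that
  truncation changes the expected minimum by at most \<open>sup \<Theta>. E (l \<Theta> - B)\<^sup>+\<close>, whatever the constraint
  set; hence \<open>B\<close> can be fixed before any discretization. The truncated loss is Lipschitz.

  Since the constraint sets need not be convex, the differences of their elements are measured in the
  gauge of the convex body of all \<open>\<theta>\<close> for which \<open>\<bar>\<theta>\<^sup>T x\<bar>\<close> and \<open>\<bar>\<theta>\<^sup>T g\<bar>\<close> have a bounded exponential
  moment. A volume argument in this gauge gives \<open>\<epsilon>\<close>-nets of size \<open>(1 + 2 / \<epsilon>)\<^sup>p\<close>, along which the
  truncated minimum moves by \<open>O(\<epsilon>)\<close> uniformly. As \<open>p = O(n)\<close>, the minimum over a net is the free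
  energy at inverse temperature \<open>\<beta> n\<close> up to \<open>O(1 / \<beta>)\<close>.

  The free energies of \<open>X\<close> and \<open>G\<close> are compared by exchanging one row at a time for a fixed noise
  vector. An exchange changes the free energy by \<open>ln \<langle>exp (- \<beta> l)\<rangle> / (\<beta> n)\<close>, the average being over a
  Gibbs measure that does not involve the exchanged row. Approximating the logarithm by a polynomial,
  and \<open>exp (- \<beta> l)\<close> by a polynomial in sines of the coordinates of \<open>\<Theta>\<^sup>T x\<close>, turns the logarithm into
  a finite sum of cosines of linear forms \<open>u\<^sup>T x\<close> with \<open>u\<close> in a multiple of \<open>S\<close>, whose expectations are
  asymptotically equal by the domain of Gaussianity, uniformly in the Gibbs measure.
\<close>

section \<open>Packing in a symmetric convex body\<close>

text \<open>Restricted subgaussianity controls the linear form of a vector in the directions of the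
  constraint sets only. The difference of two constraint vectors may be short in Euclidean norm and
  still have an uncontrolled exponential moment, so a Euclidean net does not make the risk vary
  little. In \<open>exp_body\<close> the moment bound is part of the definition: a difference in
  \<epsilon> times the body changes the average loss by \<epsilon> times a quantity whose expected
  supremum over the body is bounded. The price is an entropy of order p, which only a temperature of
  order 1 / n can absorb. An exchanged row therefore enters through exp (- \<beta> l) with a fixed
  \<beta>, which cannot be linearized in l, and under Gibbs weights that are arbitrary. The
  comparison of one row must be uniform over these weights and over p; the coefficient sum in
  \<open>trig\<close> is what survives the averaging. The Lipschitz constant of the truncated loss
  depends on B, the net on that constant, the temperature on the net. A truncation error that
  depended on the net would make these choices circular.\<close>

lemma nn_integral_PiM_affine:
  fixes f :: "('i \<Rightarrow> real) \<Rightarrow> ennreal" and c :: "'i \<Rightarrow> real"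
  assumes "finite I" "0 < s" "f \<in> borel_measurable (Pi\<^sub>M I (\<lambda>_. lborel))"
  shows "(\<integral>\<^sup>+x. f x \<partial>Pi\<^sub>M I (\<lambda>_. lborel)) =
    ennreal (s ^ card I) * (\<integral>\<^sup>+x. f (\<lambda>i\<in>I. c i + s * x i) \<partial>Pi\<^sub>M I (\<lambda>_. lborel))"
  using assms
proof (induction I arbitrary: f rule: finite_induct)
  case empty
  interpret product_sigma_finite "\<lambda>_::'i. lborel :: real measure" ..
  show ?case by (simp add: PiM_empty nn_integral_count_space_finite restrict_def)
next
  case (insert i I)
  interpret product_sigma_finite "\<lambda>_::'i. lborel :: real measure" ..
  note insert.prems(2)[measurable] and \<open>finite I\<close>[simp]
  have aff: "(\<lambda>x. f (\<lambda>i\<in>insert i I. c i + s * x i)) \<in> borel_measurable (Pi\<^sub>M (insert i I) (\<lambda>_. lborel))"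
    by measurable
  \<comment> \<open>The one-dimensional substitution in the new coordinate; the others are treated
    by the induction hypothesis, applied to the inner integral.\<close>
  have 1: "(\<integral>\<^sup>+y. f (x(i := y)) \<partial>lborel) = ennreal s * (\<integral>\<^sup>+y. f (x(i := c i + s * y)) \<partial>lborel)"
    if "x \<in> space (Pi\<^sub>M I (\<lambda>_. lborel))" for x
  proof -
    have "(\<lambda>y. f (x(i := y))) \<in> borel_measurable lborel"
      using measurable_comp[OF measurable_component_update insert.prems(2), OF that \<open>i \<notin> I\<close>]
      unfolding comp_def .
    then show ?thesis
      using nn_integral_real_affine[of "\<lambda>y. f (x(i := y))" s "c i"] insert.prems by simp
  qed
  have m1: "(\<lambda>x. \<integral>\<^sup>+y. f (x(i := c i + s * y)) \<partial>lborel) \<in> borel_measurable (Pi\<^sub>M I (\<lambda>_. lborel))"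
  proof -
    have "(\<lambda>(x,y). f (x(i := c i + s * y))) \<in> borel_measurable (Pi\<^sub>M I (\<lambda>_. lborel) \<Otimes>\<^sub>M lborel)"
      unfolding split_beta'
      by (intro measurable_compose[OF _ insert.prems(2)] measurable_fun_upd[where J=I]) auto
    then show ?thesis
      by (simp add: lborel.borel_measurable_nn_integral)
  qed
  have "(\<integral>\<^sup>+x. f x \<partial>Pi\<^sub>M (insert i I) (\<lambda>_. lborel)) =
      (\<integral>\<^sup>+x. \<integral>\<^sup>+y. f (x(i := y)) \<partial>lborel \<partial>Pi\<^sub>M I (\<lambda>_. lborel))"
    using insert by (intro product_nn_integral_insert) auto
  also have "\<dots> = (\<integral>\<^sup>+x. ennreal s * (\<integral>\<^sup>+y. f (x(i := c i + s * y)) \<partial>lborel) \<partial>Pi\<^sub>M I (\<lambda>_. lborel))"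
    by (intro nn_integral_cong 1)
  also have "\<dots> = ennreal s * (\<integral>\<^sup>+x. (\<integral>\<^sup>+y. f (x(i := c i + s * y)) \<partial>lborel) \<partial>Pi\<^sub>M I (\<lambda>_. lborel))"
    by (intro nn_integral_cmult m1)
  also have "(\<integral>\<^sup>+x. (\<integral>\<^sup>+y. f (x(i := c i + s * y)) \<partial>lborel) \<partial>Pi\<^sub>M I (\<lambda>_. lborel)) =
     ennreal (s ^ card I) * (\<integral>\<^sup>+x. (\<integral>\<^sup>+y. f ((\<lambda>i\<in>I. c i + s * x i)(i := c i + s * y)) \<partial>lborel) \<partial>Pi\<^sub>M I (\<lambda>_. lborel))"
    by (rule insert.IH[OF \<open>0 < s\<close> m1])
  also have "(\<integral>\<^sup>+x. (\<integral>\<^sup>+y. f ((\<lambda>i\<in>I. c i + s * x i)(i := c i + s * y)) \<partial>lborel) \<partial>Pi\<^sub>M I (\<lambda>_. lborel)) =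
     (\<integral>\<^sup>+x. (\<integral>\<^sup>+y. f (\<lambda>j\<in>insert i I. c j + s * (x(i := y)) j) \<partial>lborel) \<partial>Pi\<^sub>M I (\<lambda>_. lborel))"
    using \<open>i \<notin> I\<close>
    by (intro nn_integral_cong arg_cong[where f=f]) (auto simp: fun_eq_iff)
  also have "\<dots> = (\<integral>\<^sup>+x. f (\<lambda>i\<in>insert i I. c i + s * x i) \<partial>Pi\<^sub>M (insert i I) (\<lambda>_. lborel))"
    using insert aff by (intro product_nn_integral_insert[symmetric]) auto
  finally show ?case
    using insert.hyps \<open>0 < s\<close> by (simp add: ennreal_mult mult.assoc del: restrict_apply)
qed

text \<open>Volume comparison: the translates x + (e / 2) A with x in F are pairwise disjoint and
  contained in (1 + e / 2) A. A box inside A and a box around A make its volume positive and finite,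
  so that it cancels.\<close>

lemma packing_bound:
  fixes A :: "(nat \<Rightarrow> real) set"
  assumes meas: "A \<in> sets (borel_vec p)"
    and sc: "symmetric_convex p A"
    and bdd: "\<And>x i. x \<in> A \<Longrightarrow> i < p \<Longrightarrow> \<bar>x i\<bar> \<le> R"
    and int: "0 < \<eta>" "\<And>x. x \<in> Rvec p \<Longrightarrow> (\<And>i. i < p \<Longrightarrow> \<bar>x i\<bar> \<le> \<eta>) \<Longrightarrow> x \<in> A"
    and e: "0 < e"
    and F: "finite F" "F \<subseteq> A"
      "\<And>x y. x \<in> F \<Longrightarrow> y \<in> F \<Longrightarrow> x \<noteq> y \<Longrightarrow> (\<lambda>i\<in>{..<p}. (x i - y i) / e) \<notin> A"
  shows "real (card F) \<le> (1 + 2 / e) ^ p"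
proof -
  let ?V = "Pi\<^sub>M {..<p} (\<lambda>_. lborel) :: (nat \<Rightarrow> real) measure"
  interpret product_sigma_finite "\<lambda>_::nat. lborel :: real measure" ..
  have sV: "sets ?V = sets (borel_vec p)" by (intro sets_PiM_cong) auto
  have [measurable]: "A \<in> sets ?V" using meas sV by simp
  define a where "a = e / 2"
  have a: "0 < a" using e by (simp add: a_def)
  have spA: "A \<subseteq> Rvec p"
    using sets.sets_into_space[OF meas] by (auto simp: space_PiM Rvec_def)
  define v where "v = emeasure ?V A"
  have "emeasure ?V (\<Pi>\<^sub>E i\<in>{..<p}. {-\<eta>..\<eta>}) \<le> v"
    unfolding v_def
  proof (intro emeasure_mono subsetI)
    fix x :: "nat \<Rightarrow> real" assume x: "x \<in> (\<Pi>\<^sub>E i\<in>{..<p}. {-\<eta>..\<eta>})"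
    have "\<bar>x i\<bar> \<le> \<eta>" if "i < p" for i
      using PiE_mem[OF x, of i] that by (auto simp: abs_le_iff)
    moreover have "x \<in> Rvec p" using x by (auto simp: Rvec_def PiE_iff)
    ultimately show "x \<in> A" by (intro int(2))
  qed simp
  moreover have "emeasure ?V (\<Pi>\<^sub>E i\<in>{..<p}. {-\<eta>..\<eta>}) > 0"
  proof -
    have "emeasure ?V (\<Pi>\<^sub>E i\<in>{..<p}. {-\<eta>..\<eta>}) = (\<Prod>i<p. emeasure lborel {-\<eta>..\<eta>})"
      by (subst emeasure_PiM) auto
    also have "\<dots> = ennreal ((2 * \<eta>) ^ p)"
      using int(1) by (simp add: ennreal_power)
    finally show ?thesis using int(1) by simp
  qed
  ultimately have v0: "v > 0" by order
  have "v \<le> emeasure ?V (\<Pi>\<^sub>E i\<in>{..<p}. {-R..R})"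
    unfolding v_def
  proof (intro emeasure_mono subsetI)
    fix x assume x: "x \<in> A"
    then show "x \<in> (\<Pi>\<^sub>E i\<in>{..<p}. {-R..R})"
      using bdd[OF x] spA by (auto simp: Rvec_def abs_le_iff PiE_iff minus_le_iff)
  qed (auto intro!: sets_PiM_I_finite)
  moreover have "emeasure ?V (\<Pi>\<^sub>E i\<in>{..<p}. {-R..R}) < \<infinity>"
  proof -
    have "emeasure ?V (\<Pi>\<^sub>E i\<in>{..<p}. {-R..R}) = (\<Prod>i<p. emeasure lborel {-R..R})"
      by (subst emeasure_PiM) auto
    also have "\<dots> < \<infinity>" by (simp add: power_less_top_ennreal emeasure_lborel_Icc_eq)
    finally show ?thesis .
  qed
  ultimately have v1: "v < \<infinity>" by order
  \<comment> \<open>The integrand is the indicator of a translate of s A, so this is the scaling of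
    volume.\<close>
  have scal: "(\<integral>\<^sup>+y. indicator A (\<lambda>i\<in>{..<p}. c i + y i / s) \<partial>?V) = ennreal (s ^ p) * v" if "0 < s" for s and c :: "nat \<Rightarrow> real"
  proof -
    have "v = (\<integral>\<^sup>+y. indicator A y \<partial>?V)" by (simp add: v_def)
    also have "\<dots> = ennreal ((1 / s) ^ p) * (\<integral>\<^sup>+y. indicator A (\<lambda>i\<in>{..<p}. c i + (1 / s) * y i) \<partial>?V)"
      using nn_integral_PiM_affine[of "{..<p}" "1 / s" "indicator A" c] that by simp
    finally have "ennreal (s ^ p) * v =
        ennreal (s ^ p * (1 / s) ^ p) * (\<integral>\<^sup>+y. indicator A (\<lambda>i\<in>{..<p}. c i + (1 / s) * y i) \<partial>?V)"
      using that by (simp add: ennreal_mult mult.assoc)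
    also have "s ^ p * (1 / s) ^ p = 1" using that by (simp add: power_mult_distrib[symmetric])
    finally show ?thesis by (simp add: mult.commute divide_inverse del: restrict_apply)
  qed
  have comb: "(\<lambda>i\<in>{..<p}. (1 - t) * x i + t * y i) \<in> A" if "x \<in> A" "y \<in> A" "0 \<le> t" "t \<le> 1" for x y t
    using sc that unfolding symmetric_convex_def by auto
  have sym: "(\<lambda>i\<in>{..<p}. - x i) \<in> A" if "x \<in> A" for x
    using sc that unfolding symmetric_convex_def by auto
  \<comment> \<open>Disjointness and containment in one pointwise inequality: at most one summand is
    1, and then the right-hand side is 1.\<close>
  have pt: "(\<Sum>x\<in>F. indicator A (\<lambda>i\<in>{..<p}. - x i / a + y i / a)) \<le>
      (indicator A (\<lambda>i\<in>{..<p}. 0 + y i / (1 + a)) :: ennreal)" for y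
  proof (cases "\<exists>x\<in>F. (\<lambda>i\<in>{..<p}. - x i / a + y i / a) \<in> A")
    case True
    then obtain x where x: "x \<in> F" "(\<lambda>i\<in>{..<p}. - x i / a + y i / a) \<in> A" by blast
    have xA: "x \<in> A" using x F by auto
    \<comment> \<open>y / (1 + a) is the convex combination of x and (y - x) / a with weight a / (1
      + a) on the second.\<close>
    have "(\<lambda>i\<in>{..<p}. (1 - a / (1 + a)) * x i + a / (1 + a) * (\<lambda>i\<in>{..<p}. - x i / a + y i / a) i) \<in> A"
      by (intro comb xA x(2)) (use a in auto)
    also have "(\<lambda>i\<in>{..<p}. (1 - a / (1 + a)) * x i + a / (1 + a) * (\<lambda>i\<in>{..<p}. - x i / a + y i / a) i)
       = (\<lambda>i\<in>{..<p}. 0 + y i / (1 + a))"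
    proof (rule ext)
      fix i
      have "1 + a \<noteq> 0" using a by simp
      then have "(1 - a / (1 + a)) * x i + a / (1 + a) * (- x i / a + y i / a) = y i / (1 + a)"
        using a by (simp add: divide_simps)
      then show "(\<lambda>i\<in>{..<p}. (1 - a / (1 + a)) * x i + a / (1 + a) * (\<lambda>i\<in>{..<p}. - x i / a + y i / a) i) i
       = (\<lambda>i\<in>{..<p}. 0 + y i / (1 + a)) i" by (simp add: restrict_def)
    qed
    finally have in': "(\<lambda>i\<in>{..<p}. 0 + y i / (1 + a)) \<in> A" .
    \<comment> \<open>If y lay in two translates, (x - x') / e would be the midpoint of (y - x') / a
      and the reflection of (y - x) / a, because 2 a = e; the separation of F forbids this.\<close>
    have uniq: "(\<lambda>i\<in>{..<p}. - x' i / a + y i / a) \<notin> A" if "x' \<in> F" "x' \<noteq> x" for x'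
    proof
      assume h: "(\<lambda>i\<in>{..<p}. - x' i / a + y i / a) \<in> A"
      have "(\<lambda>i\<in>{..<p}. (1 - 1 / 2) * (\<lambda>i\<in>{..<p}. - x' i / a + y i / a) i + 1 / 2 * (\<lambda>i\<in>{..<p}. - (\<lambda>i\<in>{..<p}. - x i / a + y i / a) i) i) \<in> A"
        by (intro comb h sym x) auto
      also have "(\<lambda>i\<in>{..<p}. (1 - 1 / 2) * (\<lambda>i\<in>{..<p}. - x' i / a + y i / a) i + 1 / 2 * (\<lambda>i\<in>{..<p}. - (\<lambda>i\<in>{..<p}. - x i / a + y i / a) i) i)
         = (\<lambda>i\<in>{..<p}. (x i - x' i) / e)"
        using e by (auto simp: a_def fun_eq_iff field_simps)
      finally show False using F(3)[OF x(1) that(1) that(2)[symmetric]] by contradiction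
    qed
    have "(\<Sum>x'\<in>F. indicator A (\<lambda>i\<in>{..<p}. - x' i / a + y i / a)) =
        (\<Sum>x'\<in>F. if x' = x then 1 else (0::ennreal))"
      using uniq x by (intro sum.cong) (auto simp: indicator_def)
    also have "\<dots> = 1" using F(1) x(1) by simp
    finally show ?thesis using in' by simp
  qed simp
  have meas_aff: "(\<lambda>y. \<lambda>i\<in>{..<p}. c i + y i / s) \<in> measurable ?V ?V" for c :: "nat \<Rightarrow> real" and s
    by measurable
  have "of_nat (card F) * (ennreal (a ^ p) * v) = (\<Sum>x\<in>F. \<integral>\<^sup>+y. indicator A (\<lambda>i\<in>{..<p}. - x i / a + y i / a) \<partial>?V)"
    by (subst scal[OF a]) simp
  also have "\<dots> = (\<integral>\<^sup>+y. (\<Sum>x\<in>F. indicator A (\<lambda>i\<in>{..<p}. - x i / a + y i / a)) \<partial>?V)"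
    by (rule nn_integral_sum[symmetric]) (intro measurable_compose[OF meas_aff], simp)
  also have "\<dots> \<le> (\<integral>\<^sup>+y. indicator A (\<lambda>i\<in>{..<p}. 0 + y i / (1 + a)) \<partial>?V)"
    by (intro nn_integral_mono pt)
  also have "\<dots> = ennreal ((1 + a) ^ p) * v" using scal[of "1 + a" "\<lambda>_. 0"] a by simp
  finally have "(ennreal (real (card F) * a ^ p)) * v \<le> ennreal ((1 + a) ^ p) * v"
    using a by (simp add: ennreal_mult mult.assoc ennreal_of_nat_eq_real_of_nat)
  then have "real (card F) * a ^ p \<le> (1 + a) ^ p"
    using v0 v1 a by (metis ennreal_le_iff ennreal_mult_le_mult_iff less_irrefl infinity_ennreal_def mult.commute zero_le_power add_nonneg_nonneg zero_le_one less_imp_le)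
  then have "real (card F) \<le> (1 + a) ^ p / a ^ p" using a by (simp add: field_simps)
  also have "\<dots> = ((1 + a) / a) ^ p" by (simp add: power_divide)
  also have "(1 + a) / a = 1 + 2 / e" using e by (simp add: a_def field_simps)
  finally show ?thesis .
qed

section \<open>Nets in the body of bounded exponential moments\<close>

lemma dot_restrict [simp]: "dot p (restrict u {..<p}) v = dot p u v" "dot p u (restrict v {..<p}) = dot p u v"
  by (simp_all add: dot_def)

lemma measurable_dot [measurable]: "dot p u \<in> borel_measurable (borel_vec p)"
  unfolding dot_def[abs_def] by measurable

lemma space_borel_vec: "space (borel_vec p) = Rvec p"
  by (simp add: space_PiM Rvec_def)

lemma L2_set_restrict [simp]: "L2_set (restrict u {..<p}) {..<p} = L2_set u {..<p}"
  by (simp add: L2_set_def)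

lemma coord_le_L2: "(i::nat) < p \<Longrightarrow> \<bar>x i\<bar> \<le> L2_set x {..<p}"
  using member_le_L2_set[OF finite_lessThan, of i p "\<lambda>j. \<bar>x j\<bar>"]
  by (simp add: L2_set_def)

text \<open>P and Q stand for the laws of x and g. The exponential moment at a fixed scale t is
  convex and even in \<theta>, so its sublevel set is symmetric and convex without any loss in c.
  The Euclidean bound makes the set bounded and later controls the penalty.\<close>

definition exp_body :: "nat \<Rightarrow> real \<Rightarrow> real \<Rightarrow> real \<Rightarrow> (nat \<Rightarrow> real) measure \<Rightarrow> (nat \<Rightarrow> real) measure \<Rightarrow> (nat \<Rightarrow> real) set"
  where "exp_body p t c R P Q = {\<theta> \<in> Rvec p. L2_set \<theta> {..<p} \<le> R \<and>
    (\<integral>\<^sup>+x. ennreal (exp (\<bar>dot p \<theta> x\<bar> / t)) \<partial>P) \<le> ennreal c \<and>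
    (\<integral>\<^sup>+x. ennreal (exp (\<bar>dot p \<theta> x\<bar> / t)) \<partial>Q) \<le> ennreal c}"

text \<open>Finite rather than probability measures, because the packing bound applies this to
  truncated laws, which lose mass.\<close>

lemma exp_body_measurable:
  assumes "finite_measure P" "finite_measure Q" "sets P = sets (borel_vec p)" "sets Q = sets (borel_vec p)"
  shows "exp_body p t c R P Q \<in> sets (borel_vec p)"
proof -
  interpret P: finite_measure P by fact
  interpret Q: finite_measure Q by fact
  note [measurable_cong] = assms(3,4)
  have [measurable]: "(\<lambda>z. dot p (fst z) (snd z)) \<in> borel_measurable (borel_vec p \<Otimes>\<^sub>M P)"
    "(\<lambda>z. dot p (fst z) (snd z)) \<in> borel_measurable (borel_vec p \<Otimes>\<^sub>M Q)"
    unfolding dot_def by measurable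
  have [measurable]: "(\<lambda>\<theta>. \<integral>\<^sup>+x. ennreal (exp (\<bar>dot p \<theta> x\<bar> / t)) \<partial>P) \<in> borel_measurable (borel_vec p)"
    by (rule P.borel_measurable_nn_integral) (simp add: split_beta')
  have [measurable]: "(\<lambda>\<theta>. \<integral>\<^sup>+x. ennreal (exp (\<bar>dot p \<theta> x\<bar> / t)) \<partial>Q) \<in> borel_measurable (borel_vec p)"
    by (rule Q.borel_measurable_nn_integral) (simp add: split_beta')
  have [measurable]: "(\<lambda>\<theta>. L2_set \<theta> {..<p}) \<in> borel_measurable (borel_vec p)"
    unfolding L2_set_def by measurable
  have "{\<theta> \<in> space (borel_vec p). L2_set \<theta> {..<p} \<le> R \<and>
    (\<integral>\<^sup>+x. ennreal (exp (\<bar>dot p \<theta> x\<bar> / t)) \<partial>P) \<le> ennreal c \<and>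
    (\<integral>\<^sup>+x. ennreal (exp (\<bar>dot p \<theta> x\<bar> / t)) \<partial>Q) \<le> ennreal c} \<in> sets (borel_vec p)"
    by measurable
  then show ?thesis by (simp add: exp_body_def space_borel_vec)
qed

lemma nn_integral_exp_convex:
  assumes [measurable]: "dot p u \<in> borel_measurable P" "dot p v \<in> borel_measurable P"
    and s: "0 \<le> s" "s \<le> 1" and t: "0 < t"
    and u: "(\<integral>\<^sup>+x. ennreal (exp (\<bar>dot p u x\<bar> / t)) \<partial>P) \<le> ennreal c"
    and v: "(\<integral>\<^sup>+x. ennreal (exp (\<bar>dot p v x\<bar> / t)) \<partial>P) \<le> ennreal c"
  shows "(\<integral>\<^sup>+x. ennreal (exp (\<bar>dot p (\<lambda>i. (1 - s) * u i + s * v i) x\<bar> / t)) \<partial>P) \<le> ennreal c"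
proof -
  have pt: "exp (\<bar>dot p (\<lambda>i. (1 - s) * u i + s * v i) x\<bar> / t) \<le>
      (1 - s) * exp (\<bar>dot p u x\<bar> / t) + s * exp (\<bar>dot p v x\<bar> / t)" for x
  proof -
    have "dot p (\<lambda>i. (1 - s) * u i + s * v i) x = (1 - s) * dot p u x + s * dot p v x"
      unfolding dot_def sum_distrib_left sum.distrib[symmetric]
      by (intro sum.cong refl) (simp add: algebra_simps)
    then have "\<bar>dot p (\<lambda>i. (1 - s) * u i + s * v i) x\<bar> \<le> (1 - s) * \<bar>dot p u x\<bar> + s * \<bar>dot p v x\<bar>"
      using s by (simp add: order_trans[OF abs_triangle_ineq] abs_mult)
    then have "\<bar>dot p (\<lambda>i. (1 - s) * u i + s * v i) x\<bar> / t \<le> (1 - s) * (\<bar>dot p u x\<bar> / t) + s * (\<bar>dot p v x\<bar> / t)"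
      using t by (simp add: field_simps)
    then have "exp (\<bar>dot p (\<lambda>i. (1 - s) * u i + s * v i) x\<bar> / t) \<le> exp ((1 - s) *\<^sub>R (\<bar>dot p u x\<bar> / t) + s *\<^sub>R (\<bar>dot p v x\<bar> / t))"
      by simp
    also have "\<dots> \<le> (1 - s) * exp (\<bar>dot p u x\<bar> / t) + s * exp (\<bar>dot p v x\<bar> / t)"
      using s by (intro convex_onD[OF exp_convex]) auto
    finally show ?thesis .
  qed
  have "(\<integral>\<^sup>+x. ennreal (exp (\<bar>dot p (\<lambda>i. (1 - s) * u i + s * v i) x\<bar> / t)) \<partial>P) \<le>
     (\<integral>\<^sup>+x. ennreal (1 - s) * ennreal (exp (\<bar>dot p u x\<bar> / t)) + ennreal s * ennreal (exp (\<bar>dot p v x\<bar> / t)) \<partial>P)"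
    using s pt by (intro nn_integral_mono) (simp add: ennreal_mult[symmetric] ennreal_plus[symmetric] del: ennreal_plus)
  also have "\<dots> = ennreal (1 - s) * (\<integral>\<^sup>+x. ennreal (exp (\<bar>dot p u x\<bar> / t)) \<partial>P)
      + ennreal s * (\<integral>\<^sup>+x. ennreal (exp (\<bar>dot p v x\<bar> / t)) \<partial>P)"
    by (simp add: nn_integral_add nn_integral_cmult)
  also have "\<dots> \<le> ennreal (1 - s) * ennreal c + ennreal s * ennreal c"
    by (intro add_mono mult_left_mono u v) auto
  also have "\<dots> = (ennreal (1 - s) + ennreal s) * ennreal c" by (simp add: distrib_right)
  also have "ennreal (1 - s) + ennreal s = 1" using s by (simp flip: ennreal_plus)
  finally show ?thesis by simp
qed

lemma exp_body_symmetric_convex: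
  assumes "sets P = sets (borel_vec p)" "sets Q = sets (borel_vec p)" "0 < t"
  shows "symmetric_convex p (exp_body p t c R P Q)"
  unfolding symmetric_convex_def
proof safe
  note [measurable_cong] = assms(1,2)
  have mP: "dot p u \<in> borel_measurable P" for u by measurable
  have mQ: "dot p u \<in> borel_measurable Q" for u by measurable
  fix u assume u: "u \<in> exp_body p t c R P Q"
  have "\<bar>dot p (\<lambda>i\<in>{..<p}. - u i) x\<bar> = \<bar>dot p u x\<bar>" for x
    by (simp add: dot_def sum_negf)
  moreover have "L2_set (\<lambda>i\<in>{..<p}. - u i) {..<p} = L2_set u {..<p}" by (simp add: L2_set_def)
  ultimately show "(\<lambda>i\<in>{..<p}. - u i) \<in> exp_body p t c R P Q"
    using u by (simp add: exp_body_def Rvec_def)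
  fix v and s :: real assume v: "v \<in> exp_body p t c R P Q" and s: "s \<in> {0..1}"
  have "L2_set (\<lambda>i. (1 - s) * u i + s * v i) {..<p} \<le> L2_set (\<lambda>i. (1 - s) * u i) {..<p} + L2_set (\<lambda>i. s * v i) {..<p}"
    by (rule L2_set_triangle_ineq)
  also have "\<dots> = (1 - s) * L2_set u {..<p} + s * L2_set v {..<p}"
    using s by (simp add: L2_set_right_distrib)
  also have "\<dots> \<le> (1 - s) * R + s * R"
    using u v s by (intro add_mono mult_left_mono) (auto simp: exp_body_def)
  finally have "L2_set (\<lambda>i. (1 - s) * u i + s * v i) {..<p} \<le> R" by (simp add: algebra_simps)
  moreover have "(\<integral>\<^sup>+x. ennreal (exp (\<bar>dot p (\<lambda>i. (1 - s) * u i + s * v i) x\<bar> / t)) \<partial>P) \<le> ennreal c"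
    "(\<integral>\<^sup>+x. ennreal (exp (\<bar>dot p (\<lambda>i. (1 - s) * u i + s * v i) x\<bar> / t)) \<partial>Q) \<le> ennreal c"
    using u v s by (intro nn_integral_exp_convex mP mQ \<open>0 < t\<close>, auto simp: exp_body_def)+
  ultimately show "(\<lambda>i\<in>{..<p}. (1 - s) * u i + s * v i) \<in> exp_body p t c R P Q"
    by (simp add: exp_body_def Rvec_def)
qed

text \<open>Under P itself the exponential moments may be infinite in directions arbitrarily close
  to 0, and the body may have empty interior. Restricted to a box all linear forms are bounded, so
  the body of the restricted law contains a small cube around 0, as the volume argument
  requires.\<close>

definition box_trunc :: "nat \<Rightarrow> nat \<Rightarrow> (nat \<Rightarrow> real) measure \<Rightarrow> (nat \<Rightarrow> real) measure"
  where "box_trunc p m P = density P (indicator {x \<in> space P. \<forall>i<p. \<bar>x i\<bar> \<le> real m})"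

lemma sets_box_trunc [simp]: "sets (box_trunc p m P) = sets P"
  by (simp add: box_trunc_def)

lemma box_measurable:
  assumes "sets P = sets (borel_vec p)"
  shows "{x \<in> space P. \<forall>i<p. \<bar>x i\<bar> \<le> b} \<in> sets P"
proof -
  note [measurable_cong] = assms(1)
  have "{x \<in> space P. \<forall>i\<in>{..<p}. \<bar>x i\<bar> \<le> b} \<in> sets P"
    by measurable
  then show ?thesis by (simp add: Ball_def)
qed

lemma nn_integral_box_trunc:
  assumes "sets P = sets (borel_vec p)" "f \<in> borel_measurable P"
  shows "(\<integral>\<^sup>+x. f x \<partial>box_trunc p m P) = (\<integral>\<^sup>+x. f x * indicator {x \<in> space P. \<forall>i<p. \<bar>x i\<bar> \<le> real m} x \<partial>P)"
proof -
  have "(indicator {x \<in> space P. \<forall>i<p. \<bar>x i\<bar> \<le> real m} :: _ \<Rightarrow> ennreal) \<in> borel_measurable P"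
    by (intro borel_measurable_indicator box_measurable assms(1))
  from nn_integral_density[OF this assms(2)] show ?thesis
    unfolding box_trunc_def by (simp only: mult.commute)
qed

lemma nn_integral_box_trunc_tendsto:
  assumes "sets P = sets (borel_vec p)" "f \<in> borel_measurable P"
  shows "(\<lambda>m. \<integral>\<^sup>+x. f x \<partial>box_trunc p m P) \<longlonglongrightarrow> (\<integral>\<^sup>+x. f x \<partial>P)"
proof -
  have "(\<lambda>m. \<integral>\<^sup>+x. f x * indicator {x \<in> space P. \<forall>i<p. \<bar>x i\<bar> \<le> real m} x \<partial>P)
      \<longlonglongrightarrow> (\<integral>\<^sup>+x. f x * indicator (space P) x \<partial>P)"
  proof (rule nn_integral_LIMSEQ)
    show "incseq (\<lambda>m x. f x * indicator {x \<in> space P. \<forall>i<p. \<bar>x i\<bar> \<le> real m} x)"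
    proof (intro incseq_SucI le_funI)
      fix m x
      have "{x \<in> space P. \<forall>i<p. \<bar>x i\<bar> \<le> real m} \<subseteq> {x \<in> space P. \<forall>i<p. \<bar>x i\<bar> \<le> real (Suc m)}"
        by (auto intro: order_trans[of _ "real m"])
      then show "f x * indicator {x \<in> space P. \<forall>i<p. \<bar>x i\<bar> \<le> real m} x \<le> f x * indicator {x \<in> space P. \<forall>i<p. \<bar>x i\<bar> \<le> real (Suc m)} x"
        by (intro mult_left_mono) (auto simp: indicator_def)
    qed
    fix x
    have ev: "eventually (\<lambda>m. \<forall>i<p. \<bar>x i\<bar> \<le> real m) sequentially"
    proof -
      obtain m0 :: nat where m0: "(\<Sum>i<p. \<bar>x i\<bar>) \<le> real m0" using real_arch_simple by blast
      have "\<bar>x i\<bar> \<le> real m" if "m0 \<le> m" "i < p" for i m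
        using m0 that member_le_sum[of i "{..<p}" "\<lambda>i. \<bar>x i\<bar>"] by fastforce
      then show ?thesis by (auto simp: eventually_sequentially)
    qed
    show "(\<lambda>m. f x * indicator {x \<in> space P. \<forall>i<p. \<bar>x i\<bar> \<le> real m} x) \<longlonglongrightarrow> f x * indicator (space P) x"
      by (rule tendsto_eventually, rule eventually_mono[OF ev]) (simp add: indicator_def)
  qed (intro borel_measurable_times_ennreal borel_measurable_indicator box_measurable assms)
  also have "(\<integral>\<^sup>+x. f x * indicator (space P) x \<partial>P) = (\<integral>\<^sup>+x. f x \<partial>P)"
    by (intro nn_integral_cong) simp
  finally show ?thesis unfolding nn_integral_box_trunc[OF assms] .
qed

text \<open>The volume argument is run for the laws restricted to a large box. Restriction decreases
  the moments, so F stays in the body; a violated moment bound is a strict inequality and survives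
  monotone convergence, and as F is finite all separations survive at one common level m.\<close>

lemma exp_body_packing:
  assumes "prob_space P" "prob_space Q" and sets: "sets P = sets (borel_vec p)" "sets Q = sets (borel_vec p)"
    and t: "0 < t" and c: "1 < c" and R: "0 < R" and e: "0 < e"
    and F: "finite F" "F \<subseteq> exp_body p t c R P Q"
      "\<And>x y. x \<in> F \<Longrightarrow> y \<in> F \<Longrightarrow> x \<noteq> y \<Longrightarrow> (\<lambda>i\<in>{..<p}. (x i - y i) / e) \<notin> exp_body p t c R P Q"
  shows "real (card F) \<le> (1 + 2 / e) ^ p"
proof -
  interpret P: prob_space P by fact
  interpret Q: prob_space Q by fact
  note [measurable_cong] = sets
  define A where "A m = exp_body p t c R (box_trunc p m P) (box_trunc p m Q)" for m
  have lim: "(\<lambda>m. \<integral>\<^sup>+x. ennreal (exp (\<bar>dot p u x\<bar> / t)) \<partial>box_trunc p m P) \<longlonglongrightarrow> (\<integral>\<^sup>+x. ennreal (exp (\<bar>dot p u x\<bar> / t)) \<partial>P)"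
    "(\<lambda>m. \<integral>\<^sup>+x. ennreal (exp (\<bar>dot p u x\<bar> / t)) \<partial>box_trunc p m Q) \<longlonglongrightarrow> (\<integral>\<^sup>+x. ennreal (exp (\<bar>dot p u x\<bar> / t)) \<partial>Q)" for u
    by (intro nn_integral_box_trunc_tendsto sets; measurable)+
  have out: "eventually (\<lambda>m. u \<notin> A m) sequentially" if u: "u \<notin> exp_body p t c R P Q" for u
  proof -
    consider "u \<notin> Rvec p \<or> \<not> L2_set u {..<p} \<le> R"
      | "(\<integral>\<^sup>+x. ennreal (exp (\<bar>dot p u x\<bar> / t)) \<partial>P) > ennreal c"
      | "(\<integral>\<^sup>+x. ennreal (exp (\<bar>dot p u x\<bar> / t)) \<partial>Q) > ennreal c"
      using u unfolding exp_body_def mem_Collect_eq not_le[symmetric] by blast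
    then show ?thesis
    proof cases
      case 1 then show ?thesis by (auto simp: A_def exp_body_def)
    next
      case 2 then show ?thesis
        by (intro eventually_mono[OF order_tendstoD(1)[OF lim(1)], of "ennreal c" u]) (auto simp: A_def exp_body_def not_le)
    next
      case 3 then show ?thesis
        by (intro eventually_mono[OF order_tendstoD(1)[OF lim(2)], of "ennreal c" u]) (auto simp: A_def exp_body_def not_le)
    qed
  qed
  have "eventually (\<lambda>m. \<forall>x\<in>F. \<forall>y\<in>F. x \<noteq> y \<longrightarrow> (\<lambda>i\<in>{..<p}. (x i - y i) / e) \<notin> A m) sequentially"
  proof (intro eventually_ball_finite ballI F(1))
    fix x y assume "x \<in> F" "y \<in> F"
    then show "eventually (\<lambda>m. x \<noteq> y \<longrightarrow> (\<lambda>i\<in>{..<p}. (x i - y i) / e) \<notin> A m) sequentially"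
      using F(3) out by (cases "x = y") auto
  qed
  then obtain m where m: "\<forall>x\<in>F. \<forall>y\<in>F. x \<noteq> y \<longrightarrow> (\<lambda>i\<in>{..<p}. (x i - y i) / e) \<notin> A m"
    using eventually_happens by fastforce
  have le: "(\<integral>\<^sup>+x. f x \<partial>box_trunc p m P) \<le> (\<integral>\<^sup>+x. f x \<partial>P)" if "f \<in> borel_measurable P" "sets P = sets (borel_vec p)" for f P
    unfolding nn_integral_box_trunc[OF that(2,1)] by (intro nn_integral_mono) (auto simp: indicator_def)
  have FA: "F \<subseteq> A m"
  proof
    fix x assume "x \<in> F"
    then have x: "x \<in> exp_body p t c R P Q" using F by auto
    have "(\<integral>\<^sup>+y. ennreal (exp (\<bar>dot p x y\<bar> / t)) \<partial>box_trunc p m P) \<le> (\<integral>\<^sup>+y. ennreal (exp (\<bar>dot p x y\<bar> / t)) \<partial>P)"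
      "(\<integral>\<^sup>+y. ennreal (exp (\<bar>dot p x y\<bar> / t)) \<partial>box_trunc p m Q) \<le> (\<integral>\<^sup>+y. ennreal (exp (\<bar>dot p x y\<bar> / t)) \<partial>Q)"
      by (intro le sets; measurable)+
    then show "x \<in> A m" using x by (auto simp: A_def exp_body_def intro: order_trans)
  qed
  \<comment> \<open>Coordinates of size at most \<eta> give a sum of absolute values at most R by
    the first entry, and a linear form of size at most t ln c on the box of level m by the second;
    the \<open>+ 1\<close> covers p = 0 and m = 0.\<close>
  define \<eta> where "\<eta> = min (R / (real p + 1)) (t * ln c / (real p * real m + 1))"
  have \<eta>0: "\<eta> > 0" using R t c
    by (auto simp: \<eta>_def intro!: divide_pos_pos mult_pos_pos add_nonneg_pos)
  have fin: "finite_measure (box_trunc p m P)" if "prob_space P" "sets P = sets (borel_vec p)" for P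
  proof
    interpret prob_space P by fact
    have "emeasure (box_trunc p m P) (space (box_trunc p m P)) = (\<integral>\<^sup>+x. 1 \<partial>box_trunc p m P)" by simp
    also have "\<dots> \<le> (\<integral>\<^sup>+x. 1 \<partial>P)" by (rule le) (auto simp: that)
    finally show "emeasure (box_trunc p m P) (space (box_trunc p m P)) \<noteq> \<infinity>"
      by (auto simp: emeasure_space_1 top_unique)
  qed
  show ?thesis
  proof (rule packing_bound[of "A m" p R \<eta>])
    show "A m \<in> sets (borel_vec p)" unfolding A_def
      by (rule exp_body_measurable) (auto simp: fin assms)
    show "symmetric_convex p (A m)" unfolding A_def
      by (rule exp_body_symmetric_convex) (auto simp: assms)
    show "\<bar>x i\<bar> \<le> R" if "x \<in> A m" "i < p" for x i
      using that coord_le_L2[of i p x] by (auto simp: A_def exp_body_def)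
    fix x assume x: "x \<in> Rvec p" "\<And>i. i < p \<Longrightarrow> \<bar>x i\<bar> \<le> \<eta>"
    have "L2_set x {..<p} \<le> (\<Sum>i<p. \<bar>x i\<bar>)" by (rule L2_set_le_sum_abs)
    also have "\<dots> \<le> real p * \<eta>" using sum_bounded_above[of "{..<p}" "\<lambda>i. \<bar>x i\<bar>" \<eta>] x(2) by simp
    also have "\<dots> \<le> real p * (R / (real p + 1))" by (intro mult_left_mono) (auto simp: \<eta>_def)
    also have "\<dots> \<le> R" using R by (simp add: field_simps)
    finally have L2: "L2_set x {..<p} \<le> R" .
    have int: "(\<integral>\<^sup>+y. ennreal (exp (\<bar>dot p x y\<bar> / t)) \<partial>box_trunc p m P) \<le> ennreal c"
      if "prob_space P" and sP [measurable_cong]: "sets P = sets (borel_vec p)" for P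
    proof -
      interpret prob_space P by fact
      have pt: "ennreal (exp (\<bar>dot p x y\<bar> / t)) * indicator {x \<in> space P. \<forall>i<p. \<bar>x i\<bar> \<le> real m} y \<le> ennreal c" for y
      proof (cases "\<forall>i<p. \<bar>y i\<bar> \<le> real m")
        case True
        have "\<bar>dot p x y\<bar> \<le> (\<Sum>i<p. \<bar>x i\<bar> * \<bar>y i\<bar>)"
          unfolding dot_def by (rule order_trans[OF sum_abs]) (simp add: abs_mult)
        also have "\<dots> \<le> (\<Sum>i<p. \<eta> * real m)"
          using x True \<eta>0 by (intro sum_mono mult_mono) auto
        also have "\<dots> = real p * real m * \<eta>" by simp
        also have "\<dots> \<le> real p * real m * (t * ln c / (real p * real m + 1))"
          by (intro mult_left_mono) (auto simp: \<eta>_def)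
        also have "\<dots> \<le> t * ln c"
        proof -
          have "x * (y / (x + 1)) \<le> y" if "0 \<le> x" "0 \<le> y" for x y :: real
            using that by (simp add: field_simps)
          then show ?thesis using t c by simp
        qed
        finally have "\<bar>dot p x y\<bar> / t \<le> ln c" using t by (simp add: field_simps)
        then have "exp (\<bar>dot p x y\<bar> / t) \<le> c" using c by (simp add: ln_ge_iff)
        then have "ennreal (exp (\<bar>dot p x y\<bar> / t)) \<le> ennreal c" by (rule ennreal_leI)
        then show ?thesis by (simp add: indicator_def)
      qed auto
      have "(\<integral>\<^sup>+y. ennreal (exp (\<bar>dot p x y\<bar> / t)) \<partial>box_trunc p m P) \<le> (\<integral>\<^sup>+y. ennreal c \<partial>P)"
        by (subst nn_integral_box_trunc[OF sP]) (measurable, intro nn_integral_mono pt)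
      then show ?thesis by (simp add: emeasure_space_1)
    qed
    show "x \<in> A m" using x(1) L2 int assms by (auto simp: A_def exp_body_def)
  qed (use \<eta>0 e F m FA in auto)
qed

text \<open>A separated subset of maximal size is a net, since an uncovered point of T could be
  added to it; the packing bound ensures that a maximal size exists.\<close>

lemma exp_body_net:
  assumes "prob_space P" "prob_space Q" "sets P = sets (borel_vec p)" "sets Q = sets (borel_vec p)"
    and t: "0 < t" and c: "1 < c" and R: "0 < R" and e: "0 < e"
    and T: "T \<subseteq> exp_body p t c R P Q"
  obtains F where "finite F" "F \<subseteq> T" "real (card F) \<le> (1 + 2 / e) ^ p"
    "\<And>x. x \<in> T \<Longrightarrow> \<exists>y\<in>F. (\<lambda>i\<in>{..<p}. (x i - y i) / e) \<in> exp_body p t c R P Q"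
proof -
  let ?B = "exp_body p t c R P Q"
  interpret P: prob_space P by fact
  interpret Q: prob_space Q by fact
  define sep where "sep F \<longleftrightarrow> finite F \<and> F \<subseteq> T \<and>
    (\<forall>x\<in>F. \<forall>y\<in>F. x \<noteq> y \<longrightarrow> (\<lambda>i\<in>{..<p}. (x i - y i) / e) \<notin> ?B)" for F
  have bd: "real (card F) \<le> (1 + 2 / e) ^ p" if "sep F" for F
    using that T by (intro exp_body_packing[OF assms(1-8)]) (auto simp: sep_def)
  have "\<exists>n. (\<exists>F. sep F \<and> card F = n) \<and> (\<forall>m. (\<exists>F. sep F \<and> card F = m) \<longrightarrow> m \<le> n)"
  proof (rule Nat.ex_has_greatest_nat)
    show "\<exists>F. sep F \<and> card F = 0" by (intro exI[of _ "{}"]) (simp add: sep_def)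
    show "\<forall>m. (\<exists>F. sep F \<and> card F = m) \<longrightarrow> m \<le> nat \<lceil>(1 + 2 / e) ^ p\<rceil>"
    proof (intro allI impI)
      fix m assume "\<exists>F. sep F \<and> card F = m"
      then have "real m \<le> (1 + 2 / e) ^ p" using bd by auto
      then show "m \<le> nat \<lceil>(1 + 2 / e) ^ p\<rceil>" by linarith
    qed
  qed
  then obtain F where F: "sep F" and mx: "\<And>G. sep G \<Longrightarrow> card G \<le> card F" by auto
  have "\<exists>y\<in>F. (\<lambda>i\<in>{..<p}. (x i - y i) / e) \<in> ?B" if x: "x \<in> T" for x
  proof (rule ccontr)
    assume no: "\<not> ?thesis"
    have sym: "(\<lambda>i\<in>{..<p}. (x i - y i) / e) \<in> ?B" if "(\<lambda>i\<in>{..<p}. (y i - x i) / e) \<in> ?B" for y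
    proof -
      have "(\<lambda>i\<in>{..<p}. - (\<lambda>i\<in>{..<p}. (y i - x i) / e) i) \<in> ?B"
        using exp_body_symmetric_convex[OF assms(3,4) t, of c R] that unfolding symmetric_convex_def by blast
      also have "(\<lambda>i\<in>{..<p}. - (\<lambda>i\<in>{..<p}. (y i - x i) / e) i) = (\<lambda>i\<in>{..<p}. (x i - y i) / e)"
        by (auto simp: fun_eq_iff diff_divide_distrib)
      finally show ?thesis .
    qed
    have "x \<notin> F"
    proof
      assume "x \<in> F"
      \<comment> \<open>The zero vector lies in the body because its exponential moment is 1 and 1 <
        c.\<close>
      have "(\<lambda>i\<in>{..<p}. (x i - x i) / e) \<in> ?B"
        using c R by (auto simp: exp_body_def Rvec_def dot_def L2_set_def P.emeasure_space_1 Q.emeasure_space_1)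
      then show False using no \<open>x \<in> F\<close> by blast
    qed
    have "sep (insert x F)"
      unfolding sep_def
    proof (intro conjI ballI impI)
      fix a b assume "a \<in> insert x F" "b \<in> insert x F" "a \<noteq> b"
      then show "(\<lambda>i\<in>{..<p}. (a i - b i) / e) \<notin> ?B"
        using F no sym unfolding sep_def by (elim insertE) blast+
    qed (use F x in \<open>auto simp: sep_def\<close>)
    then have "card (insert x F) \<le> card F" by (rule mx)
    then show False using F \<open>x \<notin> F\<close> by (simp add: sep_def)
  qed
  then show ?thesis using that[of F] F bd[OF F] by (auto simp: sep_def)
qed

text \<open>W is a measurable majorant of the supremum over the whole body, and the same function
  for both laws. It comes from an exponential union bound over a net of spacing 1 / 2: the supremum
  is at most the maximum over the net plus half of itself, which costs a factor 2.\<close>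

lemma exp_body_avg_bound:
  fixes P Q :: "(nat \<Rightarrow> real) measure"
  assumes "prob_space P" "prob_space Q" and sets: "sets P = sets (borel_vec p)" "sets Q = sets (borel_vec p)"
    and t: "0 < t" and c: "1 < c" and R: "0 < R" and n: "1 \<le> n" and pn: "real p \<le> C0 * real n"
  obtains W :: "(nat \<Rightarrow> nat \<Rightarrow> real) \<Rightarrow> real" where
    "W \<in> borel_measurable (Pi\<^sub>M {..<n} (\<lambda>_. borel_vec p))"
    "\<And>X. 0 \<le> W X"
    "\<And>X \<theta>. \<theta> \<in> exp_body p t c R P Q \<Longrightarrow> (\<Sum>i<n. \<bar>dot p \<theta> (X i)\<bar>) / real n \<le> W X"
    "(\<integral>\<^sup>+X. ennreal (W X) \<partial>Pi\<^sub>M {..<n} (\<lambda>_. P)) \<le> ennreal (2 * t * (C0 * ln 5 + ln c + 1))"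
    "(\<integral>\<^sup>+X. ennreal (W X) \<partial>Pi\<^sub>M {..<n} (\<lambda>_. Q)) \<le> ennreal (2 * t * (C0 * ln 5 + ln c + 1))"
proof -
  let ?B = "exp_body p t c R P Q"
  interpret P: prob_space P by fact
  interpret Q: prob_space Q by fact
  have C0: "0 \<le> C0" using pn n by (smt (verit) mult_neg_pos of_nat_0_le_iff of_nat_0_less_iff less_le_trans zero_less_one)
  obtain F where F: "finite F" "F \<subseteq> ?B" "real (card F) \<le> (1 + 2 / (1/2)) ^ p"
    "\<And>x. x \<in> ?B \<Longrightarrow> \<exists>y\<in>F. (\<lambda>i\<in>{..<p}. (x i - y i) / (1/2)) \<in> ?B"
    using exp_body_net[OF assms(1-7), of "1/2" ?B] by auto
  \<comment> \<open>exp (n a) bounds 5^p c^n, the expected sum over the net: 5 = 1 + 2 / (1 / 2)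
    comes from the size of the net, c from each row, and p is at most C0 n.\<close>
  define a where "a = C0 * ln 5 + ln c"
  have a: "0 \<le> a" using C0 c by (simp add: a_def)
  \<comment> \<open>From y \<le> n a + exp (y - n a) with y equal to n / t times the average at
    \<theta>. The exponential is bounded by its sum over the net, and the expectation of each
    summand factorizes over the rows.\<close>
  define V where "V X = t * a + t / real n * exp (- (real n * a)) * (\<Sum>\<theta>\<in>F. \<Prod>i<n. exp (\<bar>dot p \<theta> (X i)\<bar> / t))" for X :: "nat \<Rightarrow> nat \<Rightarrow> real"
  have V0: "0 \<le> V X" for X unfolding V_def using t a
    by (intro add_nonneg_nonneg mult_nonneg_nonneg sum_nonneg prod_nonneg) auto
  have Vm: "V \<in> borel_measurable (Pi\<^sub>M {..<n} (\<lambda>_. borel_vec p))"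
    unfolding V_def[abs_def] by measurable
  define q where "q X \<theta> = (\<Sum>i<n. \<bar>dot p \<theta> (X i)\<bar>) / real n" for X \<theta>
  have qV: "q X \<theta> \<le> V X" if "\<theta> \<in> F" for X \<theta>
  proof -
    let ?y = "real n * q X \<theta> / t"
    have "?y = (\<Sum>i<n. \<bar>dot p \<theta> (X i)\<bar>) / t" using n by (simp add: q_def)
    then have "?y = (\<Sum>i<n. \<bar>dot p \<theta> (X i)\<bar> / t)" by (simp only: sum_divide_distrib)
    then have e: "exp ?y = (\<Prod>i<n. exp (\<bar>dot p \<theta> (X i)\<bar> / t))" by (simp add: exp_sum)
    also have "\<dots> \<le> (\<Sum>\<theta>\<in>F. \<Prod>i<n. exp (\<bar>dot p \<theta> (X i)\<bar> / t))"
      using F that by (intro member_le_sum prod_nonneg) auto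
    finally have e: "exp ?y \<le> (\<Sum>\<theta>\<in>F. \<Prod>i<n. exp (\<bar>dot p \<theta> (X i)\<bar> / t))" .
    have "?y - real n * a \<le> exp (?y - real n * a)" using exp_ge_add_one_self[of "?y - real n * a"] by linarith
    also have "\<dots> = exp (- (real n * a)) * exp ?y" by (simp add: exp_add[symmetric])
    also have "\<dots> \<le> exp (- (real n * a)) * (\<Sum>\<theta>\<in>F. \<Prod>i<n. exp (\<bar>dot p \<theta> (X i)\<bar> / t))"
      using e by simp
    finally have "t / real n * (?y - real n * a) \<le> t / real n * (exp (- (real n * a)) * (\<Sum>\<theta>\<in>F. \<Prod>i<n. exp (\<bar>dot p \<theta> (X i)\<bar> / t)))"
      using t by (intro mult_left_mono) auto
    moreover have "t / real n * (?y - real n * a) = q X \<theta> - t * a" using n t by (simp add: field_simps)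
    ultimately show ?thesis by (simp add: V_def mult.assoc)
  qed
  have qW: "q X \<theta> \<le> 2 * V X" if th: "\<theta> \<in> ?B" for X \<theta>
  proof -
    \<comment> \<open>For fixed X the supremum is finite, which allows half of it to be
      absorbed.\<close>
    have bdd: "bdd_above (q X ` ?B)"
    proof (rule bdd_aboveI2)
      fix \<theta> assume th: "\<theta> \<in> ?B"
      show "q X \<theta> \<le> (\<Sum>i<n. \<Sum>j<p. R * \<bar>X i j\<bar>) / real n"
        unfolding q_def dot_def
      proof (intro divide_right_mono sum_mono)
        fix i
        show "\<bar>\<Sum>j<p. \<theta> j * X i j\<bar> \<le> (\<Sum>j<p. R * \<bar>X i j\<bar>)"
        proof (rule order_trans[OF sum_abs], rule sum_mono)
          fix j assume "j \<in> {..<p}"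
          then have "\<bar>\<theta> j\<bar> \<le> R" using coord_le_L2[of j p \<theta>] th by (auto simp: exp_body_def)
          then show "\<bar>\<theta> j * X i j\<bar> \<le> R * \<bar>X i j\<bar>" by (simp add: abs_mult mult_right_mono)
        qed
      qed auto
    qed
    let ?s = "SUP \<theta>\<in>?B. q X \<theta>"
    have "?s \<le> V X + ?s / 2"
    proof (rule cSUP_least)
      show "?B \<noteq> {}" using th by auto
      fix x assume x: "x \<in> ?B"
      obtain y where y: "y \<in> F" "(\<lambda>i\<in>{..<p}. (x i - y i) / (1/2)) \<in> ?B" using F(4)[OF x] by auto
      have "dot p x v = dot p y v + dot p (\<lambda>i\<in>{..<p}. (x i - y i) / (1/2)) v / 2" for v
        by (simp add: dot_def sum_divide_distrib sum.distrib[symmetric] field_simps)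
      then have "\<bar>dot p x v\<bar> \<le> \<bar>dot p y v\<bar> + \<bar>dot p (\<lambda>i\<in>{..<p}. (x i - y i) / (1/2)) v\<bar> / 2" for v
        by (smt (verit) abs_triangle_ineq field_sum_of_halves abs_divide)
      then have "q X x \<le> (\<Sum>i<n. \<bar>dot p y (X i)\<bar> + \<bar>dot p (\<lambda>i\<in>{..<p}. (x i - y i) / (1/2)) (X i)\<bar> / 2) / real n"
        unfolding q_def by (intro divide_right_mono sum_mono) auto
      also have "\<dots> = q X y + q X (\<lambda>i\<in>{..<p}. (x i - y i) / (1/2)) / 2"
        by (simp add: q_def sum.distrib sum_divide_distrib add_divide_distrib mult.commute)
      also have "\<dots> \<le> V X + ?s / 2"
        using qV[OF y(1)] cSUP_upper[OF y(2) bdd] by (intro add_mono divide_right_mono) auto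
      finally show "q X x \<le> V X + ?s / 2" .
    qed
    then show ?thesis using cSUP_upper[OF th bdd] by linarith
  qed
  have int: "(\<integral>\<^sup>+X. ennreal (2 * V X) \<partial>Pi\<^sub>M {..<n} (\<lambda>_. P')) \<le> ennreal (2 * t * (a + 1))"
    if "prob_space P'" and sP [measurable_cong]: "sets P' = sets (borel_vec p)"
      and b: "\<And>\<theta>. \<theta> \<in> F \<Longrightarrow> (\<integral>\<^sup>+x. ennreal (exp (\<bar>dot p \<theta> x\<bar> / t)) \<partial>P') \<le> ennreal c" for P'
  proof -
    interpret P': prob_space P' by fact
    interpret product_sigma_finite "\<lambda>_::nat. P'" by standard
    interpret pn: prob_space "Pi\<^sub>M {..<n} (\<lambda>_. P')" by (rule prob_space_PiM) (rule that(1))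
    have card: "real (card F) * c ^ n \<le> exp (real n * a)"
    proof -
      have "real (card F) \<le> 5 ^ p" using F(3) by simp
      also have "\<dots> = exp (real p * ln 5)" by (simp add: exp_of_nat_mult)
      also have "\<dots> \<le> exp (C0 * real n * ln 5)" using pn by (simp add: mult_right_mono)
      finally have "real (card F) * c ^ n \<le> exp (C0 * real n * ln 5) * exp (real n * ln c)"
        using c by (intro mult_mono) (auto simp: exp_of_nat_mult)
      also have "\<dots> = exp (real n * a)" by (simp add: a_def exp_add[symmetric] algebra_simps)
      finally show ?thesis .
    qed
    have "(\<integral>\<^sup>+X. ennreal (\<Sum>\<theta>\<in>F. \<Prod>i<n. exp (\<bar>dot p \<theta> (X i)\<bar> / t)) \<partial>Pi\<^sub>M {..<n} (\<lambda>_. P'))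
        = (\<integral>\<^sup>+X. (\<Sum>\<theta>\<in>F. \<Prod>i<n. ennreal (exp (\<bar>dot p \<theta> (X i)\<bar> / t))) \<partial>Pi\<^sub>M {..<n} (\<lambda>_. P'))"
      by (intro nn_integral_cong) (simp add: prod_ennreal prod_nonneg)
    also have "\<dots> = (\<Sum>\<theta>\<in>F. \<integral>\<^sup>+X. (\<Prod>i<n. ennreal (exp (\<bar>dot p \<theta> (X i)\<bar> / t))) \<partial>Pi\<^sub>M {..<n} (\<lambda>_. P'))"
      by (intro nn_integral_sum) measurable
    also have "\<dots> = (\<Sum>\<theta>\<in>F. \<Prod>i<n. \<integral>\<^sup>+x. ennreal (exp (\<bar>dot p \<theta> x\<bar> / t)) \<partial>P')"
      by (intro sum.cong refl product_nn_integral_prod) auto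
    also have "\<dots> \<le> (\<Sum>\<theta>\<in>F. \<Prod>i<n. ennreal c)"
      by (intro sum_mono) (simp add: b power_mono_ennreal)
    also have "\<dots> = ennreal (real (card F) * c ^ n)"
      using c by (simp add: ennreal_mult ennreal_of_nat_eq_real_of_nat ennreal_power)
    also have "\<dots> \<le> ennreal (exp (real n * a))" using card by (rule ennreal_leI)
    finally have i1: "(\<integral>\<^sup>+X. ennreal (\<Sum>\<theta>\<in>F. \<Prod>i<n. exp (\<bar>dot p \<theta> (X i)\<bar> / t)) \<partial>Pi\<^sub>M {..<n} (\<lambda>_. P')) \<le> ennreal (exp (real n * a))" .
    have s0: "0 \<le> (\<Sum>\<theta>\<in>F. \<Prod>i<n. exp (\<bar>dot p \<theta> (X i)\<bar> / t))" for X :: "nat \<Rightarrow> nat \<Rightarrow> real"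
      by (intro sum_nonneg prod_nonneg) auto
    let ?k = "2 * (t / real n * exp (- (real n * a)))"
    have k0: "0 \<le> ?k" using t by simp
    have ta: "0 \<le> 2 * t * a" using t a by simp
    have en: "ennreal (A + k * e) = ennreal A + ennreal k * ennreal e" if "0 \<le> A" "0 \<le> k" "0 \<le> e" for A k e :: real
      using that by (simp add: ennreal_mult)
    have eV: "2 * V X = 2 * t * a + ?k * (\<Sum>\<theta>\<in>F. \<Prod>i<n. exp (\<bar>dot p \<theta> (X i)\<bar> / t))" for X
      unfolding V_def by (simp only: distrib_left mult.assoc)
    have "(\<integral>\<^sup>+X. ennreal (2 * V X) \<partial>Pi\<^sub>M {..<n} (\<lambda>_. P')) =
      (\<integral>\<^sup>+X. ennreal (2 * t * a) + ennreal ?k * ennreal (\<Sum>\<theta>\<in>F. \<Prod>i<n. exp (\<bar>dot p \<theta> (X i)\<bar> / t)) \<partial>Pi\<^sub>M {..<n} (\<lambda>_. P'))"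
      unfolding eV en[OF ta k0 s0] ..
    also have "\<dots> = ennreal (2 * t * a) + ennreal ?k * (\<integral>\<^sup>+X. ennreal (\<Sum>\<theta>\<in>F. \<Prod>i<n. exp (\<bar>dot p \<theta> (X i)\<bar> / t)) \<partial>Pi\<^sub>M {..<n} (\<lambda>_. P'))"
      by (simp add: nn_integral_add nn_integral_cmult pn.emeasure_space_1)
    also have "\<dots> \<le> ennreal (2 * t * a) + ennreal ?k * ennreal (exp (real n * a))"
      by (intro add_left_mono mult_left_mono i1) auto
    also have "\<dots> = ennreal (2 * t * a + ?k * exp (real n * a))"
      by (rule en[symmetric, OF ta k0]) simp
    also have "?k * exp (real n * a) = 2 * (t / real n)" by (simp add: exp_add[symmetric] mult.assoc)
    also have "ennreal (2 * t * a + 2 * (t / real n)) \<le> ennreal (2 * t * (a + 1))"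
      using t n by (intro ennreal_leI) (simp add: field_simps)
    finally show ?thesis .
  qed
  show ?thesis
  proof (rule that[of "\<lambda>X. 2 * V X"])
    show "(\<lambda>X. 2 * V X) \<in> borel_measurable (Pi\<^sub>M {..<n} (\<lambda>_. borel_vec p))" using Vm by measurable
    show "0 \<le> 2 * V X" for X using V0[of X] by simp
    show "(\<Sum>i<n. \<bar>dot p \<theta> (X i)\<bar>) / real n \<le> 2 * V X" if "\<theta> \<in> ?B" for X \<theta>
      using qW[OF that, of X] by (simp add: q_def)
    show "(\<integral>\<^sup>+X. ennreal (2 * V X) \<partial>Pi\<^sub>M {..<n} (\<lambda>_. P)) \<le> ennreal (2 * t * (C0 * ln 5 + ln c + 1))"
      using int[OF assms(1) sets(1)] F(2) by (auto simp: a_def exp_body_def)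
    show "(\<integral>\<^sup>+X. ennreal (2 * V X) \<partial>Pi\<^sub>M {..<n} (\<lambda>_. Q)) \<le> ennreal (2 * t * (C0 * ln 5 + ln c + 1))"
      using int[OF assms(2) sets(2)] F(2) by (auto simp: a_def exp_body_def)
  qed
qed

section \<open>Trigonometric functions of linear forms\<close>

text \<open>Membership of u in \<tau> S. Only coordinates below p are compared, so that u can be
  formed by arithmetic without restoring extensionality.\<close>

definition freq :: "nat \<Rightarrow> (nat \<Rightarrow> real) set \<Rightarrow> real \<Rightarrow> (nat \<Rightarrow> real) \<Rightarrow> bool"
  where "freq p S \<tau> u \<longleftrightarrow> 0 \<le> \<tau> \<and> (\<exists>s\<in>S. \<forall>i<p. u i = \<tau> * s i)"

lemma freq_memI: "s \<in> S \<Longrightarrow> freq p S 1 s"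
  by (auto simp: freq_def)

lemma freq_minus:
  assumes "symmetric_convex p S" "freq p S \<tau> u"
  shows "freq p S \<tau> (\<lambda>i. - u i)"
proof -
  obtain s where s: "s \<in> S" "\<forall>i<p. u i = \<tau> * s i" "0 \<le> \<tau>" using assms(2) by (auto simp: freq_def)
  then have "(\<lambda>i\<in>{..<p}. - s i) \<in> S" using assms(1) by (auto simp: symmetric_convex_def)
  then show ?thesis using s unfolding freq_def by (intro conjI bexI) auto
qed

lemma freq_scale:
  assumes "symmetric_convex p S" "freq p S \<tau> u"
  shows "freq p S (\<bar>a\<bar> * \<tau>) (\<lambda>i. a * u i)"
proof -
  have pos: "freq p S (b * \<tau>) (\<lambda>i. b * u i)" if "0 \<le> b" for b
    using assms(2) that by (auto simp: freq_def)
  show ?thesis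
  proof (cases "0 \<le> a")
    case True then show ?thesis using pos[of a] by simp
  next
    case False
    then have "freq p S (\<bar>a\<bar> * \<tau>) (\<lambda>i. - (\<bar>a\<bar> * u i))" by (intro freq_minus assms(1) pos) simp
    then show ?thesis using False by simp
  qed
qed

text \<open>Here convexity of S enters: \<tau> s + \<tau>' s' is \<tau> + \<tau>' times a convex
  combination of s and s'.\<close>

lemma freq_add:
  assumes "symmetric_convex p S" "freq p S \<tau> u" "freq p S \<tau>' u'"
  shows "freq p S (\<tau> + \<tau>') (\<lambda>i. u i + u' i)"
proof -
  obtain s where s: "s \<in> S" "\<forall>i<p. u i = \<tau> * s i" "0 \<le> \<tau>" using assms(2) by (auto simp: freq_def)
  obtain s' where s': "s' \<in> S" "\<forall>i<p. u' i = \<tau>' * s' i" "0 \<le> \<tau>'" using assms(3) by (auto simp: freq_def)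
  show ?thesis
  proof (cases "\<tau> + \<tau>' = 0")
    case True
    then have "\<tau> = 0" "\<tau>' = 0" using s s' by auto
    then show ?thesis using s s' by (auto simp: freq_def)
  next
    case False
    then have pos: "0 < \<tau> + \<tau>'" using s s' by auto
    let ?t = "\<tau>' / (\<tau> + \<tau>')"
    have t: "?t \<in> {0..1}" using pos s s' by auto
    then have m: "(\<lambda>i\<in>{..<p}. (1 - ?t) * s i + ?t * s' i) \<in> S"
      using assms(1) s s' unfolding symmetric_convex_def by blast
    have "u i + u' i = (\<tau> + \<tau>') * ((1 - ?t) * s i + ?t * s' i)" if "i < p" for i
    proof -
      have "(\<tau> + \<tau>') * (1 - ?t) = \<tau>" "(\<tau> + \<tau>') * ?t = \<tau>'" using pos by (simp_all add: field_simps)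
      then show ?thesis using s s' that by (simp only: distrib_left mult.assoc[symmetric])
    qed
    then show ?thesis using m pos unfolding freq_def by (intro conjI bexI[OF _ m]) auto
  qed
qed

lemma freq_zero:
  assumes "symmetric_convex p S" "S \<noteq> {}" "0 \<le> \<tau>"
  shows "freq p S \<tau> (\<lambda>_. 0)"
proof -
  obtain s where s: "s \<in> S" using assms(2) by auto
  have "freq p S (1 + 1) (\<lambda>i. s i + - s i)"
    by (intro freq_add freq_minus assms(1) freq_memI s)
  then have "freq p S (\<bar>\<tau> / 2\<bar> * 2) (\<lambda>i. \<tau> / 2 * 0)"
    by (intro freq_scale assms(1)) simp
  then show ?thesis using assms(3) by simp
qed

text \<open>The missing scale \<tau>' - \<tau> is supplied by the zero vector, which a nonempty
  symmetric convex set contains.\<close>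

lemma freq_mono:
  assumes "symmetric_convex p S" "freq p S \<tau> u" "\<tau> \<le> \<tau>'"
  shows "freq p S \<tau>' u"
proof -
  have "S \<noteq> {}" using assms(2) by (auto simp: freq_def)
  then show ?thesis
    using freq_add[OF assms(1,2) freq_zero[OF assms(1), of "\<tau>' - \<tau>"]] assms(3) by simp
qed

text \<open>Sums of cosines whose absolute coefficients add up to at most c. The number of terms is
  left out on purpose: c alone controls the sup norm and the difference of two expectations, and it
  does not grow when such sums are averaged. The phase makes sines members, and the frequency 0
  makes constants members.\<close>

inductive trig :: "nat \<Rightarrow> (nat \<Rightarrow> real) set \<Rightarrow> real \<Rightarrow> real \<Rightarrow> ((nat \<Rightarrow> real) \<Rightarrow> real) \<Rightarrow> bool" for p S \<tau>
  where
    trig_cos: "freq p S \<tau> u \<Longrightarrow> \<bar>a\<bar> \<le> c \<Longrightarrow> trig p S \<tau> c (\<lambda>x. a * cos (dot p u x + s))"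
  | trig_add: "trig p S \<tau> c f \<Longrightarrow> trig p S \<tau> c' g \<Longrightarrow> trig p S \<tau> (c + c') (\<lambda>x. f x + g x)"

lemma trig_bounded: "trig p S \<tau> c f \<Longrightarrow> \<bar>f x\<bar> \<le> c"
proof (induction rule: trig.induct)
  case (trig_cos u a c s)
  then show ?case
    using mult_mono[OF trig_cos(2) abs_cos_le_one[of "dot p u x + s"]] by (simp add: abs_mult)
qed auto

lemma trig_measurable: "trig p S \<tau> c f \<Longrightarrow> f \<in> borel_measurable (borel_vec p)"
proof (induction rule: trig.induct)
qed measurable

lemma trig_freq_mono:
  assumes "symmetric_convex p S" "\<tau> \<le> \<tau>'"
  shows "trig p S \<tau> c f \<Longrightarrow> trig p S \<tau>' c f"
  by (induction rule: trig.induct) (auto intro: trig.intros freq_mono[OF assms(1) _ assms(2)])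

lemma trig_const:
  assumes "symmetric_convex p S" "S \<noteq> {}" "0 \<le> \<tau>" "\<bar>a\<bar> \<le> c"
  shows "trig p S \<tau> c (\<lambda>_. a)"
  using trig_cos[OF freq_zero[OF assms(1-3)] assms(4), of 0] by (simp add: dot_def)

text \<open>Product-to-sum formulas: the scales of the frequencies add up, the coefficient sums
  multiply.\<close>

lemma trig_mult:
  assumes sc: "symmetric_convex p S" and g: "trig p S \<tau>' c' g"
  shows "trig p S \<tau> c f \<Longrightarrow> trig p S (\<tau> + \<tau>') (c * c') (\<lambda>x. f x * g x)"
proof (induction rule: trig.induct)
  case (trig_cos u a c s)
  from g show ?case
  proof (induction rule: trig.induct)
    case (trig_cos u' a' c' s')
    have ac: "\<bar>a * a' / 2\<bar> \<le> c * c' / 2"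
      using mult_mono[OF \<open>\<bar>a\<bar> \<le> c\<close> \<open>\<bar>a'\<bar> \<le> c'\<close>] \<open>\<bar>a\<bar> \<le> c\<close> by (simp add: abs_mult)
    have "freq p S (\<tau> + \<tau>') (\<lambda>i. u i + u' i)" "freq p S (\<tau> + \<tau>') (\<lambda>i. u i + - u' i)"
      by (intro freq_add freq_minus sc trig_cos(1) \<open>freq p S \<tau> u\<close>)+
    then have "trig p S (\<tau> + \<tau>') (c * c' / 2 + c * c' / 2)
       (\<lambda>x. a * a' / 2 * cos (dot p (\<lambda>i. u i + - u' i) x + (s - s')) + a * a' / 2 * cos (dot p (\<lambda>i. u i + u' i) x + (s + s')))"
      by (intro trig_add trig.trig_cos ac)
    moreover have "a * a' / 2 * cos (dot p (\<lambda>i. u i + - u' i) x + (s - s')) + a * a' / 2 * cos (dot p (\<lambda>i. u i + u' i) x + (s + s'))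
        = a * cos (dot p u x + s) * (a' * cos (dot p u' x + s'))" for x
    proof -
      have "dot p (\<lambda>i. u i + - u' i) x + (s - s') = (dot p u x + s) - (dot p u' x + s')"
        "dot p (\<lambda>i. u i + u' i) x + (s + s') = (dot p u x + s) + (dot p u' x + s')"
        by (simp_all add: dot_def sum_subtractf sum.distrib algebra_simps)
      then show ?thesis by (simp only: cos_diff cos_add) (simp add: algebra_simps)
    qed
    ultimately show ?case by (simp add: mult.commute[of c' c])
  next
    case (trig_add c1 f1 c2 f2)
    from trig.trig_add[OF trig_add.IH] show ?case by (simp add: distrib_left)
  qed
next
  case (trig_add c1 f1 c2 f2)
  from trig.trig_add[OF trig_add.IH] show ?case by (simp add: distrib_right)
qed

lemma trig_cmult:
  assumes "symmetric_convex p S" "S \<noteq> {}" "trig p S \<tau> c f"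
  shows "trig p S \<tau> (\<bar>a\<bar> * c) (\<lambda>x. a * f x)"
  using trig_mult[OF assms(1,3) trig_const[OF assms(1,2), of 0 a "\<bar>a\<bar>"]] by simp

lemma trig_sum:
  assumes "symmetric_convex p S" "S \<noteq> {}" "0 \<le> \<tau>" "finite D" "\<And>i. i \<in> D \<Longrightarrow> trig p S \<tau> (c i) (f i)"
  shows "trig p S \<tau> (\<Sum>i\<in>D. c i) (\<lambda>x. \<Sum>i\<in>D. f i x)"
  using assms(4,5)
proof (induction rule: finite_induct)
  case empty then show ?case using trig_const[OF assms(1-3), of 0 0] by simp
next
  case (insert i D)
  then show ?case by (simp add: trig_add)
qed

text \<open>What matters is the order of the quantifiers: \<tau>' and c' depend on q, \<tau> and c
  only and serve every dimension, every S and every f.\<close>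

lemma trig_polynomial:
  assumes "real_polynomial_function q" "0 \<le> \<tau>" "0 \<le> c"
  shows "\<exists>\<tau>'\<ge>0. \<exists>c'\<ge>0. \<forall>p S f. symmetric_convex p S \<longrightarrow> S \<noteq> {} \<longrightarrow> trig p S \<tau> c f \<longrightarrow> trig p S \<tau>' c' (\<lambda>x. q (f x))"
  using assms(1)
proof induction
  case (linear h)
  then obtain a where h: "h = (\<lambda>x. x * a)" using real_bounded_linear by auto
  show ?case
    using trig_cmult[where a=a] assms(2,3)
    by (intro exI[of _ \<tau>] conjI exI[of _ "\<bar>a\<bar> * c"]) (auto simp: h mult.commute[of _ a])
next
  case (const a)
  show ?case by (intro exI[of _ "0::real"] conjI exI[of _ "\<bar>a\<bar>"]) (auto intro: trig_const)
next
  case (add f g)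
  obtain \<tau>1 c1 where 1: "0 \<le> \<tau>1" "0 \<le> c1" "\<And>p S h. symmetric_convex p S \<Longrightarrow> S \<noteq> {} \<Longrightarrow> trig p S \<tau> c h \<Longrightarrow> trig p S \<tau>1 c1 (\<lambda>x. f (h x))"
    using add.IH(1) by metis
  obtain \<tau>2 c2 where 2: "0 \<le> \<tau>2" "0 \<le> c2" "\<And>p S h. symmetric_convex p S \<Longrightarrow> S \<noteq> {} \<Longrightarrow> trig p S \<tau> c h \<Longrightarrow> trig p S \<tau>2 c2 (\<lambda>x. g (h x))"
    using add.IH(2) by metis
  have "trig p S (\<tau>1 + \<tau>2) (c1 + c2) (\<lambda>x. f (h x) + g (h x))"
    if "symmetric_convex p S" "S \<noteq> {}" "trig p S \<tau> c h" for p S h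
    using 1(1) 2(1) by (intro trig_add trig_freq_mono[OF that(1) _ 1(3)[OF that]] trig_freq_mono[OF that(1) _ 2(3)[OF that]]) auto
  then show ?case using 1 2 by (intro exI[of _ "\<tau>1 + \<tau>2"] conjI exI[of _ "c1 + c2"]) auto
next
  case (mult f g)
  obtain \<tau>1 c1 where 1: "0 \<le> \<tau>1" "0 \<le> c1" "\<And>p S h. symmetric_convex p S \<Longrightarrow> S \<noteq> {} \<Longrightarrow> trig p S \<tau> c h \<Longrightarrow> trig p S \<tau>1 c1 (\<lambda>x. f (h x))"
    using mult.IH(1) by metis
  obtain \<tau>2 c2 where 2: "0 \<le> \<tau>2" "0 \<le> c2" "\<And>p S h. symmetric_convex p S \<Longrightarrow> S \<noteq> {} \<Longrightarrow> trig p S \<tau> c h \<Longrightarrow> trig p S \<tau>2 c2 (\<lambda>x. g (h x))"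
    using mult.IH(2) by metis
  have "trig p S (\<tau>1 + \<tau>2) (c1 * c2) (\<lambda>x. f (h x) * g (h x))"
    if "symmetric_convex p S" "S \<noteq> {}" "trig p S \<tau> c h" for p S h
    by (intro trig_mult that(1) 1(3)[OF that] 2(3)[OF that])
  then show ?case using 1 2 by (intro exI[of _ "\<tau>1 + \<tau>2"] conjI exI[of _ "c1 * c2"]) auto
qed

text \<open>Polynomials in these coordinates are bounded on the whole space and are trigonometric
  sums of linear forms; L stretches the period so that the map is injective on a prescribed
  box.\<close>

definition sin_coords :: "real \<Rightarrow> (real ^ 'k) \<times> real \<Rightarrow> (real ^ 'k) \<times> real"
  where "sin_coords L z = ((\<chi> j. sin (fst z $ j / L)), sin (snd z / L))"

text \<open>Again \<tau> and c are independent of p, S, \<Theta> and e. The last coordinate carries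
  the fixed noise, so it contributes only constants to the function of x.\<close>

lemma trig_polynomial_sin:
  fixes P :: "(real ^ 'k::finite) \<times> real \<Rightarrow> real"
  assumes "real_polynomial_function P" "0 < L"
  shows "\<exists>\<tau>\<ge>0. \<exists>c\<ge>0. \<forall>p S (\<Theta> :: 'k \<Rightarrow> nat \<Rightarrow> real) e. symmetric_convex p S \<longrightarrow> (\<forall>j. \<Theta> j \<in> S) \<longrightarrow>
    trig p S \<tau> c (\<lambda>x. P (sin_coords L (tmat_vec p \<Theta> x, e)))"
  using assms(1)
proof induction
  case (linear h)
  interpret h: bounded_linear h by fact
  define a where "a j = h (axis j 1, 0)" for j
  define b where "b = h (0, 1)"
  have h: "h (y, z) = (\<Sum>j\<in>UNIV. a j * y $ j) + b * z" for y z
  proof -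
    have y: "y = (\<Sum>j\<in>UNIV. (y $ j) *\<^sub>R axis j 1)"
      by (simp add: vec_eq_iff axis_def if_distrib[where f="\<lambda>x. _ * x"] cong: if_cong)
    have "(y, z) = (\<Sum>j\<in>UNIV. (y $ j) *\<^sub>R (axis j 1, 0)) + z *\<^sub>R (0, 1)"
      by (subst (1) y) (simp add: sum_prod prod_eq_iff fst_sum snd_sum)
    then have "h (y, z) = (\<Sum>j\<in>UNIV. (y $ j) *\<^sub>R h (axis j 1, 0)) + z *\<^sub>R h (0, 1)"
      by (simp only: h.add h.sum h.scaleR)
    then show ?thesis by (simp add: a_def b_def mult.commute)
  qed
  have "trig p S (1 / L) ((\<Sum>j\<in>UNIV. \<bar>a j\<bar> * 1) + \<bar>b\<bar>) (\<lambda>x. h (sin_coords L (tmat_vec p \<Theta> x, e)))"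
    if sc: "symmetric_convex p S" and \<Theta>: "\<forall>j. \<Theta> j \<in> S" for p S and \<Theta> :: "'k \<Rightarrow> nat \<Rightarrow> real" and e
  proof -
    have ne: "S \<noteq> {}" using \<Theta> by auto
    have L: "0 \<le> 1 / L" using assms(2) by simp
    have c: "trig p S (1 / L) 1 (\<lambda>x. sin (dot p (\<Theta> j) x / L))" for j
    proof -
      have "freq p S (\<bar>1 / L\<bar> * 1) (\<lambda>i. 1 / L * \<Theta> j i)"
        by (intro freq_scale sc freq_memI) (use \<Theta> in auto)
      \<comment> \<open>The sine as a cosine with phase - pi / 2.\<close>
      then have "trig p S (1 / L) 1 (\<lambda>x. 1 * cos (dot p (\<lambda>i. 1 / L * \<Theta> j i) x + (- (pi / 2))))"
        using assms(2) by (intro trig_cos) auto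
      moreover have "1 * cos (dot p (\<lambda>i. 1 / L * \<Theta> j i) x + (- (pi / 2))) = sin (dot p (\<Theta> j) x / L)" for x
      proof -
        have "dot p (\<lambda>i. 1 / L * \<Theta> j i) x = dot p (\<Theta> j) x / L"
          by (simp add: dot_def sum_divide_distrib)
        then show ?thesis by (simp add: cos_diff)
      qed
      ultimately show ?thesis by simp
    qed
    have t: "trig p S (1 / L) ((\<Sum>j\<in>UNIV. \<bar>a j\<bar> * 1) + \<bar>b\<bar>)
       (\<lambda>x. (\<Sum>j\<in>UNIV. a j * sin (dot p (\<Theta> j) x / L)) + b * sin (e / L))"
    proof (intro trig_add trig_sum trig_const trig_cmult sc ne L c)
      show "\<bar>b * sin (e / L)\<bar> \<le> \<bar>b\<bar>"
        using mult_left_mono[OF abs_sin_le_one[of "e / L"], of "\<bar>b\<bar>"] by (simp add: abs_mult)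
    qed simp
    then show ?thesis by (simp add: sin_coords_def h tmat_vec_def)
  qed
  then show ?case using assms(2)
    by (intro exI[of _ "1 / L"] conjI exI[of _ "(\<Sum>j\<in>UNIV. \<bar>a j\<bar> * 1) + \<bar>b\<bar>"]) (auto intro!: add_nonneg_nonneg sum_nonneg)
next
  case (const a)
  show ?case by (intro exI[of _ "0::real"] conjI exI[of _ "\<bar>a\<bar>"]) (auto intro!: trig_const)
next
  case (add f g)
  obtain \<tau>1 c1 where 1: "0 \<le> \<tau>1" "0 \<le> c1" "\<And>p S (\<Theta> :: 'k \<Rightarrow> nat \<Rightarrow> real) e. symmetric_convex p S \<Longrightarrow> (\<forall>j. \<Theta> j \<in> S) \<Longrightarrow>
    trig p S \<tau>1 c1 (\<lambda>x. f (sin_coords L (tmat_vec p \<Theta> x, e)))"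
    using add.IH(1) by metis
  obtain \<tau>2 c2 where 2: "0 \<le> \<tau>2" "0 \<le> c2" "\<And>p S (\<Theta> :: 'k \<Rightarrow> nat \<Rightarrow> real) e. symmetric_convex p S \<Longrightarrow> (\<forall>j. \<Theta> j \<in> S) \<Longrightarrow>
    trig p S \<tau>2 c2 (\<lambda>x. g (sin_coords L (tmat_vec p \<Theta> x, e)))"
    using add.IH(2) by metis
  have "trig p S (\<tau>1 + \<tau>2) (c1 + c2) (\<lambda>x. f (sin_coords L (tmat_vec p \<Theta> x, e)) + g (sin_coords L (tmat_vec p \<Theta> x, e)))"
    if "symmetric_convex p S" "\<forall>j. \<Theta> j \<in> S" for p S and \<Theta> :: "'k \<Rightarrow> nat \<Rightarrow> real" and e
    using 1(1) 2(1) by (intro trig_add trig_freq_mono[OF that(1) _ 1(3)[OF that]] trig_freq_mono[OF that(1) _ 2(3)[OF that]]) auto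
  then show ?case using 1 2 by (intro exI[of _ "\<tau>1 + \<tau>2"] conjI exI[of _ "c1 + c2"]) auto
next
  case (mult f g)
  obtain \<tau>1 c1 where 1: "0 \<le> \<tau>1" "0 \<le> c1" "\<And>p S (\<Theta> :: 'k \<Rightarrow> nat \<Rightarrow> real) e. symmetric_convex p S \<Longrightarrow> (\<forall>j. \<Theta> j \<in> S) \<Longrightarrow>
    trig p S \<tau>1 c1 (\<lambda>x. f (sin_coords L (tmat_vec p \<Theta> x, e)))"
    using mult.IH(1) by metis
  obtain \<tau>2 c2 where 2: "0 \<le> \<tau>2" "0 \<le> c2" "\<And>p S (\<Theta> :: 'k \<Rightarrow> nat \<Rightarrow> real) e. symmetric_convex p S \<Longrightarrow> (\<forall>j. \<Theta> j \<in> S) \<Longrightarrow>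
    trig p S \<tau>2 c2 (\<lambda>x. g (sin_coords L (tmat_vec p \<Theta> x, e)))"
    using mult.IH(2) by metis
  have "trig p S (\<tau>1 + \<tau>2) (c1 * c2) (\<lambda>x. f (sin_coords L (tmat_vec p \<Theta> x, e)) * g (sin_coords L (tmat_vec p \<Theta> x, e)))"
    if "symmetric_convex p S" "\<forall>j. \<Theta> j \<in> S" for p S and \<Theta> :: "'k \<Rightarrow> nat \<Rightarrow> real" and e
    by (intro trig_mult that(1) 1(3)[OF that] 2(3)[OF that])
  then show ?case using 1 2 by (intro exI[of _ "\<tau>1 + \<tau>2"] conjI exI[of _ "c1 * c2"]) auto
qed

lemma trig_expectation:
  assumes "prob_space P" "prob_space Q" and sets: "sets P = sets (borel_vec p)" "sets Q = sets (borel_vec p)"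
    and \<Delta>: "\<And>u s. freq p S \<tau> u \<Longrightarrow> \<bar>(\<integral>x. cos (dot p u x + s) \<partial>P) - (\<integral>x. cos (dot p u x + s) \<partial>Q)\<bar> \<le> \<Delta>"
    and f: "trig p S \<tau> c f"
  shows "\<bar>(\<integral>x. f x \<partial>P) - (\<integral>x. f x \<partial>Q)\<bar> \<le> c * \<Delta>"
proof -
  interpret P: prob_space P by fact
  interpret Q: prob_space Q by fact
  note [measurable_cong] = sets
  have integ: "integrable P f" "integrable Q f" if "trig p S \<tau> c f" for c f
  proof -
    have [measurable]: "f \<in> borel_measurable (borel_vec p)" by (rule trig_measurable[OF that])
    show "integrable P f" by (rule P.integrable_const_bound[of _ c]) (auto simp: trig_bounded[OF that])
    show "integrable Q f" by (rule Q.integrable_const_bound[of _ c]) (auto simp: trig_bounded[OF that])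
  qed
  from f show ?thesis
  proof (induction rule: trig.induct)
    case (trig_cos u a c s)
    have "\<bar>(\<integral>x. a * cos (dot p u x + s) \<partial>P) - (\<integral>x. a * cos (dot p u x + s) \<partial>Q)\<bar>
      = \<bar>a\<bar> * \<bar>(\<integral>x. cos (dot p u x + s) \<partial>P) - (\<integral>x. cos (dot p u x + s) \<partial>Q)\<bar>"
      by (simp add: right_diff_distrib[symmetric] abs_mult)
    also have "\<dots> \<le> c * \<Delta>" using trig_cos \<Delta>[OF trig_cos(1)] by (intro mult_mono) auto
    finally show ?case .
  next
    case (trig_add c f c' g)
    then show ?case by (simp add: integ distrib_right)
  qed
qed

text \<open>Weierstrass approximation of h composed with L arcsin on the cube of sines. On the box
  of radius b = L pi / 2 the arcsine undoes the sine. Outside, the argument is folded back to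
  another point of the space, where h still takes values between 0 and 1, so the two bounds on the
  approximation hold everywhere.\<close>

lemma bounded_trig_approx:
  fixes h :: "(real ^ 'k::finite) \<times> real \<Rightarrow> real"
  assumes h: "continuous_on UNIV h" "\<And>z. 0 \<le> h z" "\<And>z. h z \<le> 1"
    and b: "0 < b" and \<delta>: "0 < \<delta>"
  obtains P L where "real_polynomial_function P" "0 < L"
    "\<And>z. - \<delta> \<le> P (sin_coords L z)" "\<And>z. P (sin_coords L z) \<le> 1 + \<delta>"
    "\<And>v e. (\<forall>j. \<bar>v $ j\<bar> \<le> b) \<Longrightarrow> \<bar>e\<bar> \<le> b \<Longrightarrow> \<bar>h (v, e) - P (sin_coords L (v, e))\<bar> \<le> \<delta>"
proof -
  define L where "L = 2 * b / pi"
  have L: "0 < L" using b by (simp add: L_def)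
  let ?C = "cbox (\<chi> j. -1) (\<chi> j. 1) \<times> {-1..1} :: ((real ^ 'k) \<times> real) set"
  define H where "H z = h ((\<chi> j. L * arcsin (fst z $ j)), L * arcsin (snd z))" for z
  have "continuous_on ?C H"
    unfolding H_def
    by (rule continuous_on_compose2[OF h(1)])
       (auto intro!: continuous_intros continuous_on_vec_lambda simp: mem_box_cart)
  moreover have "compact ?C" by (intro compact_Times compact_cbox compact_Icc)
  ultimately obtain P where P: "real_polynomial_function P" "\<And>z. z \<in> ?C \<Longrightarrow> \<bar>H z - P z\<bar> < \<delta>"
    using Stone_Weierstrass_real_polynomial_function \<delta> by metis
  have inC: "sin_coords L z \<in> ?C" for z
    by (auto simp: sin_coords_def mem_box_cart)
  have close: "\<bar>H (sin_coords L z) - P (sin_coords L z)\<bar> < \<delta>" for z using P(2) inC by blast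
  have bnd: "0 \<le> H z" "H z \<le> 1" for z unfolding H_def using h by auto
  have eq: "H (sin_coords L (v, e)) = h (v, e)" if "\<forall>j. \<bar>v $ j\<bar> \<le> b" "\<bar>e\<bar> \<le> b" for v e
  proof -
    have "L * arcsin (sin (x / L)) = x" if "\<bar>x\<bar> \<le> b" for x
    proof -
      have "pi / 2 * L = b" by (simp add: L_def)
      then have "x / L \<le> pi / 2" "- (pi / 2) \<le> x / L"
        using that L by (auto simp: pos_divide_le_eq pos_le_divide_eq abs_le_iff)
      then have "arcsin (sin (x / L)) = x / L" by (rule arcsin_sin[rotated])
      then show ?thesis using L by simp
    qed
    then show ?thesis using that by (simp add: H_def sin_coords_def vec_eq_iff)
  qed
  show ?thesis
  proof (rule that[OF P(1) L])
    show "- \<delta> \<le> P (sin_coords L z)" "P (sin_coords L z) \<le> 1 + \<delta>" for z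
      using close[of z] bnd[of "sin_coords L z"] by (auto simp: abs_less_iff)
    show "\<bar>h (v, e) - P (sin_coords L (v, e))\<bar> \<le> \<delta>" if "\<forall>j. \<bar>v $ j\<bar> \<le> b" "\<bar>e\<bar> \<le> b" for v e
      using close[of "(v, e)"] eq[OF that] by simp
  qed
qed

section \<open>The logarithm of a Gibbs average\<close>

lemma ln_lipschitz_above:
  assumes "0 < \<kappa>" "\<kappa> \<le> a" "\<kappa> \<le> b"
  shows "\<bar>ln a - ln b\<bar> \<le> \<bar>a - b\<bar> / (\<kappa> :: real)"
proof -
  have *: "ln x - ln y \<le> \<bar>x - y\<bar> / \<kappa>" if "\<kappa> \<le> x" "\<kappa> \<le> y" for x y
  proof -
    have "ln x - ln y \<le> (x - y) / y" using that assms(1) by (intro ln_diff_le) auto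
    also have "\<dots> \<le> \<bar>x - y\<bar> / y" using that assms(1) by (intro divide_right_mono) auto
    also have "\<dots> \<le> \<bar>x - y\<bar> / \<kappa>" using that assms(1) by (intro divide_left_mono) auto
    finally show ?thesis .
  qed
  from *[of a b] *[of b a] show ?thesis using assms by (simp add: abs_le_iff abs_minus_commute)
qed

lemma measurable_tmat_vec [measurable]: "tmat_vec p \<Theta> \<in> measurable (borel_vec p) borel"
  by (subst borel_measurable_euclidean_space) (auto simp: Basis_vec_def inner_axis tmat_vec_def)

text \<open>The frequency scale \<tau> and the coefficient c are fixed before p, S, the two laws,
  the finite set and the weights. Gibbs weights depending on all the other rows can therefore be
  inserted, and only the cosines have to be compared.\<close>

lemma log_gibbs_average_universality:
  fixes h :: "(real ^ 'k::finite) \<times> real \<Rightarrow> real"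
  assumes h: "continuous_on UNIV h" "\<And>z. \<kappa> \<le> h z" "\<And>z. h z \<le> 1" and \<kappa>: "0 < \<kappa>"
    and \<eta>: "0 < \<eta>" and m: "0 \<le> m" and b1: "0 < b1"
  obtains \<tau> c where "0 \<le> \<tau>" "0 \<le> c"
    "\<And>p S P Q \<Delta> D w e. symmetric_convex p S \<Longrightarrow> prob_space P \<Longrightarrow> prob_space Q \<Longrightarrow>
      sets P = sets (borel_vec p) \<Longrightarrow> sets Q = sets (borel_vec p) \<Longrightarrow>
      \<forall>u s. freq p S \<tau> u \<longrightarrow> \<bar>(\<integral>x. cos (dot p u x + s) \<partial>P) - (\<integral>x. cos (dot p u x + s) \<partial>Q)\<bar> \<le> \<Delta> \<Longrightarrow>
      finite D \<Longrightarrow> \<forall>\<Theta>\<in>D. 0 \<le> w \<Theta> \<Longrightarrow> sum w D = 1 \<Longrightarrow>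
      \<forall>\<Theta>\<in>D. \<forall>j. \<Theta> j \<in> S \<and> integrable P (dot p (\<Theta> j)) \<and> integrable Q (dot p (\<Theta> j)) \<and>
         (\<integral>x. \<bar>dot p (\<Theta> j) x\<bar> \<partial>P) \<le> m \<and> (\<integral>x. \<bar>dot p (\<Theta> j) x\<bar> \<partial>Q) \<le> m \<Longrightarrow>
      \<bar>e\<bar> \<le> b1 \<Longrightarrow>
      \<bar>(\<integral>x. ln (\<Sum>\<Theta>\<in>D. w \<Theta> * h (tmat_vec p (\<Theta> :: 'k \<Rightarrow> nat \<Rightarrow> real) x, e)) \<partial>P) -
       (\<integral>x. ln (\<Sum>\<Theta>\<in>D. w \<Theta> * h (tmat_vec p \<Theta> x, e)) \<partial>Q)\<bar> \<le> \<eta> + c * \<Delta>"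
proof -
  \<comment> \<open>At most 1, so that the approximate average stays between -1 and 2, where the
    logarithm is replaced by a polynomial; the other entry is divided by \<kappa>, the inverse of
    the Lipschitz constant of the logarithm, later on.\<close>
  define \<delta> where "\<delta> = min 1 (\<kappa> * \<eta> / 8)"
  have \<delta>: "0 < \<delta>" "\<delta> \<le> 1" "\<delta> \<le> \<kappa> * \<eta> / 8" using \<kappa> \<eta> by (auto simp: \<delta>_def)
  let ?k = "real CARD('k)"
  \<comment> \<open>Large enough for \<open>bm\<close>, which bounds the contribution from outside
    the box by first moments, and at least b1, so that the noise lies in the box.\<close>
  define b where "b = max b1 (16 * ?k * (m + 1) / (\<kappa> * \<eta>))"
  have b: "0 < b" "b1 \<le> b" using b1 by (auto simp: b_def)
  have bm: "2 * (?k * (m / b)) \<le> \<kappa> * \<eta> / 8"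
  proof -
    have "16 * ?k * (m + 1) \<le> b * (\<kappa> * \<eta>)"
      using \<kappa> \<eta> max.cobounded2[of "16 * ?k * (m + 1) / (\<kappa> * \<eta>)" b1]
      by (simp add: b_def pos_divide_le_eq[symmetric] del: max.cobounded2)
    then have "16 * ?k * m \<le> b * (\<kappa> * \<eta>)"
      using m by (smt (verit) mult_left_mono of_nat_0_le_iff)
    then show ?thesis using b by (simp add: field_simps)
  qed
  have h0: "0 \<le> h z" for z using h(2)[of z] \<kappa> by linarith
  obtain P0 L where P0: "real_polynomial_function P0" "0 < L"
    "\<And>z. - \<delta> \<le> P0 (sin_coords L z)" "\<And>z. P0 (sin_coords L z) \<le> 1 + \<delta>"
    "\<And>v e. (\<forall>j. \<bar>v $ j\<bar> \<le> b) \<Longrightarrow> \<bar>e\<bar> \<le> b \<Longrightarrow> \<bar>h (v, e) - P0 (sin_coords L (v, e))\<bar> \<le> \<delta>"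
    by (rule bounded_trig_approx[OF h(1) h0 h(3) b(1) \<delta>(1)]) (rule that)
  obtain \<tau>0 c0 where T: "0 \<le> \<tau>0" "0 \<le> c0" "\<And>p S (\<Theta> :: 'k \<Rightarrow> nat \<Rightarrow> real) e. symmetric_convex p S \<Longrightarrow> (\<forall>j. \<Theta> j \<in> S) \<Longrightarrow>
    trig p S \<tau>0 c0 (\<lambda>x. P0 (sin_coords L (tmat_vec p \<Theta> x, e)))"
    using trig_polynomial_sin[OF P0(1,2)] by metis
  \<comment> \<open>The logarithm cut off at \<kappa>: averages of h stay above \<kappa>, but
    averages of its approximation may be negative.\<close>
  define \<Phi> where "\<Phi> y = ln (max y \<kappa>)" for y
  have \<Phi>_lip: "\<bar>\<Phi> x - \<Phi> y\<bar> \<le> \<bar>x - y\<bar> / \<kappa>" for x y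
  proof -
    have "\<bar>\<Phi> x - \<Phi> y\<bar> \<le> \<bar>max x \<kappa> - max y \<kappa>\<bar> / \<kappa>"
      unfolding \<Phi>_def using \<kappa> by (intro ln_lipschitz_above) auto
    also have "\<dots> \<le> \<bar>x - y\<bar> / \<kappa>" using \<kappa> by (intro divide_right_mono) auto
    finally show ?thesis .
  qed
  have "continuous_on {-1..2} \<Phi>"
    unfolding \<Phi>_def using \<kappa> by (intro continuous_intros) auto
  moreover have "0 < \<eta> / 8" using \<eta> by simp
  ultimately obtain q where q: "real_polynomial_function q" "\<And>y. y \<in> {-1..2} \<Longrightarrow> \<bar>\<Phi> y - q y\<bar> < \<eta> / 8"
    using Stone_Weierstrass_real_polynomial_function[OF compact_Icc] by metis
  obtain \<tau> c where tc: "0 \<le> \<tau>" "0 \<le> c" "\<And>p S f. symmetric_convex p S \<Longrightarrow> S \<noteq> {} \<Longrightarrow>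
    trig p S \<tau>0 c0 f \<Longrightarrow> trig p S \<tau> c (\<lambda>x. q (f x))"
    using trig_polynomial[OF q(1) T(1,2)] by metis
  show ?thesis
  proof (rule that[OF tc(1,2)])
    fix p S and P Q :: "(nat \<Rightarrow> real) measure" and \<Delta> and D :: "('k \<Rightarrow> nat \<Rightarrow> real) set" and w :: "('k \<Rightarrow> nat \<Rightarrow> real) \<Rightarrow> real" and e :: real
    assume sc: "symmetric_convex p S" and pr: "prob_space P" "prob_space Q"
      and sets: "sets P = sets (borel_vec p)" "sets Q = sets (borel_vec p)"
      and \<Delta>: "\<forall>u s. freq p S \<tau> u \<longrightarrow> \<bar>(\<integral>x. cos (dot p u x + s) \<partial>P) - (\<integral>x. cos (dot p u x + s) \<partial>Q)\<bar> \<le> \<Delta>"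
      and D: "finite D" and w: "\<forall>\<Theta>\<in>D. 0 \<le> w \<Theta>" "sum w D = 1"
      and \<Theta>: "\<forall>\<Theta>\<in>D. \<forall>j. \<Theta> j \<in> S \<and> integrable P (dot p (\<Theta> j)) \<and> integrable Q (dot p (\<Theta> j)) \<and>
       (\<integral>x. \<bar>dot p (\<Theta> j) x\<bar> \<partial>P) \<le> m \<and> (\<integral>x. \<bar>dot p (\<Theta> j) x\<bar> \<partial>Q) \<le> m"
      and e: "\<bar>e\<bar> \<le> b1"
    have ne: "S \<noteq> {}"
    proof -
      have "D \<noteq> {}" using w(2) by auto
      then show ?thesis using \<Theta> by blast
    qed
    define Y where "Y x = (\<Sum>\<Theta>\<in>D. w \<Theta> * h (tmat_vec p \<Theta> x, e))" for x
    define Z where "Z x = (\<Sum>\<Theta>\<in>D. w \<Theta> * P0 (sin_coords L (tmat_vec p \<Theta> x, e)))" for x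
    \<comment> \<open>Since the weights sum to 1, averaging keeps the coefficient bound c0 whatever
      the size of D.\<close>
    have Ztrig: "trig p S \<tau>0 c0 Z"
    proof -
      have "trig p S \<tau>0 (\<Sum>\<Theta>\<in>D. \<bar>w \<Theta>\<bar> * c0) Z"
        unfolding Z_def using \<Theta> by (intro trig_sum trig_cmult sc ne T D) auto
      moreover have "(\<Sum>\<Theta>\<in>D. \<bar>w \<Theta>\<bar> * c0) = c0"
      proof -
        have "(\<Sum>\<Theta>\<in>D. \<bar>w \<Theta>\<bar> * c0) = (\<Sum>\<Theta>\<in>D. w \<Theta>) * c0" using w(1) by (simp add: sum_distrib_right)
        then show ?thesis using w(2) by simp
      qed
      ultimately show ?thesis by simp
    qed
    have avg: "A \<le> (\<Sum>\<Theta>\<in>D. w \<Theta> * f \<Theta>)" if "\<And>\<Theta>. \<Theta> \<in> D \<Longrightarrow> A \<le> f \<Theta>" for A and f :: "('k \<Rightarrow> nat \<Rightarrow> real) \<Rightarrow> real"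
    proof -
      have "A = (\<Sum>\<Theta>\<in>D. w \<Theta> * A)" using w(2) by (simp add: sum_distrib_right[symmetric])
      also have "\<dots> \<le> (\<Sum>\<Theta>\<in>D. w \<Theta> * f \<Theta>)" using w(1) that by (intro sum_mono mult_left_mono) auto
      finally show ?thesis .
    qed
    have avg': "(\<Sum>\<Theta>\<in>D. w \<Theta> * f \<Theta>) \<le> A" if "\<And>\<Theta>. \<Theta> \<in> D \<Longrightarrow> f \<Theta> \<le> A" for A and f :: "('k \<Rightarrow> nat \<Rightarrow> real) \<Rightarrow> real"
      using avg[of "- A" "\<lambda>\<Theta>. - f \<Theta>"] that by (simp add: sum_negf)
    have Ybnd: "\<kappa> \<le> Y x" "Y x \<le> 1" for x unfolding Y_def using h by (auto intro: avg avg')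
    have Zbnd: "-1 \<le> Z x" "Z x \<le> 2" for x
    proof -
      have "- \<delta> \<le> Z x" "Z x \<le> 1 + \<delta>" unfolding Z_def using P0(3,4) by (auto intro: avg avg')
      then show "-1 \<le> Z x" "Z x \<le> 2" using \<delta> by linarith+
    qed
    have \<Phi>Y: "\<Phi> (Y x) = ln (Y x)" for x using Ybnd[of x] by (simp add: \<Phi>_def max_def)
    define g where "g x = (\<Sum>\<Theta>\<in>D. w \<Theta> * (\<Sum>j\<in>UNIV. \<bar>dot p (\<Theta> j) x\<bar>))" for x
    \<comment> \<open>Inside the box the error is at most \<delta>. Outside it is bounded, and
      Markov's inequality in pointwise form, 1 at most \<bar>dot\<bar> / b for some column, turns it
      into a multiple of g.\<close>
    have YZ: "\<bar>Y x - Z x\<bar> \<le> \<delta> + 2 / b * g x" for x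
    proof -
      have pt: "\<bar>h (tmat_vec p \<Theta> x, e) - P0 (sin_coords L (tmat_vec p \<Theta> x, e))\<bar> \<le> \<delta> + 2 / b * (\<Sum>j\<in>UNIV. \<bar>dot p (\<Theta> j) x\<bar>)" for \<Theta> :: "'k \<Rightarrow> nat \<Rightarrow> real"
      proof (cases "\<forall>j. \<bar>dot p (\<Theta> j) x\<bar> \<le> b")
        case True
        then have "\<bar>h (tmat_vec p \<Theta> x, e) - P0 (sin_coords L (tmat_vec p \<Theta> x, e))\<bar> \<le> \<delta>"
          using e b by (intro P0(5)) (auto simp: tmat_vec_def)
        moreover have "0 \<le> 2 / b * (\<Sum>j\<in>UNIV. \<bar>dot p (\<Theta> j) x\<bar>)" using b by (simp add: sum_nonneg)
        ultimately show ?thesis by linarith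
      next
        case False
        then obtain j where "b \<le> \<bar>dot p (\<Theta> j) x\<bar>" by (meson linear)
        also have "\<dots> \<le> (\<Sum>j\<in>UNIV. \<bar>dot p (\<Theta> j) x\<bar>)" by (rule member_le_sum) auto
        finally have "1 \<le> 1 / b * (\<Sum>j\<in>UNIV. \<bar>dot p (\<Theta> j) x\<bar>)" using b by simp
        moreover have "\<bar>h (tmat_vec p \<Theta> x, e) - P0 (sin_coords L (tmat_vec p \<Theta> x, e))\<bar> \<le> \<delta> + 2"
          using h(2,3)[of "(tmat_vec p \<Theta> x, e)"] P0(3,4)[of "(tmat_vec p \<Theta> x, e)"] \<delta> \<kappa> by linarith
        ultimately show ?thesis by simp
      qed
      have "\<bar>Y x - Z x\<bar> = \<bar>\<Sum>\<Theta>\<in>D. w \<Theta> * (h (tmat_vec p \<Theta> x, e) - P0 (sin_coords L (tmat_vec p \<Theta> x, e)))\<bar>"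
        by (simp add: Y_def Z_def sum_subtractf right_diff_distrib)
      also have "\<dots> \<le> (\<Sum>\<Theta>\<in>D. w \<Theta> * \<bar>h (tmat_vec p \<Theta> x, e) - P0 (sin_coords L (tmat_vec p \<Theta> x, e))\<bar>)"
        using w(1) by (intro order_trans[OF sum_abs] sum_mono) (auto simp: abs_mult)
      also have "\<dots> \<le> (\<Sum>\<Theta>\<in>D. w \<Theta> * (\<delta> + 2 / b * (\<Sum>j\<in>UNIV. \<bar>dot p (\<Theta> j) x\<bar>)))"
        using w(1) pt by (intro sum_mono mult_left_mono) auto
      also have "\<dots> = (\<Sum>\<Theta>\<in>D. w \<Theta> * \<delta> + 2 / b * (w \<Theta> * (\<Sum>j\<in>UNIV. \<bar>dot p (\<Theta> j) x\<bar>)))"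
        by (simp add: algebra_simps)
      also have "\<dots> = (\<Sum>\<Theta>\<in>D. w \<Theta>) * \<delta> + 2 / b * g x"
        by (simp only: sum.distrib sum_distrib_right sum_distrib_left g_def)
      finally show ?thesis using w(2) by simp
    qed
    have hm: "h \<in> borel_measurable borel" using h(1) by (rule borel_measurable_continuous_onI)
    have law: "integrable P' (\<lambda>x. ln (Y x))" "integrable P' (\<lambda>x. q (Z x))"
      "\<bar>(\<integral>x. ln (Y x) \<partial>P') - (\<integral>x. q (Z x) \<partial>P')\<bar> \<le> \<eta> / 2"
      if pr: "prob_space P'" and sP [measurable_cong]: "sets P' = sets (borel_vec p)"
        and it: "\<And>\<Theta> j. \<Theta> \<in> D \<Longrightarrow> integrable P' (dot p (\<Theta> j))"
        and mo: "\<And>\<Theta> j. \<Theta> \<in> D \<Longrightarrow> (\<integral>x. \<bar>dot p (\<Theta> j) x\<bar> \<partial>P') \<le> m" for P'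
    proof -
      interpret P': prob_space P' by fact
      have "(\<lambda>x. h (tmat_vec p \<Theta> x, e)) \<in> borel_measurable P'" for \<Theta>
        using hm by measurable
      then have [measurable]: "Y \<in> borel_measurable P'" unfolding Y_def by measurable
      have bndY: "\<bar>ln (Y x)\<bar> \<le> \<bar>ln \<kappa>\<bar>" for x
      proof -
        have "ln \<kappa> \<le> ln (Y x)" "ln (Y x) \<le> 0" using Ybnd[of x] \<kappa> by auto
        then show ?thesis by linarith
      qed
      show i1: "integrable P' (\<lambda>x. ln (Y x))"
        by (rule P'.integrable_const_bound[of _ "\<bar>ln \<kappa>\<bar>"]) (auto simp: bndY)
      have qt: "trig p S \<tau> c (\<lambda>x. q (Z x))" by (rule tc(3)[OF sc ne Ztrig])
      have [measurable]: "(\<lambda>x. q (Z x)) \<in> borel_measurable P'" using trig_measurable[OF qt] by measurable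
      show i2: "integrable P' (\<lambda>x. q (Z x))"
        by (rule P'.integrable_const_bound[of _ c]) (auto simp: trig_bounded[OF qt])
      have ig: "integrable P' g" unfolding g_def
        by (intro Bochner_Integration.integrable_sum integrable_mult_right integrable_abs it)
      have "(\<integral>x. g x \<partial>P') = (\<Sum>\<Theta>\<in>D. w \<Theta> * (\<Sum>j\<in>UNIV. \<integral>x. \<bar>dot p (\<Theta> j) x\<bar> \<partial>P'))"
        unfolding g_def
        by (subst Bochner_Integration.integral_sum) (auto intro!: sum.cong integrable_mult_right Bochner_Integration.integrable_sum integrable_abs it simp: Bochner_Integration.integral_sum it)
      also have "\<dots> \<le> ?k * m"
      proof (rule avg')
        fix \<Theta> assume "\<Theta> \<in> D"
        then show "(\<Sum>j\<in>UNIV. \<integral>x. \<bar>dot p (\<Theta> j) x\<bar> \<partial>P') \<le> ?k * m"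
          using sum_bounded_above[of UNIV "\<lambda>j. \<integral>x. \<bar>dot p (\<Theta> j) x\<bar> \<partial>P'" m] mo by simp
      qed
      finally have gm: "(\<integral>x. g x \<partial>P') \<le> ?k * m" .
      have pt: "\<bar>ln (Y x) - q (Z x)\<bar> \<le> \<eta> / 8 + (\<delta> + 2 / b * g x) / \<kappa>" for x
      proof -
        have "\<bar>ln (Y x) - q (Z x)\<bar> \<le> \<bar>\<Phi> (Y x) - \<Phi> (Z x)\<bar> + \<bar>\<Phi> (Z x) - q (Z x)\<bar>"
          unfolding \<Phi>Y by linarith
        also have "\<dots> \<le> \<bar>Y x - Z x\<bar> / \<kappa> + \<eta> / 8"
          using \<Phi>_lip[of "Y x" "Z x"] q(2)[of "Z x"] Zbnd[of x] by auto
        also have "\<dots> \<le> (\<delta> + 2 / b * g x) / \<kappa> + \<eta> / 8"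
          using YZ[of x] \<kappa> by (intro add_right_mono divide_right_mono) auto
        finally show ?thesis by simp
      qed
      have "\<bar>(\<integral>x. ln (Y x) \<partial>P') - (\<integral>x. q (Z x) \<partial>P')\<bar> = \<bar>\<integral>x. ln (Y x) - q (Z x) \<partial>P'\<bar>"
        by (simp add: i1 i2)
      also have "\<dots> \<le> (\<integral>x. \<bar>ln (Y x) - q (Z x)\<bar> \<partial>P')"
        using integral_norm_bound[of P' "\<lambda>x. ln (Y x) - q (Z x)"] by simp
      also have "\<dots> \<le> (\<integral>x. \<eta> / 8 + (\<delta> + 2 / b * g x) / \<kappa> \<partial>P')"
        by (intro integral_mono pt integrable_abs Bochner_Integration.integrable_diff i1 i2) (simp add: ig)
      also have "\<dots> = \<eta> / 8 + (\<delta> + 2 / b * (\<integral>x. g x \<partial>P')) / \<kappa>"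
        by (simp add: ig P'.prob_space)
      also have "\<dots> \<le> \<eta> / 8 + (\<kappa> * \<eta> / 8 + 2 / b * (?k * m)) / \<kappa>"
        using \<delta> \<kappa> gm b by (intro add_left_mono divide_right_mono add_mono mult_left_mono) auto
      also have "\<dots> \<le> \<eta> / 8 + (\<kappa> * \<eta> / 8 + \<kappa> * \<eta> / 8) / \<kappa>"
        using bm \<kappa> by (intro add_left_mono divide_right_mono) (auto simp: field_simps)
      also have "\<dots> \<le> \<eta> / 2" using \<kappa> \<eta> by (simp add: field_simps)
      finally show "\<bar>(\<integral>x. ln (Y x) \<partial>P') - (\<integral>x. q (Z x) \<partial>P')\<bar> \<le> \<eta> / 2" .
    qed
    have "\<bar>(\<integral>x. q (Z x) \<partial>P) - (\<integral>x. q (Z x) \<partial>Q)\<bar> \<le> c * \<Delta>"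
      using \<Delta> by (intro trig_expectation[OF pr sets _ tc(3)[OF sc ne Ztrig]]) auto
    moreover have "\<bar>(\<integral>x. ln (Y x) \<partial>P) - (\<integral>x. q (Z x) \<partial>P)\<bar> \<le> \<eta> / 2"
      using \<Theta> by (intro law(3)[OF pr(1) sets(1)]) auto
    moreover have "\<bar>(\<integral>x. ln (Y x) \<partial>Q) - (\<integral>x. q (Z x) \<partial>Q)\<bar> \<le> \<eta> / 2"
      using \<Theta> by (intro law(3)[OF pr(2) sets(2)]) auto
    ultimately show "\<bar>(\<integral>x. ln (\<Sum>\<Theta>\<in>D. w \<Theta> * h (tmat_vec p \<Theta> x, e)) \<partial>P) -
     (\<integral>x. ln (\<Sum>\<Theta>\<in>D. w \<Theta> * h (tmat_vec p \<Theta> x, e)) \<partial>Q)\<bar> \<le> \<eta> + c * \<Delta>"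
      unfolding Y_def by linarith
  qed
qed

section \<open>Exchanging rows\<close>

text \<open>g is the mean of \<psi> over the interval from x to x + h. Its derivative is a
  difference quotient of \<psi>, hence bounded by L and Lipschitz with constant 2 L / h. The
  quadratic remainder makes n exchanges, each moving the argument by O(1 / n), cost O(1 / n) in
  total.\<close>

lemma lipschitz_smoothing:
  fixes \<psi> :: "real \<Rightarrow> real"
  assumes L: "L-lipschitz_on UNIV \<psi>" and h: "0 < h"
  obtains g g' :: "real \<Rightarrow> real" where
    "\<And>x. \<bar>g x - \<psi> x\<bar> \<le> L * h"
    "\<And>x. \<bar>g' x\<bar> \<le> L"
    "\<And>x y. \<bar>g y - g x - g' x * (y - x)\<bar> \<le> 2 * L / h * (y - x)\<^sup>2"
    "continuous_on UNIV g"
proof -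
  have L0: "0 \<le> L" using L by (rule lipschitz_on_nonneg)
  have lip: "\<bar>\<psi> x - \<psi> y\<bar> \<le> L * \<bar>x - y\<bar>" for x y
    using lipschitz_onD[OF L, of x y] by (simp add: dist_real_def)
  have cont: "continuous_on A \<psi>" for A
    using lipschitz_on_continuous_on[OF L] continuous_on_subset by blast
  define F where "F x = (LBINT s=ereal 0..ereal x. \<psi> s)" for x :: real
  have F: "(F has_real_derivative \<psi> x) (at x)" for x
  proof -
    let ?a = "min 0 x - 1" and ?b = "max 0 x + 1"
    have "((\<lambda>u. LBINT s=ereal 0..ereal u. \<psi> s) has_vector_derivative \<psi> x) (at x within {?a..?b})"
      by (rule interval_integral_FTC2) (auto simp: cont)
    then have "(F has_real_derivative \<psi> x) (at x within {?a..?b})"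
      unfolding F_def[abs_def] by (simp only: has_real_derivative_iff_has_vector_derivative)
    then show ?thesis
      by (subst (asm) at_within_interior) (auto simp: interior_atLeastAtMost_real)
  qed
  define g where "g x = (F (x + h) - F x) / h" for x
  define g' where "g' x = (\<psi> (x + h) - \<psi> x) / h" for x
  have g: "(g has_real_derivative g' x) (at x)" for x
    unfolding g_def[abs_def] g'_def
    by (rule DERIV_cdivide, rule DERIV_diff[OF _ F]) (use F[of "x + h"] in \<open>simp add: DERIV_shift\<close>)
  show ?thesis
  proof (rule that[of g g'])
    show "\<bar>g x - \<psi> x\<bar> \<le> L * h" for x
    proof -
      \<comment> \<open>The mean over the window is attained, so g x is a value of \<psi> at
        distance less than h from x.\<close>
      obtain z where z: "x < z" "z < x + h" "F (x + h) - F x = (x + h - x) * \<psi> z"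
        using MVT2[of x "x + h" F \<psi>] h F by auto
      then have "g x = \<psi> z" using h by (simp add: g_def)
      then have "\<bar>g x - \<psi> x\<bar> \<le> L * \<bar>z - x\<bar>" using lip[of z x] by simp
      also have "\<dots> \<le> L * h" using z L0 by (intro mult_left_mono) auto
      finally show ?thesis .
    qed
    show "\<bar>g' x\<bar> \<le> L" for x
      using lip[of "x + h" x] h by (simp add: g'_def field_simps)
    have g'lip: "\<bar>g' x - g' y\<bar> \<le> 2 * L / h * \<bar>x - y\<bar>" for x y
    proof -
      have "\<bar>(\<psi> (x + h) - \<psi> x) - (\<psi> (y + h) - \<psi> y)\<bar> \<le> \<bar>\<psi> (x + h) - \<psi> (y + h)\<bar> + \<bar>\<psi> x - \<psi> y\<bar>"
        by linarith
      also have "\<dots> \<le> 2 * L * \<bar>x - y\<bar>" using lip[of "x + h" "y + h"] lip[of x y] by simp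
      finally show ?thesis using h by (simp add: g'_def diff_divide_distrib[symmetric] divide_right_mono)
    qed
    show "\<bar>g y - g x - g' x * (y - x)\<bar> \<le> 2 * L / h * (y - x)\<^sup>2" for x y
    proof -
      have "\<exists>z. \<bar>z - x\<bar> \<le> \<bar>y - x\<bar> \<and> g y - g x = g' z * (y - x)"
      proof (cases x y rule: linorder_cases)
        case less
        then obtain z where "x < z" "z < y" "g y - g x = (y - x) * g' z" using MVT2[of x y g g'] g by auto
        then show ?thesis by (intro exI[of _ z]) auto
      next
        case greater
        then obtain z where "y < z" "z < x" "g x - g y = (x - y) * g' z" using MVT2[of y x g g'] g by auto
        then show ?thesis by (intro exI[of _ z]) (auto simp: algebra_simps)
      qed auto
      then obtain z where z: "\<bar>z - x\<bar> \<le> \<bar>y - x\<bar>" "g y - g x = g' z * (y - x)" by blast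
      have "\<bar>g y - g x - g' x * (y - x)\<bar> = \<bar>g' z - g' x\<bar> * \<bar>y - x\<bar>"
        by (simp add: z(2) abs_mult[symmetric] left_diff_distrib)
      also have "\<dots> \<le> (2 * L / h * \<bar>y - x\<bar>) * \<bar>y - x\<bar>"
        using L0 h z(1) by (intro mult_right_mono order_trans[OF g'lip] mult_left_mono) auto
      finally show ?thesis by (simp add: power2_eq_square mult.assoc)
    qed
    show "continuous_on UNIV g"
      using g by (intro continuous_at_imp_continuous_on ballI DERIV_isCont)
  qed
qed

section \<open>Free energy as a smooth minimum over a finite set\<close>

definition softmin :: "real \<Rightarrow> 'b set \<Rightarrow> ('b \<Rightarrow> real) \<Rightarrow> real"
  where "softmin a D R = - ln (\<Sum>\<Theta>\<in>D. exp (- a * R \<Theta>)) / a"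

lemma softmin_bounds:
  assumes "finite D" "D \<noteq> {}" "0 < a"
  shows "softmin a D R \<le> Min (R ` D)" "Min (R ` D) - ln (real (card D)) / a \<le> softmin a D R"
proof -
  let ?Z = "\<Sum>\<Theta>\<in>D. exp (- a * R \<Theta>)" and ?m = "Min (R ` D)"
  have Z: "0 < ?Z" using assms by (intro sum_pos) auto
  have "?m \<in> R ` D" using assms by (intro Min_in) auto
  then obtain d where d: "d \<in> D" "R d = ?m" by auto
  have "exp (- a * R d) \<le> ?Z" using assms d by (intro member_le_sum) auto
  then have "ln (exp (- a * R d)) \<le> ln ?Z" using Z by (subst ln_le_cancel_iff) auto
  then have "- a * ?m \<le> ln ?Z" using d by simp
  then show "softmin a D R \<le> ?m" using assms(3) by (simp add: softmin_def field_simps)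
  have "?Z \<le> (\<Sum>\<Theta>\<in>D. exp (- a * ?m))" using assms by (intro sum_mono) auto
  then have "?Z \<le> real (card D) * exp (- a * ?m)" by simp
  then have "ln ?Z \<le> ln (real (card D) * exp (- a * ?m))"
    using Z by (subst ln_le_cancel_iff) auto
  also have "\<dots> = ln (real (card D)) - a * ?m"
    using assms by (subst ln_mult) (auto simp: card_gt_0_iff)
  finally have "(a * ?m - ln (real (card D))) / a \<le> - ln ?Z / a"
    using assms(3) by (intro divide_right_mono) auto
  then show "?m - ln (real (card D)) / a \<le> softmin a D R"
    using assms(3) by (simp add: softmin_def diff_divide_distrib)
qed

text \<open>Used with R the risk without one row and T the contribution of that row: the normalized
  weights form the Gibbs measure of the other rows, and only exp (- a T) sees the row
  itself.\<close>

lemma softmin_add: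
  assumes "finite D" "D \<noteq> {}" "0 < a"
  shows "softmin a D (\<lambda>\<Theta>. R \<Theta> + T \<Theta>) = softmin a D R -
    ln (\<Sum>\<Theta>\<in>D. exp (- a * R \<Theta>) / (\<Sum>\<Theta>\<in>D. exp (- a * R \<Theta>)) * exp (- a * T \<Theta>)) / a"
proof -
  let ?Z = "\<Sum>\<Theta>\<in>D. exp (- a * R \<Theta>)"
  let ?W = "\<Sum>\<Theta>\<in>D. exp (- a * R \<Theta>) / ?Z * exp (- a * T \<Theta>)"
  have Z: "0 < ?Z" using assms by (intro sum_pos) auto
  have W: "0 < ?W" using assms Z by (intro sum_pos) auto
  have "(\<Sum>\<Theta>\<in>D. exp (- a * (R \<Theta> + T \<Theta>))) = (\<Sum>\<Theta>\<in>D. ?Z * (exp (- a * R \<Theta>) / ?Z * exp (- a * T \<Theta>)))"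
    using Z by (intro sum.cong refl) (simp add: distrib_left exp_add[symmetric])
  also have "\<dots> = ?Z * ?W" by (simp only: sum_distrib_left)
  finally have "ln (\<Sum>\<Theta>\<in>D. exp (- a * (R \<Theta> + T \<Theta>))) = ln ?Z + ln ?W"
    using Z W by (simp only: ln_mult_pos)
  then show ?thesis by (simp add: softmin_def add_divide_distrib diff_divide_distrib)
qed

text \<open>Induction on the index set: coordinate i is exchanged first, with the others under P;
  the function obtained by integrating out i under Q is left to the induction hypothesis. The
  exchange bound is assumed for every u and not only on average, so it passes through these
  integrals.\<close>

lemma lindeberg_PiM:
  fixes F :: "('i \<Rightarrow> 'a) \<Rightarrow> real"
  assumes P: "prob_space P" and Q: "prob_space Q" and sets: "sets Q = sets P"
    and "finite I" and F: "F \<in> borel_measurable (Pi\<^sub>M I (\<lambda>_. P))" "\<And>x. \<bar>F x\<bar> \<le> B"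
    and swap: "\<And>i u. i \<in> I \<Longrightarrow> u \<in> space (Pi\<^sub>M I (\<lambda>_. P)) \<Longrightarrow>
      \<bar>(\<integral>y. F (u(i := y)) \<partial>P) - (\<integral>y. F (u(i := y)) \<partial>Q)\<bar> \<le> \<eta> i"
  shows "\<bar>(\<integral>x. F x \<partial>Pi\<^sub>M I (\<lambda>_. P)) - (\<integral>x. F x \<partial>Pi\<^sub>M I (\<lambda>_. Q))\<bar> \<le> (\<Sum>i\<in>I. \<eta> i)"
  using \<open>finite I\<close> F swap
proof (induction I arbitrary: F rule: finite_induct)
  case empty
  then show ?case by (simp add: PiM_empty)
next
  case (insert i I)
  interpret P: prob_space P by fact
  interpret Q: prob_space Q by fact
  interpret PP: product_sigma_finite "\<lambda>_::'i. P" by standard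
  interpret QQ: product_sigma_finite "\<lambda>_::'i. Q" by standard
  note [measurable_cong] = sets
  have pPI: "prob_space (Pi\<^sub>M J (\<lambda>_. P))" "prob_space (Pi\<^sub>M J (\<lambda>_. Q))" for J
    using P Q by (auto intro: prob_space_PiM)
  have sPi: "sets (Pi\<^sub>M J (\<lambda>_. Q)) = sets (Pi\<^sub>M J (\<lambda>_. P))" for J
    by (intro sets_PiM_cong sets refl)
  have spPi: "space (Pi\<^sub>M J (\<lambda>_. Q)) = space (Pi\<^sub>M J (\<lambda>_. P))" for J
    by (rule sets_eq_imp_space_eq[OF sPi])
  note Fm = insert.prems(1)
  have FmQ: "F \<in> borel_measurable (Pi\<^sub>M (insert i I) (\<lambda>_. Q))"
    using Fm sPi by (simp cong: measurable_cong_sets)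
  interpret PI: prob_space "Pi\<^sub>M I (\<lambda>_. P)" by (rule pPI)
  interpret QI: prob_space "Pi\<^sub>M I (\<lambda>_. Q)" by (rule pPI)
  interpret PiI: prob_space "Pi\<^sub>M (insert i I) (\<lambda>_. P)" by (rule pPI)
  interpret QiI: prob_space "Pi\<^sub>M (insert i I) (\<lambda>_. Q)" by (rule pPI)
  have iP: "integrable (Pi\<^sub>M (insert i I) (\<lambda>_. P)) F"
    by (rule PiI.integrable_const_bound[of _ B]) (auto simp: insert.prems(2) Fm)
  have iQ: "integrable (Pi\<^sub>M (insert i I) (\<lambda>_. Q)) F"
    by (rule QiI.integrable_const_bound[of _ B]) (auto simp: insert.prems(2) FmQ)
  have upd: "(\<lambda>(x, y). F (x(i := y))) \<in> borel_measurable (Pi\<^sub>M I (\<lambda>_. P) \<Otimes>\<^sub>M P)"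
    using measurable_compose[OF measurable_add_dim Fm] unfolding split_beta' .
  have updQ: "(\<lambda>(x, y). F (x(i := y))) \<in> borel_measurable (Pi\<^sub>M I (\<lambda>_. P) \<Otimes>\<^sub>M Q)"
    using upd by (simp cong: measurable_cong_sets add: sets_pair_measure_cong[OF refl sets])
  define A where "A x = (\<integral>y. F (x(i := y)) \<partial>P)" for x
  define A' where "A' x = (\<integral>y. F (x(i := y)) \<partial>Q)" for x
  have Am: "A \<in> borel_measurable (Pi\<^sub>M I (\<lambda>_. P))" unfolding A_def
    by (rule P.borel_measurable_lebesgue_integral[OF upd])
  have A'm: "A' \<in> borel_measurable (Pi\<^sub>M I (\<lambda>_. P))" unfolding A'_def
    by (rule Q.borel_measurable_lebesgue_integral[OF updQ])
  \<comment> \<open>Covers the default value 0 of an integral that does not exist.\<close>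
  have B0: "0 \<le> B" using insert.prems(2)[of undefined] by linarith
  have Ab: "\<bar>A x\<bar> \<le> B" for x
  proof (cases "integrable P (\<lambda>y. F (x(i := y)))")
    case True
    have "\<bar>A x\<bar> \<le> (\<integral>y. \<bar>F (x(i := y))\<bar> \<partial>P)" unfolding A_def using integral_norm_bound[of P "\<lambda>y. F (x(i := y))"] by simp
    also have "\<dots> \<le> (\<integral>y. B \<partial>P)" using True by (intro integral_mono insert.prems(2)) auto
    finally show ?thesis by (simp add: P.prob_space)
  qed (simp add: A_def not_integrable_integral_eq B0)
  have A'b: "\<bar>A' x\<bar> \<le> B" for x
  proof (cases "integrable Q (\<lambda>y. F (x(i := y)))")
    case True
    have "\<bar>A' x\<bar> \<le> (\<integral>y. \<bar>F (x(i := y))\<bar> \<partial>Q)" unfolding A'_def using integral_norm_bound[of Q "\<lambda>y. F (x(i := y))"] by simp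
    also have "\<dots> \<le> (\<integral>y. B \<partial>Q)" using True by (intro integral_mono insert.prems(2)) auto
    finally show ?thesis by (simp add: Q.prob_space)
  qed (simp add: A'_def not_integrable_integral_eq B0)
  have iA: "integrable (Pi\<^sub>M I (\<lambda>_. P)) A" by (rule PI.integrable_const_bound[of _ B]) (auto simp: Ab Am)
  have iA': "integrable (Pi\<^sub>M I (\<lambda>_. P)) A'" by (rule PI.integrable_const_bound[of _ B]) (auto simp: A'b A'm)
  \<comment> \<open>Any value at i will do: the assumed bound speaks of points of the larger
    product, but the value at i is overwritten.\<close>
  obtain y0 where y0: "y0 \<in> space P" using P.not_empty by blast
  have spi: "x(i := y0) \<in> space (Pi\<^sub>M (insert i I) (\<lambda>_. P))" if "x \<in> space (Pi\<^sub>M I (\<lambda>_. P))" for x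
    using that y0 unfolding space_PiM by (intro PiE_fun_upd)
  have dA: "\<bar>A x - A' x\<bar> \<le> \<eta> i" if "x \<in> space (Pi\<^sub>M I (\<lambda>_. P))" for x
    using insert.prems(3)[OF insertI1 spi[OF that]] unfolding A_def A'_def fun_upd_upd .
  have eqP: "(\<integral>x. F x \<partial>Pi\<^sub>M (insert i I) (\<lambda>_. P)) = (\<integral>x. A x \<partial>Pi\<^sub>M I (\<lambda>_. P))"
    unfolding A_def by (rule PP.product_integral_insert[OF insert.hyps iP])
  have eqQ: "(\<integral>x. F x \<partial>Pi\<^sub>M (insert i I) (\<lambda>_. Q)) = (\<integral>x. A' x \<partial>Pi\<^sub>M I (\<lambda>_. Q))"
    unfolding A'_def by (rule QQ.product_integral_insert[OF insert.hyps iQ])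
  have 1: "\<bar>(\<integral>x. A x \<partial>Pi\<^sub>M I (\<lambda>_. P)) - (\<integral>x. A' x \<partial>Pi\<^sub>M I (\<lambda>_. P))\<bar> \<le> \<eta> i"
  proof -
    have "\<bar>(\<integral>x. A x \<partial>Pi\<^sub>M I (\<lambda>_. P)) - (\<integral>x. A' x \<partial>Pi\<^sub>M I (\<lambda>_. P))\<bar> = \<bar>\<integral>x. A x - A' x \<partial>Pi\<^sub>M I (\<lambda>_. P)\<bar>"
      by (simp add: iA iA')
    also have "\<dots> \<le> (\<integral>x. \<bar>A x - A' x\<bar> \<partial>Pi\<^sub>M I (\<lambda>_. P))"
      using integral_norm_bound[of _ "\<lambda>x. A x - A' x"] by simp
    also have "\<dots> \<le> (\<integral>x. \<eta> i \<partial>Pi\<^sub>M I (\<lambda>_. P))"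
      by (intro integral_mono integrable_abs Bochner_Integration.integrable_diff iA iA' dA) auto
    finally show ?thesis by (simp add: PI.prob_space)
  qed
  have 2: "\<bar>(\<integral>x. A' x \<partial>Pi\<^sub>M I (\<lambda>_. P)) - (\<integral>x. A' x \<partial>Pi\<^sub>M I (\<lambda>_. Q))\<bar> \<le> (\<Sum>i\<in>I. \<eta> i)"
  proof (rule insert.IH[OF A'm A'b])
    fix j u assume j: "j \<in> I" and u: "u \<in> space (Pi\<^sub>M I (\<lambda>_. P))"
    have ij: "i \<noteq> j" using j insert.hyps by auto
    have tw: "u(j := y, i := z) = u(i := z, j := y)" for y z using ij by (rule fun_upd_twist[symmetric])
    have um: "(\<lambda>(y, z). F (u(j := y, i := z))) \<in> borel_measurable (N \<Otimes>\<^sub>M Q)" if N: "sets N = sets P" for N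
    proof -
      have "(\<lambda>(y, z). u(j := y, i := z)) \<in> measurable (P \<Otimes>\<^sub>M P) (Pi\<^sub>M (insert i I) (\<lambda>_. P))"
        unfolding split_beta'
      proof (rule measurable_fun_upd[where J=I])
        have u': "restrict u (I - {j}) \<in> space (Pi\<^sub>M (I - {j}) (\<lambda>_. P))"
          using u by (auto simp: space_PiM)
        have "(\<lambda>x. (restrict u (I - {j}))(j := fst x)) \<in> measurable (P \<Otimes>\<^sub>M P) (Pi\<^sub>M I (\<lambda>_. P))"
          by (rule measurable_fun_upd[where J="I - {j}"])
            (use j in auto, rule measurable_const[OF u'])
        moreover have "(restrict u (I - {j}))(j := z) = u(j := z)" for z
          using u by (auto simp: fun_eq_iff space_PiM PiE_def extensional_def)
        ultimately show "(\<lambda>x. u(j := fst x)) \<in> measurable (P \<Otimes>\<^sub>M P) (Pi\<^sub>M I (\<lambda>_. P))" by simp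
      qed auto
      from measurable_compose[OF this Fm] have "(\<lambda>(y, z). F (u(j := y, i := z))) \<in> borel_measurable (P \<Otimes>\<^sub>M P)"
        unfolding split_beta' .
      then show ?thesis
        by (simp cong: measurable_cong_sets add: sets_pair_measure_cong[OF N sets])
    qed
    \<comment> \<open>By Fubini the exchange of j commutes with the integral over i under Q, so the
      bound \<open>\<eta> j\<close> passes from F to A'.\<close>
    have fub: "(\<integral>y. A' (u(j := y)) \<partial>N) = (\<integral>z. (\<integral>y. F (u(i := z, j := y)) \<partial>N) \<partial>Q)"
      and intN: "integrable Q (\<lambda>z. \<integral>y. F (u(i := z, j := y)) \<partial>N)"
      if N: "prob_space N" "sets N = sets P" for N
    proof -
      interpret N: prob_space N by fact
      interpret NQ: pair_prob_space N Q ..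
      have "integrable (N \<Otimes>\<^sub>M Q) (\<lambda>(y, z). F (u(j := y, i := z)))"
        by (rule NQ.integrable_const_bound[of _ B]) (auto simp: insert.prems(2) um[OF N(2)])
      then show "(\<integral>y. A' (u(j := y)) \<partial>N) = (\<integral>z. (\<integral>y. F (u(i := z, j := y)) \<partial>N) \<partial>Q)"
        "integrable Q (\<lambda>z. \<integral>y. F (u(i := z, j := y)) \<partial>N)"
        using NQ.Fubini_integral[of "\<lambda>y z. F (u(j := y, i := z))"] NQ.integrable_snd[of "\<lambda>y z. F (u(j := y, i := z))"]
        unfolding A'_def tw by auto
    qed
    have sw: "\<bar>(\<integral>y. F (u(i := z, j := y)) \<partial>P) - (\<integral>y. F (u(i := z, j := y)) \<partial>Q)\<bar> \<le> \<eta> j" if "z \<in> space Q" for z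
    proof (rule insert.prems(3))
      show "u(i := z) \<in> space (Pi\<^sub>M (insert i I) (\<lambda>_. P))"
        using u that unfolding sets_eq_imp_space_eq[OF sets] space_PiM by (intro PiE_fun_upd)
    qed (use j in auto)
    have "\<bar>(\<integral>y. A' (u(j := y)) \<partial>P) - (\<integral>y. A' (u(j := y)) \<partial>Q)\<bar> =
      \<bar>\<integral>z. (\<integral>y. F (u(i := z, j := y)) \<partial>P) - (\<integral>y. F (u(i := z, j := y)) \<partial>Q) \<partial>Q\<bar>"
      by (simp add: fub[OF P refl] fub[OF Q sets] intN[OF P refl] intN[OF Q sets])
    also have "\<dots> \<le> (\<integral>z. \<bar>(\<integral>y. F (u(i := z, j := y)) \<partial>P) - (\<integral>y. F (u(i := z, j := y)) \<partial>Q)\<bar> \<partial>Q)"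
      using integral_norm_bound[of Q "\<lambda>z. (\<integral>y. F (u(i := z, j := y)) \<partial>P) - (\<integral>y. F (u(i := z, j := y)) \<partial>Q)"] by simp
    also have "\<dots> \<le> (\<integral>z. \<eta> j \<partial>Q)"
      by (intro integral_mono integrable_abs Bochner_Integration.integrable_diff intN P Q sets refl sw) auto
    finally show "\<bar>(\<integral>y. A' (u(j := y)) \<partial>P) - (\<integral>y. A' (u(j := y)) \<partial>Q)\<bar> \<le> \<eta> j" by (simp add: Q.prob_space)
  qed
  show ?case using 1 2 insert.hyps by (simp add: eqP eqQ)
qed

section \<open>Truncation, free energy and discretization of the risk\<close>

lemma measurable_emp_risk:
  fixes l :: "real ^ 'k::finite \<Rightarrow> real \<Rightarrow> real"
  assumes l: "continuous_on UNIV (\<lambda>(v, e). l v e)"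
    and A: "\<And>i. i < n \<Longrightarrow> (\<lambda>\<omega>. A \<omega> i) \<in> measurable M (borel_vec p)"
    and E: "\<And>i. i < n \<Longrightarrow> (\<lambda>\<omega>. E \<omega> i) \<in> borel_measurable M"
  shows "(\<lambda>\<omega>. emp_risk n p l r (E \<omega>) (A \<omega>) \<Theta>) \<in> borel_measurable M"
proof -
  have l': "(\<lambda>z. l (fst z) (snd z)) \<in> borel_measurable borel"
    using borel_measurable_continuous_onI[OF l] by (simp add: split_beta')
  have "(\<lambda>\<omega>. l (tmat_vec p \<Theta> (A \<omega> i)) (E \<omega> i)) \<in> borel_measurable M" if "i < n" for i
  proof -
    have "(\<lambda>\<omega>. (tmat_vec p \<Theta> (A \<omega> i), E \<omega> i)) \<in> borel_measurable M"
      by (intro borel_measurable_Pair E[OF that] measurable_compose[OF A[OF that]] measurable_tmat_vec)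
    from measurable_compose[OF this l'] show ?thesis by simp
  qed
  then show ?thesis unfolding emp_risk_def by (intro borel_measurable_add borel_measurable_divide borel_measurable_sum) auto
qed

lemma continuous_on_min_loss:
  assumes "continuous_on UNIV (\<lambda>(v, e). l v e)"
  shows "continuous_on UNIV (\<lambda>(v, e). min (l v e) (B::real))"
  using continuous_on_min[OF assms continuous_on_const[of _ B]] by (simp add: split_beta')

section \<open>Leave-one-out comparisons: truncation and exchange\<close>

lemma emp_risk_fun_upd:
  assumes "i < n"
  shows "emp_risk n p l r e (u(i := y)) \<Theta> =
    ((\<Sum>j\<in>{..<n} - {i}. l (tmat_vec p \<Theta> (u j)) (e j)) / real n + r \<Theta>) + l (tmat_vec p \<Theta> y) (e i) / real n"
proof -
  have "(\<Sum>j<n. l (tmat_vec p \<Theta> ((u(i := y)) j)) (e j)) =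
    l (tmat_vec p \<Theta> y) (e i) + (\<Sum>j\<in>{..<n} - {i}. l (tmat_vec p \<Theta> ((u(i := y)) j)) (e j))"
    using assms by (subst sum.remove[of _ i]) auto
  also have "(\<Sum>j\<in>{..<n} - {i}. l (tmat_vec p \<Theta> ((u(i := y)) j)) (e j)) = (\<Sum>j\<in>{..<n} - {i}. l (tmat_vec p \<Theta> (u j)) (e j))"
    by (intro sum.cong) auto
  finally show ?thesis by (simp add: emp_risk_def add_divide_distrib)
qed

text \<open>Only the excess at d appears, and d minimizes h, which does not involve T. If the
  minimizer s of the truncated risk has T s \<le> B, truncation changed nothing there; otherwise its
  truncated value is at least h d + B / n, while d competes in the untruncated minimum.\<close>

lemma Min_truncate_le:
  fixes h T :: "'b \<Rightarrow> real"
  assumes D: "finite D" "D \<noteq> {}" and n: "0 < n" and d: "d \<in> D" "\<And>\<Theta>. \<Theta> \<in> D \<Longrightarrow> h d \<le> h \<Theta>"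
  shows "Min ((\<lambda>\<Theta>. h \<Theta> + T \<Theta> / n) ` D) - Min ((\<lambda>\<Theta>. h \<Theta> + min (T \<Theta>) B / n) ` D) \<le> max 0 (T d - B) / n"
proof -
  let ?f = "\<lambda>\<Theta>. h \<Theta> + T \<Theta> / n" and ?g = "\<lambda>\<Theta>. h \<Theta> + min (T \<Theta>) B / n"
  have "Min (?g ` D) \<in> ?g ` D" using D by (intro Min_in) auto
  then obtain s where s: "s \<in> D" "Min (?g ` D) = ?g s" by auto
  have le: "Min (?f ` D) \<le> ?f \<Theta>" if "\<Theta> \<in> D" for \<Theta> using D that by (intro Min_le) auto
  show ?thesis
  proof (cases "T s \<le> B")
    case True
    then have "Min (?f ` D) - Min (?g ` D) \<le> 0" using le[OF s(1)] s(2) by simp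
    also have "0 \<le> max 0 (T d - B) / n" using n by simp
    finally show ?thesis .
  next
    case False
    then have "Min (?f ` D) - Min (?g ` D) \<le> ?f d - (h d + B / n)"
      using le[OF d(1)] s(2) d(2)[OF s(1)] by simp
    also have "\<dots> = (T d - B) / n" by (simp add: diff_divide_distrib)
    also have "\<dots> \<le> max 0 (T d - B) / n" using n by (intro divide_right_mono) auto
    finally show ?thesis .
  qed
qed

text \<open>Bounding the maximal excess over D would cost the entropy of D. Here each row is charged
  only for its excess at a point selected by the other rows; that point is independent of the row,
  so a moment bound for each fixed \<Theta> suffices.\<close>

lemma truncation_bound:
  fixes l :: "real ^ 'k::finite \<Rightarrow> real \<Rightarrow> real"
  assumes P: "prob_space P" and sP [measurable_cong]: "sets P = sets (borel_vec p)"
    and D: "finite D" "D \<noteq> {}" and n: "1 \<le> n"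
    and l: "continuous_on UNIV (\<lambda>(v, e). l v e)"
    and c: "\<And>i. i < n \<Longrightarrow> 0 \<le> c i"
      "\<And>\<Theta> i. \<Theta> \<in> D \<Longrightarrow> i < n \<Longrightarrow> (\<integral>\<^sup>+x. ennreal (max 0 (l (tmat_vec p \<Theta> x) (e i) - B)) \<partial>P) \<le> ennreal (c i)"
  shows "(\<integral>\<^sup>+X. ennreal (Min (emp_risk n p l r e X ` D) - Min (emp_risk n p (\<lambda>v e. min (l v e) B) r e X ` D)) \<partial>Pi\<^sub>M {..<n} (\<lambda>_. P))
     \<le> ennreal ((\<Sum>i<n. c i) / real n)"
proof -
  interpret P: prob_space P by fact
  interpret PP: product_sigma_finite "\<lambda>_::nat. P" by standard
  \<comment> \<open>Rows with index below m have truncated losses, the others do not; m runs from 0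
    to n.\<close>
  define T where "T m i v = (if i < m then min (l v (e i)) B else l v (e i))" for m i v
  define R where "R m X \<Theta> = (\<Sum>i<n. T m i (tmat_vec p \<Theta> (X i))) / real n + r \<Theta>" for m X \<Theta>
  define g where "g m X = Min (R m X ` D)" for m X
  have lm: "(\<lambda>v. l v a) \<in> borel_measurable borel" for a
  proof -
    have "continuous_on UNIV (\<lambda>v. (\<lambda>(v, e). l v e) (v, a))"
      by (rule continuous_on_compose2[OF l]) (auto intro!: continuous_intros)
    then show ?thesis by (intro borel_measurable_continuous_onI) simp
  qed
  have Tm: "T m i \<in> borel_measurable borel" for m i
    unfolding T_def[abs_def] using lm by (cases "i < m") auto
  have Rm: "(\<lambda>X. R m X \<Theta>) \<in> borel_measurable (Pi\<^sub>M {..<n} (\<lambda>_. P))" for m \<Theta>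
  proof -
    have "(\<lambda>X. T m i (tmat_vec p \<Theta> (X i))) \<in> borel_measurable (Pi\<^sub>M {..<n} (\<lambda>_. P))" if "i < n" for i
    proof -
      have "(\<lambda>X. X i) \<in> measurable (Pi\<^sub>M {..<n} (\<lambda>_. P)) (borel_vec p)"
        using that measurable_component_singleton[of i "{..<n}" "\<lambda>_. P"] by (simp cong: measurable_cong_sets add: sP)
      from measurable_compose[OF this measurable_compose[OF measurable_tmat_vec Tm]] show ?thesis .
    qed
    then show ?thesis unfolding R_def by (intro borel_measurable_add borel_measurable_divide borel_measurable_sum) auto
  qed
  have gm: "g m \<in> borel_measurable (Pi\<^sub>M {..<n} (\<lambda>_. P))" for m
    unfolding g_def[abs_def] using Rm by (intro borel_measurable_Min D(1))
  have mono: "g (Suc m) X \<le> g m X" for m X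
  proof -
    have "R (Suc m) X \<Theta> \<le> R m X \<Theta>" for \<Theta>
      unfolding R_def T_def by (intro add_right_mono divide_right_mono sum_mono) auto
    moreover have "g m X \<in> R m X ` D" unfolding g_def using D by (intro Min_in) auto
    then obtain d where "d \<in> D" "g m X = R m X d" by auto
    moreover have "g (Suc m) X \<le> R (Suc m) X d" if "d \<in> D" for d unfolding g_def using D that by (intro Min_le) auto
    ultimately show ?thesis by (metis order_trans)
  qed
  have step: "(\<integral>\<^sup>+X. ennreal (g m X - g (Suc m) X) \<partial>Pi\<^sub>M {..<n} (\<lambda>_. P)) \<le> ennreal (c m / real n)" if m: "m < n" for m
  proof -
    let ?I = "{..<n} - {m}"
    have I: "insert m ?I = {..<n}" using m by auto
    interpret PI: prob_space "Pi\<^sub>M ?I (\<lambda>_. P)" by (rule prob_space_PiM) (rule P)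
    have inner: "(\<integral>\<^sup>+y. ennreal (g m (u(m := y)) - g (Suc m) (u(m := y))) \<partial>P) \<le> ennreal (c m / real n)" for u
    proof -
      define h where "h \<Theta> = (\<Sum>i\<in>?I. T m i (tmat_vec p \<Theta> (u i))) / real n + r \<Theta>" for \<Theta>
      have "Min (h ` D) \<in> h ` D" using D by (intro Min_in) auto
      \<comment> \<open>d depends on the other rows u but not on y, so it is constant in the
        integral over row m.\<close>
      then obtain d where d: "d \<in> D" "Min (h ` D) = h d" by auto
      have dmin: "h d \<le> h \<Theta>" if "\<Theta> \<in> D" for \<Theta> using D that d(2)[symmetric] by (auto intro: Min_le)
      have split: "(\<Sum>i<n. T m' i (tmat_vec p \<Theta> ((u(m := y)) i))) =
          T m' m (tmat_vec p \<Theta> y) + (\<Sum>i\<in>?I. T m' i (tmat_vec p \<Theta> (u i)))" for m' \<Theta> y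
      proof -
        have "(\<Sum>i<n. T m' i (tmat_vec p \<Theta> ((u(m := y)) i))) =
          T m' m (tmat_vec p \<Theta> y) + (\<Sum>i\<in>?I. T m' i (tmat_vec p \<Theta> ((u(m := y)) i)))"
          using m by (subst sum.remove[of _ m]) auto
        also have "(\<Sum>i\<in>?I. T m' i (tmat_vec p \<Theta> ((u(m := y)) i))) = (\<Sum>i\<in>?I. T m' i (tmat_vec p \<Theta> (u i)))"
          by (intro sum.cong) auto
        finally show ?thesis .
      qed
      have TS: "(\<Sum>i\<in>?I. T (Suc m) i (tmat_vec p \<Theta> (u i))) = (\<Sum>i\<in>?I. T m i (tmat_vec p \<Theta> (u i)))" for \<Theta>
        by (intro sum.cong refl) (auto simp: T_def)
      have R1: "R m (u(m := y)) \<Theta> = h \<Theta> + l (tmat_vec p \<Theta> y) (e m) / real n" for y \<Theta>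
        unfolding R_def split h_def by (simp add: T_def[of m m] add_divide_distrib)
      have R2: "R (Suc m) (u(m := y)) \<Theta> = h \<Theta> + min (l (tmat_vec p \<Theta> y) (e m)) B / real n" for y \<Theta>
        unfolding R_def split h_def TS by (simp add: T_def[of "Suc m" m] add_divide_distrib)
      have pt: "g m (u(m := y)) - g (Suc m) (u(m := y)) \<le> max 0 (l (tmat_vec p d y) (e m) - B) / real n" for y
        unfolding g_def R1[abs_def] R2[abs_def] R1 R2 using n
          by (intro Min_truncate_le[where T="\<lambda>\<Theta>. l (tmat_vec p \<Theta> y) (e m)" and h=h and d=d] D d(1) dmin) auto
      have "(\<integral>\<^sup>+y. ennreal (g m (u(m := y)) - g (Suc m) (u(m := y))) \<partial>P)
          \<le> (\<integral>\<^sup>+y. ennreal (1 / real n) * ennreal (max 0 (l (tmat_vec p d y) (e m) - B)) \<partial>P)"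
      proof (rule nn_integral_mono)
        fix y
        have "ennreal (g m (u(m := y)) - g (Suc m) (u(m := y))) \<le> ennreal (1 / real n * max 0 (l (tmat_vec p d y) (e m) - B))"
          using pt[of y] by (intro ennreal_leI) simp
        also have "\<dots> = ennreal (1 / real n) * ennreal (max 0 (l (tmat_vec p d y) (e m) - B))"
          by (rule ennreal_mult) auto
        finally show "ennreal (g m (u(m := y)) - g (Suc m) (u(m := y))) \<le>
          ennreal (1 / real n) * ennreal (max 0 (l (tmat_vec p d y) (e m) - B))" .
      qed
      also have "\<dots> = ennreal (1 / real n) * (\<integral>\<^sup>+y. ennreal (max 0 (l (tmat_vec p d y) (e m) - B)) \<partial>P)"
      proof (rule nn_integral_cmult)
        have "(\<lambda>y. l (tmat_vec p d y) (e m)) \<in> borel_measurable P"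
          using measurable_compose[OF measurable_tmat_vec lm, of p d "e m"] by (simp cong: measurable_cong_sets add: sP)
        then show "(\<lambda>y. ennreal (max 0 (l (tmat_vec p d y) (e m) - B))) \<in> borel_measurable P" by measurable
      qed
      also have "\<dots> \<le> ennreal (1 / real n) * ennreal (c m)"
        by (intro mult_left_mono c(2) d m) auto
      also have "\<dots> = ennreal (c m / real n)" using c(1)[OF m] by (simp add: ennreal_mult[symmetric])
      finally show ?thesis .
    qed
    have "(\<lambda>X. ennreal (g m X - g (Suc m) X)) \<in> borel_measurable (Pi\<^sub>M (insert m ?I) (\<lambda>_. P))"
      unfolding I using gm by measurable
    then have "(\<integral>\<^sup>+X. ennreal (g m X - g (Suc m) X) \<partial>Pi\<^sub>M (insert m ?I) (\<lambda>_. P)) =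
      (\<integral>\<^sup>+u. (\<integral>\<^sup>+y. ennreal (g m (u(m := y)) - g (Suc m) (u(m := y))) \<partial>P) \<partial>Pi\<^sub>M ?I (\<lambda>_. P))"
      by (intro PP.product_nn_integral_insert) auto
    also have "\<dots> \<le> (\<integral>\<^sup>+u. ennreal (c m / real n) \<partial>Pi\<^sub>M ?I (\<lambda>_. P))"
      by (intro nn_integral_mono inner)
    also have "\<dots> = ennreal (c m / real n)" by (simp add: PI.emeasure_space_1)
    finally show ?thesis unfolding I .
  qed
  have R0: "R 0 X = emp_risk n p l r e X" for X by (rule ext) (simp add: R_def T_def emp_risk_def)
  have Rn: "R n X = emp_risk n p (\<lambda>v e. min (l v e) B) r e X" for X by (rule ext) (simp add: R_def T_def emp_risk_def)
  \<comment> \<open>\<open>ennreal\<close> sends negative reals to 0, so the telescoping relies on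
    \<open>mono\<close>.\<close>
  have tel: "ennreal (g 0 X - g n X) = (\<Sum>m<n. ennreal (g m X - g (Suc m) X))" for X
  proof -
    have "(\<Sum>m<n. ennreal (g m X - g (Suc m) X)) = ennreal (\<Sum>m<n. g m X - g (Suc m) X)"
      using mono by (intro sum_ennreal) auto
    then show ?thesis unfolding sum_lessThan_telescope'[of "\<lambda>m. g m X" n] by (rule sym)
  qed
  have "(\<integral>\<^sup>+X. ennreal (g 0 X - g n X) \<partial>Pi\<^sub>M {..<n} (\<lambda>_. P)) = (\<Sum>m<n. \<integral>\<^sup>+X. ennreal (g m X - g (Suc m) X) \<partial>Pi\<^sub>M {..<n} (\<lambda>_. P))"
    unfolding tel by (intro nn_integral_sum measurable_compose[OF borel_measurable_diff[OF gm gm] measurable_ennreal])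
  also have "\<dots> \<le> (\<Sum>m<n. ennreal (c m / real n))" by (intro sum_mono step) auto
  also have "\<dots> = ennreal ((\<Sum>i<n. c i) / real n)"
    unfolding sum_divide_distrib using c(1) by (intro sum_ennreal) auto
  finally show ?thesis unfolding g_def R0 Rn .
qed

text \<open>Expansion of g around the free energy without row i. The first-order difference is the
  exchange error of the logarithm, scaled by L / (\<beta> n); the remainder is quadratic in B / n
  for each of the two laws, because a loss between 0 and B moves the free energy by at most B /
  n.\<close>

lemma softmin_universality:
  fixes l :: "real ^ 'k::finite \<Rightarrow> real \<Rightarrow> real"
  assumes PQ: "prob_space P" "prob_space Q" and sets: "sets P = sets (borel_vec p)" "sets Q = sets (borel_vec p)"
    and D: "finite D" "D \<noteq> {}" and n: "1 \<le> n" and \<beta>: "0 < \<beta>"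
    and l: "continuous_on UNIV (\<lambda>(v, e). l v e)" "\<And>v e. 0 \<le> l v e" "\<And>v e. l v e \<le> B"
    and g: "\<And>x. \<bar>g' x\<bar> \<le> L" "\<And>x y. \<bar>g y - g x - g' x * (y - x)\<bar> \<le> A * (y - x)\<^sup>2" "\<And>x. \<bar>g x\<bar> \<le> G" "continuous_on UNIV g"
    and swap: "\<And>i w. i < n \<Longrightarrow> (\<And>\<Theta>. \<Theta> \<in> D \<Longrightarrow> 0 \<le> w \<Theta>) \<Longrightarrow> sum w D = 1 \<Longrightarrow>
      \<bar>(\<integral>x. ln (\<Sum>\<Theta>\<in>D. w \<Theta> * exp (- \<beta> * l (tmat_vec p \<Theta> x) (e i))) \<partial>P) -
       (\<integral>x. ln (\<Sum>\<Theta>\<in>D. w \<Theta> * exp (- \<beta> * l (tmat_vec p \<Theta> x) (e i))) \<partial>Q)\<bar> \<le> \<zeta> i"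
  shows "\<bar>(\<integral>X. g (softmin (\<beta> * real n) D (emp_risk n p l r e X)) \<partial>Pi\<^sub>M {..<n} (\<lambda>_. P)) -
          (\<integral>X. g (softmin (\<beta> * real n) D (emp_risk n p l r e X)) \<partial>Pi\<^sub>M {..<n} (\<lambda>_. Q))\<bar>
    \<le> (\<Sum>i<n. L / (\<beta> * real n) * \<zeta> i + 2 * A * (B / real n)\<^sup>2)"
proof (rule lindeberg_PiM[where B=G])
  let ?a = "\<beta> * real n"
  let ?F = "\<lambda>X. g (softmin ?a D (emp_risk n p l r e X))"
  have a: "0 < ?a" using \<beta> n by simp
  show "sets Q = sets P" using sets by simp
  note [measurable_cong] = sets
  have A0: "0 \<le> A" using g(2)[of 1 0] by simp
  have gm: "g \<in> borel_measurable borel" using g(4) by (rule borel_measurable_continuous_onI)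
  show "?F \<in> borel_measurable (Pi\<^sub>M {..<n} (\<lambda>_. P))"
  proof -
    have "(\<lambda>X. emp_risk n p l r e X \<Theta>) \<in> borel_measurable (Pi\<^sub>M {..<n} (\<lambda>_. P))" for \<Theta>
    proof (rule measurable_emp_risk[OF l(1)])
      show "(\<lambda>X. X i) \<in> measurable (Pi\<^sub>M {..<n} (\<lambda>_. P)) (borel_vec p)" if "i < n" for i
        using that measurable_component_singleton[of i "{..<n}" "\<lambda>_. P"] by (simp cong: measurable_cong_sets add: sets)
    qed auto
    then have "(\<lambda>X. softmin ?a D (emp_risk n p l r e X)) \<in> borel_measurable (Pi\<^sub>M {..<n} (\<lambda>_. P))"
      unfolding softmin_def by measurable
    then show ?thesis using gm by measurable
  qed
  fix i u assume i: "i \<in> {..<n}"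
  define h where "h \<Theta> = (\<Sum>j\<in>{..<n} - {i}. l (tmat_vec p \<Theta> (u j)) (e j)) / real n + r \<Theta>" for \<Theta>
  define w where "w \<Theta> = exp (- ?a * h \<Theta>) / (\<Sum>\<Theta>\<in>D. exp (- ?a * h \<Theta>))" for \<Theta>
  define Y where "Y y = (\<Sum>\<Theta>\<in>D. w \<Theta> * exp (- \<beta> * l (tmat_vec p \<Theta> y) (e i)))" for y
  define f0 where "f0 = softmin ?a D h"
  have Z: "0 < (\<Sum>\<Theta>\<in>D. exp (- ?a * h \<Theta>))" using D by (intro sum_pos) auto
  have w: "0 \<le> w \<Theta>" for \<Theta> using Z by (simp add: w_def)
  have w1: "sum w D = 1" using Z unfolding w_def by (simp add: sum_divide_distrib[symmetric])
  have soft: "softmin ?a D (emp_risk n p l r e (u(i := y))) = f0 + - ln (Y y) / ?a" for y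
  proof -
    have "emp_risk n p l r e (u(i := y)) = (\<lambda>\<Theta>. h \<Theta> + l (tmat_vec p \<Theta> y) (e i) / real n)"
      using i emp_risk_fun_upd[of i n p l r e u y] by (auto simp: h_def)
    moreover have "- ?a * (x / real n) = - \<beta> * x" for x using n by simp
    ultimately show ?thesis
      by (simp only: softmin_add[OF D a] w_def[symmetric] f0_def[symmetric] Y_def[symmetric])
  qed
  have Ybnd: "exp (- \<beta> * B) \<le> Y y" "Y y \<le> 1" for y
  proof -
    have e: "exp (- \<beta> * B) \<le> exp (- \<beta> * l (tmat_vec p \<Theta> y) (e i))" "exp (- \<beta> * l (tmat_vec p \<Theta> y) (e i)) \<le> 1" for \<Theta>
      using \<beta> l(2,3) by (auto simp: mult_left_mono)
    have "exp (- \<beta> * B) = (\<Sum>\<Theta>\<in>D. w \<Theta> * exp (- \<beta> * B))" using w1 by (simp add: sum_distrib_right[symmetric])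
    also have "\<dots> \<le> Y y" unfolding Y_def using w e by (intro sum_mono mult_left_mono) auto
    finally show "exp (- \<beta> * B) \<le> Y y" .
    have "Y y \<le> (\<Sum>\<Theta>\<in>D. w \<Theta> * 1)" unfolding Y_def using w e by (intro sum_mono mult_left_mono) auto
    then show "Y y \<le> 1" using w1 by simp
  qed
  have lnY: "- (\<beta> * B) \<le> ln (Y y)" "ln (Y y) \<le> 0" for y
  proof -
    have Y0: "0 < Y y" using Ybnd(1)[of y] exp_gt_zero[of "- \<beta> * B"] by linarith
    have "ln (exp (- \<beta> * B)) \<le> ln (Y y)" using Ybnd(1)[of y] Y0 by (subst ln_le_cancel_iff) auto
    then show "- (\<beta> * B) \<le> ln (Y y)" by simp
    show "ln (Y y) \<le> 0" using Ybnd(2)[of y] Y0 by (subst ln_le_zero_iff) auto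
  qed
  define \<delta> where "\<delta> y = - ln (Y y) / ?a" for y
  have \<delta>: "0 \<le> \<delta> y" "\<delta> y \<le> B / real n" for y
  proof -
    show "0 \<le> \<delta> y" using lnY(2)[of y] a unfolding \<delta>_def by (intro divide_nonneg_pos) auto
    have "\<delta> y \<le> (\<beta> * B) / ?a" unfolding \<delta>_def using lnY(1)[of y] a by (intro divide_right_mono) auto
    also have "\<dots> = B / real n" using \<beta> by simp
    finally show "\<delta> y \<le> B / real n" .
  qed
  have law: "\<bar>(\<integral>y. g (f0 + \<delta> y) \<partial>N) - (g f0 + g' f0 * (\<integral>y. \<delta> y \<partial>N))\<bar> \<le> A * (B / real n)\<^sup>2" "integrable N (\<lambda>y. ln (Y y))"
    if N: "prob_space N" and sN [measurable_cong]: "sets N = sets (borel_vec p)" for N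
  proof -
    interpret N: prob_space N by fact
    have lm: "(\<lambda>v. l v c) \<in> borel_measurable borel" for c
    proof -
      have "continuous_on UNIV (\<lambda>v. (\<lambda>(v, e). l v e) (v, c))"
        by (rule continuous_on_compose2[OF l(1)]) (auto intro!: continuous_intros)
      then show ?thesis by (intro borel_measurable_continuous_onI) simp
    qed
    have "(\<lambda>y. l (tmat_vec p \<Theta> y) (e i)) \<in> borel_measurable N" for \<Theta>
      using measurable_compose[OF measurable_tmat_vec lm, of p \<Theta> "e i"] by (simp cong: measurable_cong_sets add: sN)
    then have Ym [measurable]: "Y \<in> borel_measurable N" unfolding Y_def[abs_def] by measurable
    then have \<delta>m [measurable]: "\<delta> \<in> borel_measurable N" unfolding \<delta>_def[abs_def] by measurable
    show "integrable N (\<lambda>y. ln (Y y))"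
    proof (rule N.integrable_const_bound[of _ "\<beta> * B"])
      have "\<bar>ln (Y y)\<bar> \<le> \<beta> * B" for y using lnY[of y] by linarith
      then show "AE y in N. norm (ln (Y y)) \<le> \<beta> * B" by simp
    qed measurable
    have i\<delta>: "integrable N \<delta>"
      by (rule N.integrable_const_bound[of _ "B / real n"]) (use \<delta> in auto)
    have ig: "integrable N (\<lambda>y. g (f0 + \<delta> y))"
      by (rule N.integrable_const_bound[of _ G]) (use g(3) gm in auto)
    have pt: "\<bar>g (f0 + \<delta> y) - (g f0 + g' f0 * \<delta> y)\<bar> \<le> A * (B / real n)\<^sup>2" for y
    proof -
      have "\<bar>g (f0 + \<delta> y) - (g f0 + g' f0 * \<delta> y)\<bar> \<le> A * (\<delta> y)\<^sup>2"
        using g(2)[of "f0 + \<delta> y" f0] by (simp add: algebra_simps)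
      also have "\<dots> \<le> A * (B / real n)\<^sup>2" using \<delta>[of y] A0 by (intro mult_left_mono power_mono) auto
      finally show ?thesis .
    qed
    have "(\<integral>y. g (f0 + \<delta> y) \<partial>N) - (g f0 + g' f0 * (\<integral>y. \<delta> y \<partial>N)) = (\<integral>y. g (f0 + \<delta> y) - (g f0 + g' f0 * \<delta> y) \<partial>N)"
      by (simp add: ig i\<delta> N.prob_space)
    also have "\<bar>\<dots>\<bar> \<le> (\<integral>y. \<bar>g (f0 + \<delta> y) - (g f0 + g' f0 * \<delta> y)\<bar> \<partial>N)"
      using integral_norm_bound[of N "\<lambda>y. g (f0 + \<delta> y) - (g f0 + g' f0 * \<delta> y)"] by simp
    also have "\<dots> \<le> (\<integral>y. A * (B / real n)\<^sup>2 \<partial>N)"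
      by (intro integral_mono integrable_abs Bochner_Integration.integrable_diff ig pt) (simp_all add: i\<delta>)
    finally show "\<bar>(\<integral>y. g (f0 + \<delta> y) \<partial>N) - (g f0 + g' f0 * (\<integral>y. \<delta> y \<partial>N))\<bar> \<le> A * (B / real n)\<^sup>2"
      by (simp add: N.prob_space)
  qed
  have d: "\<bar>g' f0 * (\<integral>y. \<delta> y \<partial>P) - g' f0 * (\<integral>y. \<delta> y \<partial>Q)\<bar> \<le> L / ?a * \<zeta> i"
  proof -
    have "(\<integral>y. \<delta> y \<partial>P) - (\<integral>y. \<delta> y \<partial>Q) = ((\<integral>y. ln (Y y) \<partial>Q) - (\<integral>y. ln (Y y) \<partial>P)) / ?a"
      unfolding \<delta>_def by (simp add: diff_divide_distrib)
    also have "\<bar>\<dots>\<bar> \<le> \<zeta> i / ?a"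
      using swap[of i w] i w w1 a unfolding Y_def by (simp add: abs_minus_commute divide_right_mono)
    finally have "\<bar>(\<integral>y. \<delta> y \<partial>P) - (\<integral>y. \<delta> y \<partial>Q)\<bar> \<le> \<zeta> i / ?a" .
    then have "\<bar>g' f0\<bar> * \<bar>(\<integral>y. \<delta> y \<partial>P) - (\<integral>y. \<delta> y \<partial>Q)\<bar> \<le> L * (\<zeta> i / ?a)"
      using g(1)[of f0] by (intro mult_mono) auto
    then show ?thesis by (simp add: abs_mult[symmetric] right_diff_distrib)
  qed
  have "\<bar>(\<integral>y. g (f0 + \<delta> y) \<partial>P) - (\<integral>y. g (f0 + \<delta> y) \<partial>Q)\<bar> \<le> L / ?a * \<zeta> i + 2 * A * (B / real n)\<^sup>2"
    using law(1)[OF PQ(1) sets(1)] law(1)[OF PQ(2) sets(2)] d by linarith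
  then show "\<bar>(\<integral>y. ?F (u(i := y)) \<partial>P) - (\<integral>y. ?F (u(i := y)) \<partial>Q)\<bar> \<le> L / ?a * \<zeta> i + 2 * A * (B / real n)\<^sup>2"
    unfolding soft \<delta>_def .
qed (use PQ g(3) in auto)

lemma frob_norm_le_sum:
  fixes \<Theta> :: "'k::finite \<Rightarrow> nat \<Rightarrow> real"
  shows "frob_norm p \<Theta> \<le> (\<Sum>j\<in>UNIV. L2_set (\<Theta> j) {..<p})"
proof -
  have "frob_norm p \<Theta> = L2_set (\<lambda>j. L2_set (\<Theta> j) {..<p}) UNIV"
    by (simp add: frob_norm_def L2_set_def sum_nonneg)
  also have "\<dots> \<le> (\<Sum>j\<in>UNIV. L2_set (\<Theta> j) {..<p})" by (rule L2_set_le_sum) simp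
  finally show ?thesis .
qed

text \<open>The columns of the minimizer over D are replaced by net points whose differences lie in
  \<epsilon> E. Elements of E have a bounded Euclidean norm, which pays for the penalty, and a
  bounded average of \<bar>dot\<bar> over the rows, which pays for the loss; \<open>CARD('k)\<close>
  counts the columns.\<close>

lemma Min_net_le:
  fixes l :: "real ^ 'k::finite \<Rightarrow> real \<Rightarrow> real"
  assumes D: "finite D" "N \<subseteq> D" "N \<noteq> {}" and n: "1 \<le> n" and \<epsilon>: "0 < \<epsilon>" and K: "0 \<le> K" "0 \<le> Kr"
    and l: "\<And>v v' e. \<bar>l v e - l v' e\<bar> \<le> K * norm (v - v')"
    and r: "\<And>\<Theta> \<Theta>'. \<Theta> \<in> D \<Longrightarrow> \<Theta>' \<in> D \<Longrightarrow> \<bar>r \<Theta> - r \<Theta>'\<bar> \<le> Kr * frob_norm p (\<lambda>j i. \<Theta> j i - \<Theta>' j i)"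
    and net: "\<And>\<Theta>. \<Theta> \<in> D \<Longrightarrow> \<exists>\<Theta>'\<in>N. \<forall>j. (\<lambda>i\<in>{..<p}. (\<Theta> j i - \<Theta>' j i) / \<epsilon>) \<in> E"
    and E: "\<And>\<theta>. \<theta> \<in> E \<Longrightarrow> L2_set \<theta> {..<p} \<le> R" "\<And>\<theta>. \<theta> \<in> E \<Longrightarrow> (\<Sum>i<n. \<bar>dot p \<theta> (X i)\<bar>) / real n \<le> W"
  shows "\<bar>Min (emp_risk n p l r e X ` D) - Min (emp_risk n p l r e X ` N)\<bar> \<le> \<epsilon> * real CARD('k) * (K * W + Kr * R)"
proof -
  let ?f = "emp_risk n p l r e X"
  have fN: "finite N" "D \<noteq> {}" using D finite_subset by auto
  have "Min (?f ` D) \<in> ?f ` D" using D fN by (intro Min_in) auto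
  then obtain \<Theta> where \<Theta>: "\<Theta> \<in> D" "Min (?f ` D) = ?f \<Theta>" by auto
  obtain \<Theta>' where \<Theta>': "\<Theta>' \<in> N" "\<And>j. (\<lambda>i\<in>{..<p}. (\<Theta> j i - \<Theta>' j i) / \<epsilon>) \<in> E" using net[OF \<Theta>(1)] by auto
  define \<theta> where "\<theta> j = (\<lambda>i\<in>{..<p}. (\<Theta> j i - \<Theta>' j i) / \<epsilon>)" for j
  have \<theta>E: "\<theta> j \<in> E" for j using \<Theta>'(2) by (simp add: \<theta>_def)
  have dd: "dot p (\<Theta>' j) x - dot p (\<Theta> j) x = - (\<epsilon> * dot p (\<theta> j) x)" for j x
    unfolding \<theta>_def dot_restrict unfolding dot_def sum_subtractf[symmetric] sum_distrib_left sum_negf[symmetric]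
    by (intro sum.cong refl) (use \<epsilon> in \<open>simp add: field_simps\<close>)
  have ll: "l (tmat_vec p \<Theta>' (X i)) (e i) - l (tmat_vec p \<Theta> (X i)) (e i) \<le> K * \<epsilon> * (\<Sum>j\<in>UNIV. \<bar>dot p (\<theta> j) (X i)\<bar>)" for i
  proof -
    have "norm (tmat_vec p \<Theta>' (X i) - tmat_vec p \<Theta> (X i)) \<le> (\<Sum>j\<in>UNIV. \<bar>(tmat_vec p \<Theta>' (X i) - tmat_vec p \<Theta> (X i)) $ j\<bar>)"
      by (rule norm_le_l1_cart)
    also have "\<dots> = \<epsilon> * (\<Sum>j\<in>UNIV. \<bar>dot p (\<theta> j) (X i)\<bar>)"
      using \<epsilon> by (simp add: tmat_vec_def dd abs_mult sum_distrib_left)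
    finally have "K * norm (tmat_vec p \<Theta>' (X i) - tmat_vec p \<Theta> (X i)) \<le> K * (\<epsilon> * (\<Sum>j\<in>UNIV. \<bar>dot p (\<theta> j) (X i)\<bar>))"
      using K by (intro mult_left_mono) auto
    then show ?thesis using l[of "tmat_vec p \<Theta>' (X i)" "e i" "tmat_vec p \<Theta> (X i)"] by (simp add: mult.assoc)
  qed
  have lsum: "(\<Sum>i<n. l (tmat_vec p \<Theta>' (X i)) (e i)) / real n - (\<Sum>i<n. l (tmat_vec p \<Theta> (X i)) (e i)) / real n \<le> \<epsilon> * real CARD('k) * (K * W)"
  proof -
    have "(\<Sum>i<n. l (tmat_vec p \<Theta>' (X i)) (e i)) / real n - (\<Sum>i<n. l (tmat_vec p \<Theta> (X i)) (e i)) / real n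
      = (\<Sum>i<n. l (tmat_vec p \<Theta>' (X i)) (e i) - l (tmat_vec p \<Theta> (X i)) (e i)) / real n"
      by (simp add: diff_divide_distrib sum_subtractf)
    also have "\<dots> \<le> (\<Sum>i<n. K * \<epsilon> * (\<Sum>j\<in>UNIV. \<bar>dot p (\<theta> j) (X i)\<bar>)) / real n"
      by (intro divide_right_mono sum_mono ll) simp
    also have "\<dots> = K * \<epsilon> * (\<Sum>j\<in>UNIV. (\<Sum>i<n. \<bar>dot p (\<theta> j) (X i)\<bar>) / real n)"
      by (simp add: sum_distrib_left[symmetric] sum_divide_distrib[symmetric] sum.swap[of _ "UNIV :: 'k set"])
    also have "\<dots> \<le> K * \<epsilon> * (\<Sum>j\<in>(UNIV :: 'k set). W)"
      using K \<epsilon> by (intro mult_left_mono sum_mono E(2) \<theta>E) auto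
    finally show ?thesis by (simp add: algebra_simps)
  qed
  have rr: "r \<Theta>' - r \<Theta> \<le> \<epsilon> * real CARD('k) * (Kr * R)"
  proof -
    have "\<bar>r \<Theta> - r \<Theta>'\<bar> \<le> Kr * frob_norm p (\<lambda>j i. \<Theta> j i - \<Theta>' j i)" using r \<Theta> \<Theta>' D by auto
    also have "\<dots> \<le> Kr * (\<Sum>j\<in>UNIV. L2_set (\<lambda>i. \<Theta> j i - \<Theta>' j i) {..<p})"
      using K by (intro mult_left_mono frob_norm_le_sum) auto
    also have "\<dots> \<le> Kr * (\<Sum>j\<in>(UNIV :: 'k set). \<epsilon> * R)"
    proof (intro mult_left_mono sum_mono)
      fix j
      have "L2_set (\<lambda>i. \<Theta> j i - \<Theta>' j i) {..<p} = L2_set (\<lambda>i. \<epsilon> * \<theta> j i) {..<p}"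
        using \<epsilon> by (intro L2_set_cong) (auto simp: \<theta>_def)
      also have "\<dots> = \<epsilon> * L2_set (\<theta> j) {..<p}" using \<epsilon> by (simp add: L2_set_right_distrib)
      also have "\<dots> \<le> \<epsilon> * R" using \<epsilon> E(1)[OF \<theta>E] by (intro mult_left_mono) auto
      finally show "L2_set (\<lambda>i. \<Theta> j i - \<Theta>' j i) {..<p} \<le> \<epsilon> * R" .
    qed (use K in auto)
    finally show ?thesis by (simp add: algebra_simps)
  qed
  have "Min (?f ` N) \<le> ?f \<Theta>'" using fN \<Theta>' by (intro Min_le) auto
  also have "?f \<Theta>' - ?f \<Theta> \<le> \<epsilon> * real CARD('k) * (K * W) + \<epsilon> * real CARD('k) * (Kr * R)"
    using lsum rr by (simp add: emp_risk_def)
  then have "?f \<Theta>' \<le> ?f \<Theta> + \<epsilon> * real CARD('k) * (K * W + Kr * R)" by (simp add: distrib_left)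
  finally have "Min (?f ` N) \<le> Min (?f ` D) + \<epsilon> * real CARD('k) * (K * W + Kr * R)" using \<Theta>(2) by simp
  moreover have "Min (?f ` D) \<le> Min (?f ` N)" using D fN by (intro Min_antimono) auto
  ultimately show ?thesis by linarith
qed

section \<open>Exponential moments and bounds on the loss\<close>

text \<open>The infimum in \<open>psi2_norm\<close> need not be attained, so the scale is taken
  strictly above K, which leaves room for an admissible t below it. With s = \<bar>z\<bar> / t, the
  inequality s \<le> 1 + s^2 passes from the linear to the quadratic exponent, and its 1 gives the
  factor exp 1.\<close>

lemma psi2_norm_exp_moment:
  assumes K: "psi2_norm M Z \<le> ennreal K" "K < K'" "0 < K'" and Z: "Z \<in> borel_measurable M"
  shows "(\<integral>\<^sup>+\<omega>. ennreal (exp (\<bar>Z \<omega>\<bar> / K')) \<partial>M) \<le> ennreal (2 * exp 1)"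
proof -
  have "ennreal K < ennreal K'" using K by (simp add: ennreal_less_iff ennreal_lessI)
  then have "Inf {ennreal t | t. 0 < t \<and> (\<integral>\<^sup>+ \<omega>. ennreal (exp ((Z \<omega>)\<^sup>2 / t\<^sup>2)) \<partial>M) \<le> 2} < ennreal K'"
    using K(1) unfolding psi2_norm_def by (rule le_less_trans[rotated])
  then obtain t where t: "0 < t" "(\<integral>\<^sup>+ \<omega>. ennreal (exp ((Z \<omega>)\<^sup>2 / t\<^sup>2)) \<partial>M) \<le> 2" "ennreal t < ennreal K'"
    unfolding Inf_less_iff by auto
  then have tK: "t < K'" by (simp add: ennreal_less_iff)
  have pt: "exp (\<bar>z\<bar> / K') \<le> exp 1 * exp (z\<^sup>2 / t\<^sup>2)" for z
  proof -
    have "\<bar>z\<bar> / K' \<le> \<bar>z\<bar> / t" using t tK by (intro divide_left_mono) auto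
    also have "\<dots> \<le> 1 + (\<bar>z\<bar> / t)\<^sup>2"
    proof -
      have "0 \<le> (\<bar>z\<bar> / t - 1 / 2)\<^sup>2" by simp
      then show ?thesis by (simp add: power2_diff power_divide)
    qed
    finally have "\<bar>z\<bar> / K' \<le> 1 + z\<^sup>2 / t\<^sup>2" by (simp add: power_divide)
    then show ?thesis by (simp add: exp_add[symmetric])
  qed
  have "(\<integral>\<^sup>+\<omega>. ennreal (exp (\<bar>Z \<omega>\<bar> / K')) \<partial>M) \<le> (\<integral>\<^sup>+\<omega>. ennreal (exp 1) * ennreal (exp ((Z \<omega>)\<^sup>2 / t\<^sup>2)) \<partial>M)"
    using pt by (intro nn_integral_mono) (simp add: ennreal_mult[symmetric])
  also have "\<dots> = ennreal (exp 1) * (\<integral>\<^sup>+\<omega>. ennreal (exp ((Z \<omega>)\<^sup>2 / t\<^sup>2)) \<partial>M)"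
    by (intro nn_integral_cmult measurable_compose[OF _ measurable_ennreal] measurable_compose[OF _ borel_measurable_exp]
        borel_measurable_divide borel_measurable_power Z borel_measurable_const)
  also have "\<dots> \<le> ennreal (exp 1) * 2" by (intro mult_left_mono t(2)) auto
  also have "\<dots> = ennreal (2 * exp 1)" by (simp add: ennreal_mult mult.commute)
  finally show ?thesis .
qed

lemma exp_moment_abs:
  assumes "(\<integral>\<^sup>+\<omega>. ennreal (exp (\<bar>Z \<omega>\<bar> / t)) \<partial>M) \<le> ennreal c" "0 < t" "0 \<le> c" and [measurable]: "Z \<in> borel_measurable M"
  shows "integrable M Z" "(\<integral>\<omega>. \<bar>Z \<omega>\<bar> \<partial>M) \<le> t * c"
proof -
  have le: "\<bar>z\<bar> \<le> t * exp (\<bar>z\<bar> / t)" for z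
    using exp_ge_add_one_self[of "\<bar>z\<bar> / t"] assms(2) by (simp add: field_simps)
  have "(\<integral>\<^sup>+\<omega>. ennreal \<bar>Z \<omega>\<bar> \<partial>M) \<le> (\<integral>\<^sup>+\<omega>. ennreal t * ennreal (exp (\<bar>Z \<omega>\<bar> / t)) \<partial>M)"
    using le assms(2) by (intro nn_integral_mono) (simp add: ennreal_mult[symmetric] ennreal_leI)
  also have "\<dots> = ennreal t * (\<integral>\<^sup>+\<omega>. ennreal (exp (\<bar>Z \<omega>\<bar> / t)) \<partial>M)"
    by (intro nn_integral_cmult) measurable
  also have "\<dots> \<le> ennreal t * ennreal c" by (intro mult_left_mono assms) auto
  also have "\<dots> = ennreal (t * c)" using assms by (simp add: ennreal_mult)
  finally have *: "(\<integral>\<^sup>+\<omega>. ennreal \<bar>Z \<omega>\<bar> \<partial>M) \<le> ennreal (t * c)" .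
  then have "(\<integral>\<^sup>+\<omega>. ennreal (norm (Z \<omega>)) \<partial>M) < \<infinity>"
    by (simp add: order_le_less_trans[OF _ ennreal_less_top])
  then show i: "integrable M Z" by (intro integrableI_bounded) auto
  have "ennreal (\<integral>\<omega>. \<bar>Z \<omega>\<bar> \<partial>M) = (\<integral>\<^sup>+\<omega>. ennreal \<bar>Z \<omega>\<bar> \<partial>M)"
    using i by (intro nn_integral_eq_integral[symmetric]) auto
  then show "(\<integral>\<omega>. \<bar>Z \<omega>\<bar> \<partial>M) \<le> t * c" using * assms by (metis ennreal_le_iff mult_nonneg_nonneg less_imp_le)
qed

section \<open>Gaussian integrals\<close>

lemma nn_integral_std_normal_exp:
  "(\<integral>\<^sup>+z. ennreal (exp (a * z)) \<partial>std_normal_distribution) = ennreal (exp (a\<^sup>2 / 2))"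
proof -
  have "(\<integral>\<^sup>+z. ennreal (exp (a * z)) \<partial>std_normal_distribution) =
      (\<integral>\<^sup>+z. ennreal (std_normal_density z) * ennreal (exp (a * z)) \<partial>lborel)"
    by (subst nn_integral_density) auto
  also have "\<dots> = (\<integral>\<^sup>+z. ennreal (exp (a\<^sup>2 / 2)) * ennreal (normal_density a 1 z) \<partial>lborel)"
  proof (intro nn_integral_cong)
    fix z
    have "exp (- z\<^sup>2 / 2) * exp (a * z) = exp (a\<^sup>2 / 2) * exp (- (z - a)\<^sup>2 / 2)"
      by (simp add: exp_add[symmetric] power2_diff field_simps)
    then show "ennreal (std_normal_density z) * ennreal (exp (a * z)) = ennreal (exp (a\<^sup>2 / 2)) * ennreal (normal_density a 1 z)"
      by (simp add: normal_density_def ennreal_mult[symmetric])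
  qed
  also have "\<dots> = ennreal (exp (a\<^sup>2 / 2)) * (\<integral>\<^sup>+z. ennreal (normal_density a 1 z) \<partial>lborel)"
    by (intro nn_integral_cmult) simp
  also have "(\<integral>\<^sup>+z. ennreal (normal_density a 1 z) \<partial>lborel) = emeasure (density lborel (normal_density a 1)) (space lborel)"
    by (simp add: emeasure_density)
  also have "\<dots> = 1"
    using prob_space.emeasure_space_1[OF prob_space_normal_density[of 1 a]] by simp
  finally show ?thesis by simp
qed

lemma prob_space_std_normal: "prob_space std_normal_distribution"
  by (rule prob_space_normal_density) simp

lemma std_normal_product_exp:
  "(\<integral>\<^sup>+z. ennreal (exp (\<Sum>j<p. u j * z j)) \<partial>Pi\<^sub>M {..<p::nat} (\<lambda>_. std_normal_distribution)) = ennreal (exp ((\<Sum>j<p. (u j)\<^sup>2) / 2))"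
proof -
  interpret prob_space std_normal_distribution by (rule prob_space_std_normal)
  interpret product_sigma_finite "\<lambda>_::nat. std_normal_distribution" by standard
  have "(\<integral>\<^sup>+z. ennreal (exp (\<Sum>j<p. u j * z j)) \<partial>Pi\<^sub>M {..<p} (\<lambda>_. std_normal_distribution)) =
    (\<integral>\<^sup>+z. (\<Prod>j<p. ennreal (exp (u j * z j))) \<partial>Pi\<^sub>M {..<p} (\<lambda>_. std_normal_distribution))"
    by (intro nn_integral_cong) (simp add: exp_sum prod_ennreal)
  also have "\<dots> = (\<Prod>j<p. \<integral>\<^sup>+z. ennreal (exp (u j * z)) \<partial>std_normal_distribution)"
    by (rule product_nn_integral_prod) auto
  also have "\<dots> = ennreal (exp ((\<Sum>j<p. (u j)\<^sup>2) / 2))"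
    by (simp only: nn_integral_std_normal_exp) (simp add: prod_ennreal exp_sum sum_divide_distrib)
  finally show ?thesis .
qed

text \<open>The cosine is the real part of a character and the phase m has modulus 1, so the modulus
  of the characteristic function is a bound.\<close>

lemma std_normal_product_cos:
  "\<bar>\<integral>z. cos (m + (\<Sum>j<p. u j * z j)) \<partial>Pi\<^sub>M {..<p::nat} (\<lambda>_. std_normal_distribution)\<bar> \<le> exp (- (\<Sum>j<p. (u j)\<^sup>2) / 2)"
proof -
  interpret S: prob_space std_normal_distribution by (rule prob_space_std_normal)
  interpret product_sigma_finite "\<lambda>_::nat. std_normal_distribution" by standard
  let ?N = "Pi\<^sub>M {..<p::nat} (\<lambda>_. std_normal_distribution)"
  interpret N: prob_space ?N by (rule prob_space_PiM) (rule prob_space_std_normal)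
  have i1: "integrable std_normal_distribution (\<lambda>x. iexp (a * x))" for a :: real
    by (rule S.integrable_const_bound[of _ 1]) auto
  have "(\<integral>z. (\<Prod>j<p. iexp (u j * z j)) \<partial>?N) = (\<Prod>j<p. \<integral>x. iexp (u j * x) \<partial>std_normal_distribution)"
    by (intro product_integral_prod i1) auto
  also have "\<dots> = (\<Prod>j<p. complex_of_real (exp (- (u j)\<^sup>2 / 2)))"
    using fun_cong[OF char_std_normal_distribution] by (simp add: char_def)
  also have "\<dots> = complex_of_real (exp (- (\<Sum>j<p. (u j)\<^sup>2) / 2))"
    by (simp add: exp_sum[symmetric] sum_negf sum_divide_distrib flip: of_real_prod)
  finally have prod: "(\<integral>z. (\<Prod>j<p. iexp (u j * z j)) \<partial>?N) = complex_of_real (exp (- (\<Sum>j<p. (u j)\<^sup>2) / 2))" .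
  have eq: "iexp (m + (\<Sum>j<p. u j * z j)) = iexp m * (\<Prod>j<p. iexp (u j * z j))" for z
    by (simp add: distrib_left exp_add sum_distrib_left exp_sum)
  have int: "integrable ?N (\<lambda>z. iexp (m + (\<Sum>j<p. u j * z j)))"
    by (rule N.integrable_const_bound[of _ 1]) auto
  have "(\<integral>z. cos (m + (\<Sum>j<p. u j * z j)) \<partial>?N) = (\<integral>z. Re (iexp (m + (\<Sum>j<p. u j * z j))) \<partial>?N)"
    by (simp only: Re_exp) simp
  also have "\<dots> = Re (\<integral>z. iexp (m + (\<Sum>j<p. u j * z j)) \<partial>?N)"
    by (rule integral_Re[OF int])
  also have "\<bar>\<dots>\<bar> \<le> cmod (\<integral>z. iexp (m + (\<Sum>j<p. u j * z j)) \<partial>?N)" by (rule abs_Re_le_cmod)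
  also have "(\<integral>z. iexp (m + (\<Sum>j<p. u j * z j)) \<partial>?N) = iexp m * (\<integral>z. (\<Prod>j<p. iexp (u j * z j)) \<partial>?N)"
    unfolding eq by simp
  also have "cmod \<dots> = exp (- (\<Sum>j<p. (u j)\<^sup>2) / 2)"
    unfolding prod norm_mult norm_of_real by simp
  finally show ?thesis .
qed

lemma mv_normal_map_measurable:
  "(\<lambda>z. \<lambda>i\<in>{..<p}. \<mu> i + mat_vec p A z i) \<in> measurable (Pi\<^sub>M {..<p} (\<lambda>_. std_normal_distribution)) (borel_vec p)"
proof (rule measurable_restrict)
  fix i assume "i \<in> {..<p}"
  have "(\<lambda>z. \<mu> i + (\<Sum>j<p. A i j * z j)) \<in> borel_measurable (Pi\<^sub>M {..<p} (\<lambda>_. std_normal_distribution))"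
    by measurable
  then show "(\<lambda>z. \<mu> i + mat_vec p A z i) \<in> borel_measurable (Pi\<^sub>M {..<p} (\<lambda>_. std_normal_distribution))"
    using \<open>i \<in> {..<p}\<close> by (simp add: mat_vec_def)
qed

lemma sets_mv_normal: "sets (mv_normal p \<mu> A) = sets (borel_vec p)"
  by (simp add: mv_normal_def)

lemma prob_space_mv_normal: "prob_space (mv_normal p \<mu> A)"
proof -
  interpret N: prob_space "Pi\<^sub>M {..<p} (\<lambda>_. std_normal_distribution)" by (rule prob_space_PiM) (rule prob_space_std_normal)
  show ?thesis unfolding mv_normal_def by (rule N.prob_space_distr) (rule mv_normal_map_measurable)
qed

lemma dot_mv_normal_map:
  "dot p \<theta> (\<lambda>i\<in>{..<p}. \<mu> i + mat_vec p A z i) = dot p \<theta> \<mu> + (\<Sum>j<p. (\<Sum>i<p. \<theta> i * A i j) * z j)"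
proof -
  have "dot p \<theta> (\<lambda>i\<in>{..<p}. \<mu> i + mat_vec p A z i) = (\<Sum>i<p. \<theta> i * \<mu> i + \<theta> i * (\<Sum>j<p. A i j * z j))"
    by (simp add: dot_def mat_vec_def distrib_left)
  also have "\<dots> = dot p \<theta> \<mu> + (\<Sum>i<p. \<Sum>j<p. \<theta> i * A i j * z j)"
    by (simp add: dot_def sum.distrib sum_distrib_left mult.assoc)
  also have "(\<Sum>i<p. \<Sum>j<p. \<theta> i * A i j * z j) = (\<Sum>j<p. (\<Sum>i<p. \<theta> i * A i j) * z j)"
    by (subst sum.swap) (simp add: sum_distrib_right)
  finally show ?thesis .
qed

text \<open>The variance of \<open>\<theta>\<^sup>T g\<close> cannot be read off from the bound on \<open>\<Sigma>\<^sup>1\<^sup>/\<^sup>2 \<theta>\<close> without knowing that the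
  square root chosen in \<open>psd_sqrt\<close> is symmetric; it is recovered instead from the Gaussian
  characteristic function, which by the domain of Gaussianity is close to that of \<open>\<theta>\<^sup>T x\<close>.\<close>

lemma mv_normal_exp_moment:
  assumes P: "prob_space P" "sets P = sets (borel_vec p)"
    and t: "0 < t" and c: "1 \<le> c" and mom: "(\<integral>\<^sup>+x. ennreal (exp (\<bar>dot p \<theta> x\<bar> / t)) \<partial>P) \<le> ennreal c"
    and close: "\<bar>(\<integral>x. cos (1 / (4 * t * c) * dot p \<theta> x) \<partial>P) - (\<integral>x. cos (1 / (4 * t * c) * dot p \<theta> x) \<partial>mv_normal p \<mu> A)\<bar> \<le> 1 / 4"
    and m: "\<bar>dot p \<theta> \<mu>\<bar> \<le> m"
  shows "(\<integral>\<^sup>+x. ennreal (exp (\<bar>dot p \<theta> x\<bar> / t)) \<partial>mv_normal p \<mu> A) \<le> ennreal (2 * exp (m / t + 16 * ln 2 * c\<^sup>2))"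
proof -
  interpret P: prob_space P by fact
  note [measurable_cong] = P(2)
  let ?N = "Pi\<^sub>M {..<p} (\<lambda>_. std_normal_distribution)"
  define B where "B = psd_sqrt p A"
  \<comment> \<open>Under the Gaussian law the linear form has mean
    \<open>dot p \<theta> \<mu>\<close> and variance s2, the squared norm of the transpose of B
    applied to \<theta>.\<close>
  define u where "u j = (\<Sum>i<p. \<theta> i * B i j)" for j
  define s2 where "s2 = (\<Sum>j<p. (u j)\<^sup>2)"
  \<comment> \<open>Chosen so that \<tau> t c = 1 / 4. Then 1 - \<bar>y\<bar> \<le> cos y gives an
    expected cosine of at least 3 / 4 under P, hence of at least 1 / 2 under the Gaussian law, and 1
    / 2 \<le> exp (- \<tau>^2 s2 / 2) bounds the variance.\<close>
  define \<tau> where "\<tau> = 1 / (4 * t * c)"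
  have \<tau>: "0 < \<tau>" using t c by (simp add: \<tau>_def)
  have mv: "mv_normal p \<mu> A = distr ?N (borel_vec p) (\<lambda>z. \<lambda>i\<in>{..<p}. \<mu> i + mat_vec p B z i)"
    by (simp add: mv_normal_def B_def)
  have dm: "dot p \<theta> (\<lambda>i\<in>{..<p}. \<mu> i + mat_vec p B z i) = dot p \<theta> \<mu> + (\<Sum>j<p. u j * z j)" for z
    unfolding dot_mv_normal_map u_def ..
  note [measurable] = mv_normal_map_measurable[where p=p and \<mu>=\<mu> and A=B]
  have "(\<integral>x. cos (\<tau> * dot p \<theta> x) \<partial>mv_normal p \<mu> A) = (\<integral>z. cos (\<tau> * (dot p \<theta> \<mu> + (\<Sum>j<p. u j * z j))) \<partial>?N)"
    unfolding mv by (subst integral_distr[OF mv_normal_map_measurable]) (measurable, simp only: dm)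
  also have "\<dots> = (\<integral>z. cos (\<tau> * dot p \<theta> \<mu> + (\<Sum>j<p. (\<tau> * u j) * z j)) \<partial>?N)"
    by (simp add: distrib_left sum_distrib_left mult.assoc)
  also have "\<dots> \<le> exp (- (\<Sum>j<p. (\<tau> * u j)\<^sup>2) / 2)"
    using std_normal_product_cos[where m="\<tau> * dot p \<theta> \<mu>" and p=p and u="\<lambda>j. \<tau> * u j"] by linarith
  also have "(\<Sum>j<p. (\<tau> * u j)\<^sup>2) = \<tau>\<^sup>2 * s2" by (simp add: s2_def power_mult_distrib sum_distrib_left)
  finally have up: "(\<integral>x. cos (\<tau> * dot p \<theta> x) \<partial>mv_normal p \<mu> A) \<le> exp (- (\<tau>\<^sup>2 * s2) / 2)" .
  have lo: "3 / 4 \<le> (\<integral>x. cos (\<tau> * dot p \<theta> x) \<partial>P)"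
  proof -
    note ab = exp_moment_abs[OF mom t]
    have i: "integrable P (dot p \<theta>)" "(\<integral>x. \<bar>dot p \<theta> x\<bar> \<partial>P) \<le> t * c" using c by (auto intro!: ab)
    have cosl: "1 - \<bar>y\<bar> \<le> cos y" for y :: real
    proof -
      have "1 - cos y = 2 * (sin (y / 2) * sin (y / 2))" using cos_double_sin[of "y / 2"] by (simp add: power2_eq_square)
      also have "\<dots> \<le> 2 * (\<bar>sin (y / 2)\<bar> * 1)"
      proof (intro mult_left_mono)
        have "sin (y / 2) * sin (y / 2) = \<bar>sin (y / 2)\<bar> * \<bar>sin (y / 2)\<bar>" by simp
        also have "\<dots> \<le> \<bar>sin (y / 2)\<bar> * 1" by (intro mult_left_mono) auto
        finally show "sin (y / 2) * sin (y / 2) \<le> \<bar>sin (y / 2)\<bar> * 1" .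
      qed simp
      also have "\<dots> \<le> \<bar>y\<bar>" using abs_sin_x_le_abs_x[of "y / 2"] by simp
      finally show ?thesis by simp
    qed
    have "1 - \<tau> * (t * c) \<le> 1 - \<tau> * (\<integral>x. \<bar>dot p \<theta> x\<bar> \<partial>P)" using i \<tau> by simp
    also have "\<dots> = (\<integral>x. 1 - \<tau> * \<bar>dot p \<theta> x\<bar> \<partial>P)" using i by (simp add: P.prob_space)
    also have "\<dots> \<le> (\<integral>x. cos (\<tau> * dot p \<theta> x) \<partial>P)"
    proof (intro integral_mono)
      show "integrable P (\<lambda>x. cos (\<tau> * dot p \<theta> x))" by (rule P.integrable_const_bound[of _ 1]) auto
      show "1 - \<tau> * \<bar>dot p \<theta> x\<bar> \<le> cos (\<tau> * dot p \<theta> x)" for x using cosl[of "\<tau> * dot p \<theta> x"] \<tau> by (simp add: abs_mult)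
    qed (use i in simp)
    also have "\<tau> * (t * c) = 1 / 4" using t c by (simp add: \<tau>_def)
    finally show ?thesis by simp
  qed
  have "1 / 2 \<le> exp (- (\<tau>\<^sup>2 * s2) / 2)" using lo up close unfolding \<tau>_def[symmetric] by linarith
  then have "ln (1 / 2) \<le> ln (exp (- (\<tau>\<^sup>2 * s2) / 2))" by (subst ln_le_cancel_iff) auto
  then have "\<tau>\<^sup>2 * s2 \<le> 2 * ln 2" by (simp add: ln_div)
  then have "s2 \<le> 2 * ln 2 / \<tau>\<^sup>2" using \<tau> by (simp add: field_simps)
  also have "\<dots> = 2 * (t\<^sup>2 * (16 * ln 2 * c\<^sup>2))" using t c by (simp add: \<tau>_def power_divide power_mult_distrib)
  finally have s2: "s2 / t\<^sup>2 / 2 \<le> 16 * ln 2 * c\<^sup>2" using t by (simp add: field_simps)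
  \<comment> \<open>The exponential of \<bar>w\<bar> is at most the sum of those of w and - w, which
    reduces the moment to two Gaussian Laplace transforms.\<close>
  have pt: "exp (\<bar>a + w\<bar> / t) \<le> exp (m / t) * (exp (w / t) + exp (- w / t))" if "\<bar>a\<bar> \<le> m" for a w
  proof -
    have "\<bar>a + w\<bar> / t \<le> m / t + \<bar>w\<bar> / t" using that t by (simp add: add_divide_distrib[symmetric] divide_right_mono)
    then have "exp (\<bar>a + w\<bar> / t) \<le> exp (m / t) * exp (\<bar>w\<bar> / t)" by (simp add: exp_add[symmetric])
    also have "exp (\<bar>w\<bar> / t) \<le> exp (w / t) + exp (- w / t)" by (cases "0 \<le> w") (auto simp: abs_if)
    finally show ?thesis by simp
  qed
  have half: "(\<integral>\<^sup>+z. ennreal (exp ((\<Sum>j<p. (\<sigma> * u j / t) * z j))) \<partial>?N) \<le> ennreal (exp (16 * ln 2 * c\<^sup>2))" if "\<sigma>\<^sup>2 = 1" for \<sigma> :: real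
  proof -
    have "(\<Sum>j<p. (\<sigma> * u j / t)\<^sup>2) = s2 / t\<^sup>2"
      using that by (simp add: s2_def power_mult_distrib power_divide sum_divide_distrib)
    then show ?thesis unfolding std_normal_product_exp using s2 by (simp add: ennreal_leI)
  qed
  have "(\<integral>\<^sup>+x. ennreal (exp (\<bar>dot p \<theta> x\<bar> / t)) \<partial>mv_normal p \<mu> A) =
    (\<integral>\<^sup>+z. ennreal (exp (\<bar>dot p \<theta> \<mu> + (\<Sum>j<p. u j * z j)\<bar> / t)) \<partial>?N)"
    unfolding mv by (subst nn_integral_distr) (measurable, simp only: dm)
  also have "\<dots> \<le> (\<integral>\<^sup>+z. ennreal (exp (m / t)) * (ennreal (exp (\<Sum>j<p. (1 * u j / t) * z j)) + ennreal (exp (\<Sum>j<p. (- 1 * u j / t) * z j))) \<partial>?N)"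
  proof (rule nn_integral_mono)
    fix z :: "nat \<Rightarrow> real"
    let ?w = "\<Sum>j<p. u j * z j"
    have e: "?w / t = (\<Sum>j<p. (1 * u j / t) * z j)" "- ?w / t = (\<Sum>j<p. (- 1 * u j / t) * z j)"
      by (simp_all add: sum_divide_distrib sum_negf)
    have "ennreal (exp (\<bar>dot p \<theta> \<mu> + ?w\<bar> / t)) \<le> ennreal (exp (m / t) * (exp (?w / t) + exp (- ?w / t)))"
      by (intro ennreal_leI pt m)
    then show "ennreal (exp (\<bar>dot p \<theta> \<mu> + ?w\<bar> / t)) \<le>
      ennreal (exp (m / t)) * (ennreal (exp (\<Sum>j<p. (1 * u j / t) * z j)) + ennreal (exp (\<Sum>j<p. (- 1 * u j / t) * z j)))"
      unfolding e by (simp add: ennreal_mult ennreal_plus)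
  qed
  also have "\<dots> = ennreal (exp (m / t)) * ((\<integral>\<^sup>+z. ennreal (exp (\<Sum>j<p. (1 * u j / t) * z j)) \<partial>?N) + (\<integral>\<^sup>+z. ennreal (exp (\<Sum>j<p. (- 1 * u j / t) * z j)) \<partial>?N))"
    by (subst nn_integral_cmult, measurable, subst nn_integral_add, measurable)
  also have "\<dots> \<le> ennreal (exp (m / t)) * (ennreal (exp (16 * ln 2 * c\<^sup>2)) + ennreal (exp (16 * ln 2 * c\<^sup>2)))"
    by (intro mult_left_mono add_mono half) auto
  also have "\<dots> = ennreal (2 * exp (m / t + 16 * ln 2 * c\<^sup>2))"
    by (simp add: ennreal_mult[symmetric] ennreal_plus[symmetric] exp_add algebra_simps del: ennreal_plus)
  finally show ?thesis .
qed

section \<open>Growth and truncation of the loss\<close>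

lemma powr_le_exp:
  fixes a t :: real
  assumes "0 \<le> a" "0 < t"
  shows "\<exists>A\<ge>0. \<forall>s\<ge>0. s powr a \<le> A * exp (s / t)"
proof -
  define m where "m = nat \<lceil>a\<rceil> + 1"
  have m: "1 \<le> m" "a \<le> real m" by (auto simp: m_def) linarith
  have "s powr a \<le> (1 + (t * real m) ^ m) * exp (s / t)" if s: "0 \<le> s" for s
  proof -
    have e1: "1 \<le> exp (s / t)" using s assms by simp
    \<comment> \<open>The m-th power of x \<le> exp x at x = s / (t m) will give the bound on
      s^m.\<close>
    have "s / (t * real m) \<le> exp (s / (t * real m))" using exp_ge_add_one_self[of "s / (t * real m)"] by linarith
    then have "(s / (t * real m)) ^ m \<le> exp (s / (t * real m)) ^ m"
      using s assms m by (intro power_mono) auto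
    also have "\<dots> = exp (s / t)" using m by (simp add: exp_of_nat_mult[symmetric])
    finally have "s ^ m / (t * real m) ^ m \<le> exp (s / t)" by (simp add: power_divide)
    then have sm: "s ^ m \<le> (t * real m) ^ m * exp (s / t)"
      using assms m by (simp add: pos_divide_le_eq mult.commute)
    have "s powr a \<le> 1 + s ^ m"
    proof (cases "s \<le> 1")
      case True
      then have "s powr a \<le> 1 powr a" using s assms by (intro powr_mono2) auto
      then show ?thesis using s by (simp add: add_increasing2)
    next
      case False
      then have "s powr a \<le> s powr real m" using m by (intro powr_mono) auto
      also have "\<dots> = s ^ m" using False by (simp add: powr_realpow)
      finally show ?thesis by simp
    qed
    also have "\<dots> \<le> exp (s / t) + (t * real m) ^ m * exp (s / t)" using e1 sm by linarith
    finally show ?thesis by (simp add: distrib_right)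
  qed
  then show ?thesis using assms by (intro exI[of _ "1 + (t * real m) ^ m"]) auto
qed

text \<open>A Lipschitz loss grows at most linearly, so both kinds of loss are covered by a single
  exponent b from here on.\<close>

lemma loss_polynomial_bound:
  fixes l :: "real ^ 'k::finite \<Rightarrow> real \<Rightarrow> real"
  assumes "lipschitz_loss l \<or> poly_growth_loss l" "\<And>v e. 0 \<le> l v e"
  shows "\<exists>K\<ge>0. \<exists>b\<ge>0. \<forall>v e. l v e \<le> K * (1 + norm v powr b + \<bar>e\<bar> powr b)"
  using assms(1)
proof
  assume "lipschitz_loss l"
  then obtain K where K: "0 < K" "\<And>v e v' e'. \<bar>l v e - l v' e'\<bar> \<le> K * (norm (v - v') + \<bar>e - e'\<bar>)"
    unfolding lipschitz_loss_def by blast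
  have "l v e \<le> (l 0 0 + K) * (1 + norm v powr 1 + \<bar>e\<bar> powr 1)" for v e
  proof -
    have "l v e \<le> l 0 0 + K * (norm v + \<bar>e\<bar>)" using K(2)[of v e 0 0] by simp
    also have "\<dots> \<le> (l 0 0 + K) * (1 + norm v + \<bar>e\<bar>)"
      using assms(2)[of 0 0] K(1) by (simp add: algebra_simps)
    finally show ?thesis by simp
  qed
  then show ?thesis using assms(2)[of 0 0] K(1) by (intro exI[of _ "l 0 0 + K"] conjI exI[of _ "1::real"]) auto
next
  assume "poly_growth_loss l"
  then obtain K a b where K: "0 < a" "a \<le> b" "\<And>v e. l v e \<le> K * (1 + norm v powr b + \<bar>e\<bar> powr b)"
    unfolding poly_growth_loss_def by blast
  have "0 \<le> K" using order_trans[OF assms(2) K(3)[of 0 0]] by simp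
  then show ?thesis using K by (intro exI[of _ K] conjI exI[of _ b]) auto
qed

text \<open>The square is taken for the truncation error, since the excess of l over B is at most
  l^2 / B. The bound uses exponentials of single coordinates because these are the moments that are
  controlled.\<close>

lemma loss_square_bound:
  fixes l :: "real ^ 'k::finite \<Rightarrow> real \<Rightarrow> real"
  assumes l: "lipschitz_loss l \<or> poly_growth_loss l" "\<And>v e. 0 \<le> l v e" and t: "0 < t"
  shows "\<exists>A\<ge>0. \<forall>v e. (l v e)\<^sup>2 \<le> A * ((\<Sum>j\<in>UNIV. exp (\<bar>v $ j\<bar> / t)) + exp (\<bar>e\<bar> / t))"
proof -
  obtain K b where K: "0 \<le> K" "0 \<le> b" "\<And>v e. l v e \<le> K * (1 + norm v powr b + \<bar>e\<bar> powr b)"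
    using loss_polynomial_bound[OF l] by metis
  let ?k = "real CARD('k)"
  \<comment> \<open>The scale is t times the number of coordinates because the norm of v is at most
    that number times the largest coordinate.\<close>
  obtain A1 where A1: "0 \<le> A1" "\<And>s. 0 \<le> s \<Longrightarrow> s powr (2 * b) \<le> A1 * exp (s / (?k * t))"
    using powr_le_exp[of "2 * b" "?k * t"] K(2) t by auto
  obtain A2 where A2: "0 \<le> A2" "\<And>s. 0 \<le> s \<Longrightarrow> s powr (2 * b) \<le> A2 * exp (s / t)"
    using powr_le_exp[of "2 * b" t] K(2) t by auto
  have "(l v e)\<^sup>2 \<le> (3 * K\<^sup>2 * (A1 + A2 + 1)) * ((\<Sum>j\<in>UNIV. exp (\<bar>v $ j\<bar> / t)) + exp (\<bar>e\<bar> / t))" for v e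
  proof -
    let ?x = "norm v powr b" and ?y = "\<bar>e\<bar> powr b"
    let ?S = "\<Sum>j\<in>UNIV. exp (\<bar>v $ j\<bar> / t)" and ?E = "exp (\<bar>e\<bar> / t)"
    have S0: "0 \<le> ?S" by (intro sum_nonneg) auto
    have E1: "1 \<le> ?E" using t by simp
    have x2: "?x\<^sup>2 \<le> A1 * ?S"
    proof -
      have "Max (range (\<lambda>i. \<bar>v $ i\<bar>)) \<in> range (\<lambda>i. \<bar>v $ i\<bar>)" by (intro Max_in) auto
      then obtain j where mx: "Max (range (\<lambda>i. \<bar>v $ i\<bar>)) = \<bar>v $ j\<bar>" by (rule imageE)
      have j: "\<bar>v $ i\<bar> \<le> \<bar>v $ j\<bar>" for i unfolding mx[symmetric] by (intro Max_ge) auto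
      have "norm v \<le> (\<Sum>i\<in>UNIV. \<bar>v $ i\<bar>)" by (rule norm_le_l1_cart)
      also have "\<dots> \<le> ?k * \<bar>v $ j\<bar>" using sum_bounded_above[of UNIV "\<lambda>i. \<bar>v $ i\<bar>" "\<bar>v $ j\<bar>"] j by simp
      finally have "norm v / (?k * t) \<le> \<bar>v $ j\<bar> / t" using t by (simp add: field_simps)
      then have "exp (norm v / (?k * t)) \<le> exp (\<bar>v $ j\<bar> / t)" by simp
      also have "\<dots> \<le> ?S" by (rule member_le_sum) auto
      finally have e: "exp (norm v / (?k * t)) \<le> ?S" .
      have "?x\<^sup>2 = norm v powr (2 * b)" by (simp add: power2_eq_square powr_add[symmetric])
      also have "\<dots> \<le> A1 * exp (norm v / (?k * t))" by (intro A1(2)) simp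
      also have "\<dots> \<le> A1 * ?S" using e A1(1) by (intro mult_left_mono) auto
      finally show ?thesis .
    qed
    have y2: "?y\<^sup>2 \<le> A2 * ?E"
      using A2(2)[of "\<bar>e\<bar>"] by (simp add: power2_eq_square powr_add[symmetric])
    have "(l v e)\<^sup>2 \<le> (K * (1 + ?x + ?y))\<^sup>2" using l(2) K(3) by (intro power_mono) auto
    also have "\<dots> = K\<^sup>2 * (1 + ?x + ?y)\<^sup>2" by (simp add: power_mult_distrib)
    also have "\<dots> \<le> K\<^sup>2 * (3 * (1 + ?x\<^sup>2 + ?y\<^sup>2))"
    proof (intro mult_left_mono)
      have "0 \<le> (1 - ?x)\<^sup>2 + (1 - ?y)\<^sup>2 + (?x - ?y)\<^sup>2" by simp
      then show "(1 + ?x + ?y)\<^sup>2 \<le> 3 * (1 + ?x\<^sup>2 + ?y\<^sup>2)" by (simp add: power2_eq_square algebra_simps)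
    qed simp
    also have "\<dots> \<le> K\<^sup>2 * (3 * (?E + A1 * ?S + A2 * ?E))"
      by (intro mult_left_mono add_mono E1 x2 y2) auto
    also have "\<dots> \<le> K\<^sup>2 * (3 * ((A1 + A2 + 1) * (?S + ?E)))"
    proof (intro mult_left_mono)
      have "(A1 + A2 + 1) * (?S + ?E) = (?E + A1 * ?S + A2 * ?E) + (A2 * ?S + ?S + A1 * ?E)" by (simp add: algebra_simps)
      moreover have "0 \<le> A2 * ?S + ?S + A1 * ?E" using A1(1) A2(1) S0 by (intro add_nonneg_nonneg mult_nonneg_nonneg) auto
      ultimately show "?E + A1 * ?S + A2 * ?E \<le> (A1 + A2 + 1) * (?S + ?E)" by linarith
    qed auto
    finally show ?thesis by (simp add: mult_ac)
  qed
  moreover have "0 \<le> 3 * K\<^sup>2 * (A1 + A2 + 1)" using A1 A2 by simp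
  ultimately show ?thesis by blast
qed

text \<open>In the case of polynomial growth the lower bound on l confines the region l < B to a
  bounded set, and a local Lipschitz constant covers all points at distance less than 1 from it. If
  neither point lies in the region, the truncated losses agree; points at distance at least 1 are
  covered by the range from 0 to B.\<close>

lemma truncated_loss_lipschitz:
  fixes l :: "real ^ 'k::finite \<Rightarrow> real \<Rightarrow> real"
  assumes l: "lipschitz_loss l \<or> poly_growth_loss l" "\<And>v e. 0 \<le> l v e" and B: "0 < B"
  shows "\<exists>K\<ge>0. \<forall>v v' e. \<bar>min (l v e) B - min (l v' e) B\<bar> \<le> K * norm (v - v')"
  using l(1)
proof
  assume "lipschitz_loss l"
  then obtain K where K: "0 < K" "\<And>v e v' e'. \<bar>l v e - l v' e'\<bar> \<le> K * (norm (v - v') + \<bar>e - e'\<bar>)"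
    unfolding lipschitz_loss_def by blast
  have "\<bar>min (l v e) B - min (l v' e) B\<bar> \<le> K * norm (v - v')" for v v' e
    using K(2)[of v e v' e] by (auto simp: min_def)
  then show ?thesis using K(1) by (intro exI[of _ K]) auto
next
  assume pg: "poly_growth_loss l"
  then obtain K0 K1 a where a: "0 < K1" "0 < a" "\<And>v e. - K0 + K1 * (norm v powr a + \<bar>e\<bar> powr a) \<le> l v e"
    unfolding poly_growth_loss_def by blast
  define M where "M = ((B + \<bar>K0\<bar>) / K1) powr (1 / a)"
  have bnd: "norm v \<le> M" "\<bar>e\<bar> \<le> M" if "l v e < B" for v e
  proof -
    have "K1 * (norm v powr a + \<bar>e\<bar> powr a) \<le> B + \<bar>K0\<bar>" using a(3)[of v e] that by linarith
    then have s: "norm v powr a + \<bar>e\<bar> powr a \<le> (B + \<bar>K0\<bar>) / K1" using a(1) by (simp add: field_simps)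
    have root: "x \<le> M" if "0 \<le> x" "x powr a \<le> (B + \<bar>K0\<bar>) / K1" for x
    proof -
      have "(x powr a) powr (1 / a) \<le> M" unfolding M_def using that a(2) by (intro powr_mono2) auto
      then show ?thesis using that a(2) by (simp add: powr_powr)
    qed
    have "norm v powr a \<le> (B + \<bar>K0\<bar>) / K1" "\<bar>e\<bar> powr a \<le> (B + \<bar>K0\<bar>) / K1"
      using s powr_ge_zero[of "norm v" a] powr_ge_zero[of "\<bar>e\<bar>" a] by linarith+
    then show "norm v \<le> M" "\<bar>e\<bar> \<le> M" by (auto intro: root)
  qed
  have M0: "0 \<le> M" by (simp add: M_def)
  \<comment> \<open>Where l < B, both v and e have norm at most M, and passing to a neighbour adds
    at most 1 to the norm of v: hence the radius 2 M + 1.\<close>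
  obtain K where K: "0 < K" "\<And>v e v' e'. norm (v, e) \<le> 2 * M + 1 \<Longrightarrow> norm (v', e') \<le> 2 * M + 1 \<Longrightarrow>
      \<bar>l v e - l v' e'\<bar> \<le> K * (norm (v - v') + \<bar>e - e'\<bar>)"
  proof -
    have "\<forall>B>0. \<exists>K>0. \<forall>v e v' e'. norm (v, e) \<le> B \<longrightarrow> norm (v', e') \<le> B \<longrightarrow>
       \<bar>l v e - l v' e'\<bar> \<le> K * (norm (v - v') + \<bar>e - e'\<bar>)"
      using pg unfolding poly_growth_loss_def by (rule conjunct1)
    moreover have "0 < 2 * M + 1" using M0 by simp
    ultimately show ?thesis using that by blast
  qed
  have "\<bar>min (l v e) B - min (l v' e) B\<bar> \<le> (K + B) * norm (v - v')" for v v' e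
  proof (cases "norm (v - v') \<ge> 1")
    case True
    have "\<bar>min (l v e) B - min (l v' e) B\<bar> \<le> B" using l(2)[of v e] l(2)[of v' e] B by (auto simp: min_def)
    also have "\<dots> \<le> B * norm (v - v')" using True B by simp
    also have "\<dots> \<le> (K + B) * norm (v - v')" using K(1) by (intro mult_right_mono) auto
    finally show ?thesis .
  next
    case False
    have near: "norm (w, e) \<le> 2 * M + 1 \<and> norm (w', e) \<le> 2 * M + 1" if "l w e < B" "norm (w - w') \<le> 1" for w w'
    proof -
      have "norm (w, e) \<le> norm w + norm e" "norm (w', e) \<le> norm w' + norm e" by (rule norm_Pair_le)+
      moreover have "norm w' \<le> norm w + 1" using norm_triangle_ineq2[of w' w] that(2) by (simp add: norm_minus_commute)
      ultimately show ?thesis using bnd[OF that(1)] by auto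
    qed
    have "\<bar>l v e - l v' e\<bar> \<le> K * norm (v - v')" if "l v e < B \<or> l v' e < B"
      using that
    proof
      assume "l v e < B"
      then show ?thesis using near[of v v'] K(2)[of v e v' e] False by simp
    next
      assume "l v' e < B"
      then show ?thesis using near[of v' v] K(2)[of v e v' e] False by (simp add: norm_minus_commute)
    qed
    moreover have "\<bar>min (l v e) B - min (l v' e) B\<bar> \<le> \<bar>l v e - l v' e\<bar>" by (auto simp: min_def)
    moreover have "\<bar>min (l v e) B - min (l v' e) B\<bar> = 0" if "\<not> (l v e < B \<or> l v' e < B)"
      using that by (simp add: min_def not_less)
    ultimately have "\<bar>min (l v e) B - min (l v' e) B\<bar> \<le> K * norm (v - v')"
      using K(1) by (cases "l v e < B \<or> l v' e < B") (auto intro: order_trans)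
    also have "\<dots> \<le> (K + B) * norm (v - v')" using B by (intro mult_right_mono) auto
    finally show ?thesis .
  qed
  then show ?thesis using K(1) B by (intro exI[of _ "K + B"]) auto
qed

section \<open>Finite exhaustion of compact constraint sets\<close>

lemma compact_finite_net:
  fixes K :: "'a::metric_space set"
  assumes "compact K" "0 < \<delta>"
  shows "\<exists>F. finite F \<and> F \<subseteq> K \<and> (\<forall>x\<in>K. \<exists>y\<in>F. dist x y < \<delta>)"
proof -
  obtain F where F: "F \<subseteq> K" "finite F" "K \<subseteq> (\<Union>y\<in>F. ball y \<delta>)"
    by (rule compactE_image[OF assms(1), of K "\<lambda>y. ball y \<delta>"]) (use assms(2) in auto)
  have "\<exists>y\<in>F. dist x y < \<delta>" if x: "x \<in> K" for x
  proof -
    obtain y where "y \<in> F" "x \<in> ball y \<delta>" using F(3) x by blast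
    then show ?thesis by (intro bexI[of _ y]) (simp_all add: dist_commute)
  qed
  with F show ?thesis by blast
qed

lemma compact_Pi_UNIV:
  fixes K :: "'k \<Rightarrow> 'a::topological_space set"
  assumes "\<And>j. compact (K j)"
  shows "compact {\<Theta>. \<forall>j. \<Theta> j \<in> K j}"
proof -
  have "compactin (product_topology (\<lambda>j::'k. euclidean :: 'a topology) UNIV) (PiE UNIV K)"
    using assms by (subst compactin_PiE) simp
  moreover have "PiE UNIV K = {\<Theta>. \<forall>j. \<Theta> j \<in> K j}" by (auto simp: PiE_def)
  ultimately show ?thesis by (simp add: euclidean_product_topology)
qed

text \<open>One sequence of finite sets serves all continuous f, hence all data at once. The minimum
  over the compact sets becomes a pointwise limit of finite minima, which makes it measurable and
  lets every quantitative estimate be made for finite sets.\<close>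

lemma finite_exhaustion:
  fixes K :: "'k::finite \<Rightarrow> 'a::metric_space set"
  assumes K: "\<And>j. compact (K j)" "\<And>j. K j \<noteq> {}"
  obtains D :: "nat \<Rightarrow> 'k \<Rightarrow> 'a set" where
    "\<And>m j. finite (D m j)" "\<And>m j. D m j \<noteq> {}" "\<And>m j. D m j \<subseteq> K j"
    "\<And>f :: ('k \<Rightarrow> 'a) \<Rightarrow> real. continuous_on {\<Theta>. \<forall>j. \<Theta> j \<in> K j} f \<Longrightarrow>
      (\<lambda>m. Min (f ` {\<Theta>. \<forall>j. \<Theta> j \<in> D m j})) \<longlonglongrightarrow> (LEAST v. v \<in> f ` {\<Theta>. \<forall>j. \<Theta> j \<in> K j})"
proof -
  have "\<forall>m j. \<exists>F. finite F \<and> F \<subseteq> K j \<and> (\<forall>x\<in>K j. \<exists>y\<in>F. dist x y < inverse (real (Suc m)))"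
    by (intro allI compact_finite_net K(1)) simp
  then obtain D where D: "\<And>m j. finite (D m j)" "\<And>m j. D m j \<subseteq> K j"
    "\<And>m j x. x \<in> K j \<Longrightarrow> \<exists>y\<in>D m j. dist x y < inverse (real (Suc m))" by metis
  have ne: "D m j \<noteq> {}" for m j using D(3)[of _ j m] K(2)[of j] by blast
  show ?thesis
  proof (rule that[OF D(1) ne D(2)])
    fix f :: "('k \<Rightarrow> 'a) \<Rightarrow> real"
    let ?K = "{\<Theta>. \<forall>j. \<Theta> j \<in> K j}" and ?D = "\<lambda>m. {\<Theta>. \<forall>j. \<Theta> j \<in> D m j}"
    assume f: "continuous_on ?K f"
    have "?K \<noteq> {}" using K(2) by (auto intro!: exI[of _ "\<lambda>j. SOME x. x \<in> K j"] some_in_eq[THEN iffD2])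
    with continuous_attains_inf[OF compact_Pi_UNIV[OF K(1)] _ f]
    obtain \<Theta> where \<Theta>: "\<Theta> \<in> ?K" "\<And>\<Theta>'. \<Theta>' \<in> ?K \<Longrightarrow> f \<Theta> \<le> f \<Theta>'" by blast
    have least: "(LEAST v. v \<in> f ` ?K) = f \<Theta>"
      using \<Theta> by (intro Least_equality) auto
    have fin: "finite (?D m)" for m
    proof -
      have "?D m = PiE UNIV (D m)" by (auto simp: PiE_def)
      then show ?thesis using finite_PiE[of UNIV "D m"] D(1) by simp
    qed
    have "\<forall>m j. \<exists>y. y \<in> D m j \<and> dist (\<Theta> j) y < inverse (real (Suc m))" using D(3) \<Theta>(1) by blast
    then obtain x where x: "\<And>m j. x m j \<in> D m j" "\<And>m j. dist (\<Theta> j) (x m j) < inverse (real (Suc m))" by metis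
    have "(\<lambda>m. x m j) \<longlonglongrightarrow> \<Theta> j" for j
    proof (rule tendsto_dist_iff[THEN iffD2], rule Lim_null_comparison)
      show "\<forall>\<^sub>F m in sequentially. norm (dist (x m j) (\<Theta> j)) \<le> inverse (real (Suc m))"
      proof (rule always_eventually, rule allI)
        fix m show "norm (dist (x m j) (\<Theta> j)) \<le> inverse (real (Suc m))"
          using x(2)[of j m] by (simp only: dist_commute[of "x m j"] real_norm_def abs_of_nonneg[OF zero_le_dist] less_imp_le)
      qed
    qed (rule LIMSEQ_inverse_real_of_nat)
    then have "limitin (product_topology (\<lambda>j::'k. euclidean :: 'a topology) UNIV) x \<Theta> sequentially"
      by (simp add: limitin_componentwise)
    then have xlim: "x \<longlonglongrightarrow> \<Theta>" by (simp add: euclidean_product_topology)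
    have xK: "x m j \<in> K j" for m j using x(1)[of m j] D(2)[of m j] by blast
    have sub: "?D m \<subseteq> ?K" for m using D(2)[of m] by blast
    have lim: "(\<lambda>m. f (x m)) \<longlonglongrightarrow> f \<Theta>"
      by (intro continuous_on_tendsto_compose[OF f xlim \<Theta>(1)]) (auto intro!: always_eventually xK)
    have lo: "f \<Theta> \<le> Min (f ` ?D m)" for m
    proof -
      have "f ` ?D m \<noteq> {}" using x(1)[of m] by auto
      then show ?thesis using fin[of m] \<Theta>(2) sub[of m] by (subst Min_ge_iff) blast+
    qed
    have hi: "Min (f ` ?D m) \<le> f (x m)" for m
      using fin[of m] x(1)[of m] by (intro Min_le) auto
    show "(\<lambda>m. Min (f ` ?D m)) \<longlonglongrightarrow> (LEAST v. v \<in> f ` ?K)"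
      unfolding least
      by (rule tendsto_sandwich[OF always_eventually[OF allI[OF lo]] always_eventually[OF allI[OF hi]] tendsto_const lim])
  qed
qed

lemma continuous_on_emp_risk:
  fixes l :: "real ^ 'k::finite \<Rightarrow> real \<Rightarrow> real"
  assumes l: "continuous_on UNIV (\<lambda>(v, e). l v e)" and r: "continuous_on T r"
  shows "continuous_on T (emp_risk n p l r e X)"
proof -
  have t: "continuous_on T (\<lambda>\<Theta>. tmat_vec p \<Theta> x)" for x
  proof -
    have "continuous_on T (\<lambda>\<Theta>::'k \<Rightarrow> nat \<Rightarrow> real. \<Theta> j i)" for j i
      by (rule continuous_on_product_then_coordinatewise, rule continuous_on_product_then_coordinatewise, rule continuous_on_id)
    then show ?thesis unfolding tmat_vec_def dot_def
      by (intro continuous_on_vec_lambda continuous_on_sum continuous_on_mult_right)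
  qed
  have "continuous_on T (\<lambda>\<Theta>. (\<lambda>(v, e). l v e) (tmat_vec p \<Theta> (X i), e i))" for i
    by (rule continuous_on_compose2[OF l]) (intro continuous_on_Pair t continuous_on_const subset_UNIV)+
  then have "continuous_on T (\<lambda>\<Theta>. l (tmat_vec p \<Theta> (X i)) (e i))" for i by simp
  then show ?thesis unfolding emp_risk_def[abs_def] divide_inverse
    by (intro continuous_on_add continuous_on_mult_right continuous_on_sum r)
qed

section \<open>Universality over a finite constraint set\<close>

lemma lipschitz_expectation_diff:
  assumes N: "prob_space N" and [measurable]: "f \<in> borel_measurable N" "g \<in> borel_measurable N"
    and \<psi>: "L-lipschitz_on UNIV \<psi>" "\<And>x. \<bar>\<psi> x\<bar> \<le> (G::real)"
    and b: "(\<integral>\<^sup>+x. ennreal \<bar>f x - g x\<bar> \<partial>N) \<le> ennreal b" "0 \<le> b"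
  shows "\<bar>(\<integral>x. \<psi> (f x) \<partial>N) - (\<integral>x. \<psi> (g x) \<partial>N)\<bar> \<le> L * b"
proof -
  interpret N: prob_space N by fact
  have L0: "0 \<le> L" using \<psi>(1) by (rule lipschitz_on_nonneg)
  have [measurable]: "\<psi> \<in> borel_measurable borel"
    using lipschitz_on_continuous_on[OF \<psi>(1)] by (rule borel_measurable_continuous_onI)
  have i: "integrable N (\<lambda>x. \<psi> (f x))" "integrable N (\<lambda>x. \<psi> (g x))"
    by (rule N.integrable_const_bound[of _ G]; simp add: \<psi>(2))+
  have ifg: "integrable N (\<lambda>x. \<bar>f x - g x\<bar>)"
    by (intro integrableI_bounded) (auto intro: order_le_less_trans[OF b(1)])
  have "ennreal (\<integral>x. \<bar>f x - g x\<bar> \<partial>N) \<le> ennreal b"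
    using b(1) nn_integral_eq_integral[OF ifg] by simp
  then have le: "(\<integral>x. \<bar>f x - g x\<bar> \<partial>N) \<le> b" using b(2) by simp
  have "\<bar>(\<integral>x. \<psi> (f x) \<partial>N) - (\<integral>x. \<psi> (g x) \<partial>N)\<bar> = \<bar>\<integral>x. \<psi> (f x) - \<psi> (g x) \<partial>N\<bar>" by (simp add: i)
  also have "\<dots> \<le> (\<integral>x. \<bar>\<psi> (f x) - \<psi> (g x)\<bar> \<partial>N)"
    using integral_norm_bound[of N "\<lambda>x. \<psi> (f x) - \<psi> (g x)"] by simp
  also have "\<dots> \<le> (\<integral>x. L * \<bar>f x - g x\<bar> \<partial>N)"
  proof (rule integral_mono)
    show "integrable N (\<lambda>x. \<bar>\<psi> (f x) - \<psi> (g x)\<bar>)" by (intro integrable_abs Bochner_Integration.integrable_diff i)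
    show "integrable N (\<lambda>x. L * \<bar>f x - g x\<bar>)" by (rule integrable_mult_right) (rule ifg)
    show "\<bar>\<psi> (f x) - \<psi> (g x)\<bar> \<le> L * \<bar>f x - g x\<bar>" for x
      using lipschitz_onD[OF \<psi>(1), of "f x" "g x"] by (simp add: dist_real_def)
  qed
  also have "\<dots> = L * (\<integral>x. \<bar>f x - g x\<bar> \<partial>N)" by simp
  also have "\<dots> \<le> L * b" using le L0 by (intro mult_left_mono) auto
  finally show ?thesis .
qed

text \<open>With 0 between the bounds the conclusion also holds for the default value 0 of an
  integral that does not exist, so no measurability has to be shown where it is applied.\<close>

lemma (in prob_space) integral_between:
  assumes "\<And>x. a \<le> f x" "\<And>x. f x \<le> b" "a \<le> 0" "0 \<le> (b::real)"
  shows "a \<le> (\<integral>x. f x \<partial>M)" "(\<integral>x. f x \<partial>M) \<le> b"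
proof -
  have "a \<le> (\<integral>x. f x \<partial>M) \<and> (\<integral>x. f x \<partial>M) \<le> b"
  proof (cases "integrable M f")
    case True
    have "(\<integral>x. a \<partial>M) \<le> (\<integral>x. f x \<partial>M)" "(\<integral>x. f x \<partial>M) \<le> (\<integral>x. b \<partial>M)"
      by (rule integral_mono; use True assms in simp)+
    then show ?thesis by (simp add: prob_space)
  qed (use assms in \<open>simp add: not_integrable_integral_eq\<close>)
  then show "a \<le> (\<integral>x. f x \<partial>M)" "(\<integral>x. f x \<partial>M) \<le> b" by auto
qed

lemma card_Pi_UNIV_le:
  fixes N :: "'k::finite \<Rightarrow> 'b set"
  assumes "\<And>j. finite (N j)" "\<And>j. real (card (N j)) \<le> a"
  shows "finite {\<Theta>. \<forall>j. \<Theta> j \<in> N j}" "real (card {\<Theta>. \<forall>j. \<Theta> j \<in> N j}) \<le> a ^ CARD('k)"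
proof -
  have eq: "{\<Theta>. \<forall>j. \<Theta> j \<in> N j} = PiE UNIV N" by (auto simp: PiE_def)
  show "finite {\<Theta>. \<forall>j. \<Theta> j \<in> N j}" unfolding eq by (intro finite_PiE) (auto simp: assms)
  have "real (card (PiE UNIV N)) = (\<Prod>j\<in>UNIV. real (card (N j)))" by (simp add: card_PiE)
  also have "\<dots> \<le> (\<Prod>j\<in>(UNIV :: 'k set). a)" by (intro prod_mono) (auto simp: assms)
  finally show "real (card {\<Theta>. \<forall>j. \<Theta> j \<in> N j}) \<le> a ^ CARD('k)" unfolding eq by simp
qed

text \<open>The noise is a fixed vector and enters only through its average exponential moment m, in
  which the bound is affine. The summands are, in order: truncation at B; the net of spacing
  \<epsilon>; the gap between minimum and free energy, which is entropy over \<beta> n; the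
  smoothing of \<psi>; the exchange of rows. The first four occur once for each law. In the last,
  \<zeta> is the exchange error for noise of size at most b1, the next term charges the rows with
  larger noise, and the final one is the Taylor remainder.\<close>

lemma finite_universality_bound:
  fixes e :: "nat \<Rightarrow> real" and l :: "real ^ 'k::finite \<Rightarrow> real \<Rightarrow> real" and D :: "'k \<Rightarrow> (nat \<Rightarrow> real) set"
  defines "D' \<equiv> {\<Theta>. \<forall>j. \<Theta> j \<in> D j}" and "k \<equiv> real CARD('k)"
  assumes PQ: "prob_space P" "prob_space Q" and sets: "sets P = sets (borel_vec p)" "sets Q = sets (borel_vec p)"
    and n: "1 \<le> n" and pn: "real p \<le> C0 * real n"
    and t: "0 < t" and c: "1 < c" and R: "0 < R"
    and D: "\<And>j. finite (D j)" "\<And>j. D j \<noteq> {}" "\<And>j. D j \<subseteq> exp_body p t c R P Q"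
    and l: "continuous_on UNIV (\<lambda>(v, e). l v e)" "\<And>v e. 0 \<le> l v e"
    and A: "0 \<le> A" "\<And>v e. (l v e)\<^sup>2 \<le> A * ((\<Sum>j\<in>UNIV. exp (\<bar>v $ j\<bar> / t)) + exp (\<bar>e\<bar> / t))"
    and B: "0 < B" "0 \<le> KB" "\<And>v v' e. \<bar>min (l v e) B - min (l v' e) B\<bar> \<le> KB * norm (v - v')"
    and r: "0 \<le> Kr" "\<And>\<Theta> \<Theta>'. \<Theta> \<in> D' \<Longrightarrow> \<Theta>' \<in> D' \<Longrightarrow> \<bar>r \<Theta> - r \<Theta>'\<bar> \<le> Kr * frob_norm p (\<lambda>j i. \<Theta> j i - \<Theta>' j i)"
    and \<psi>: "L-lipschitz_on UNIV \<psi>" "\<And>x. \<bar>\<psi> x\<bar> \<le> (G::real)"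
    and pos: "0 < \<epsilon>" "0 < \<beta>" "0 < h" "0 < b1" "0 \<le> \<zeta>"
    and swap: "\<And>N w e. N \<subseteq> D' \<Longrightarrow> (\<And>\<Theta>. \<Theta> \<in> N \<Longrightarrow> 0 \<le> w \<Theta>) \<Longrightarrow> sum w N = 1 \<Longrightarrow> \<bar>e\<bar> \<le> b1 \<Longrightarrow>
      \<bar>(\<integral>x. ln (\<Sum>\<Theta>\<in>N. w \<Theta> * exp (- \<beta> * min (l (tmat_vec p \<Theta> x) e) B)) \<partial>P) -
       (\<integral>x. ln (\<Sum>\<Theta>\<in>N. w \<Theta> * exp (- \<beta> * min (l (tmat_vec p \<Theta> x) e) B)) \<partial>Q)\<bar> \<le> \<zeta>"
  defines "m \<equiv> (\<Sum>i<n. exp (\<bar>e i\<bar> / t)) / real n"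
  shows "\<bar>(\<integral>X. \<psi> (Min (emp_risk n p l r e X ` D')) \<partial>Pi\<^sub>M {..<n} (\<lambda>_. P)) -
          (\<integral>X. \<psi> (Min (emp_risk n p l r e X ` D')) \<partial>Pi\<^sub>M {..<n} (\<lambda>_. Q))\<bar>
    \<le> 2 * (L * (A / B * (k * c + m))) +
      2 * (L * (\<epsilon> * k * (KB * (2 * t * (C0 * ln 5 + ln c + 1)) + Kr * R))) +
      2 * (L * (k * C0 * ln (1 + 2 / \<epsilon>) / \<beta>)) + 2 * (L * h) +
      (L / \<beta> * \<zeta> + 2 * L * B * t / b1 * m + 4 * L / h * B\<^sup>2 / real n)"
proof -
  interpret P: prob_space P by fact
  interpret Q: prob_space Q by fact
  have L0: "0 \<le> L" using \<psi>(1) by (rule lipschitz_on_nonneg)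
  have k0: "0 < k" by (simp add: k_def)
  have G0: "0 \<le> G" using \<psi>(2)[of 0] by linarith
  have C0: "0 \<le> C0" using pn n by (smt (verit) mult_neg_pos of_nat_0_le_iff of_nat_0_less_iff less_le_trans zero_less_one)
  define lB where "lB v e = min (l v e) B" for v e
  have lB: "continuous_on UNIV (\<lambda>(v, e). lB v e)" "\<And>v e. 0 \<le> lB v e" "\<And>v e. lB v e \<le> B"
    unfolding lB_def[abs_def] using continuous_on_min_loss[OF l(1)] l(2) B(1) by auto
  let ?\<Pi> = "\<lambda>N. Pi\<^sub>M {..<n} (\<lambda>_::nat. N) :: (nat \<Rightarrow> nat \<Rightarrow> real) measure"
  have D'fin: "finite D'" unfolding D'_def
    by (rule card_Pi_UNIV_le(1)[of D "\<Sum>j\<in>UNIV. real (card (D j))"]) (auto simp: D(1) intro!: member_le_sum)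
  have D'ne: "D' \<noteq> {}" using D(2) by (auto simp: D'_def intro!: exI[of _ "\<lambda>j. SOME x. x \<in> D j"] some_in_eq[THEN iffD2])
  have bod: "\<Theta> j \<in> exp_body p t c R P Q" if "\<Theta> \<in> D'" for \<Theta> j using that D(3)[of j] by (auto simp: D'_def)
  have Xi: "(\<lambda>X. X i) \<in> measurable (?\<Pi> N) (borel_vec p)" if "sets N = sets (borel_vec p)" "i < n" for N i
    using that measurable_component_singleton[of i "{..<n}" "\<lambda>_. N"] by (simp cong: measurable_cong_sets)
  have meas: "(\<lambda>X. emp_risk n p l' r e X \<Theta>) \<in> borel_measurable (?\<Pi> N)"
    if "continuous_on UNIV (\<lambda>(v, e). l' v e)" "sets N = sets (borel_vec p)" for l' :: "real ^ 'k \<Rightarrow> real \<Rightarrow> real" and N \<Theta>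
    by (rule measurable_emp_risk[OF that(1) Xi[OF that(2)]]) simp_all
  have Minm: "(\<lambda>X. Min (emp_risk n p l' r e X ` N')) \<in> borel_measurable (?\<Pi> N)"
    if "continuous_on UNIV (\<lambda>(v, e). l' v e)" "sets N = sets (borel_vec p)" "finite N'" for l' :: "real ^ 'k \<Rightarrow> real \<Rightarrow> real" and N N'
    by (intro borel_measurable_Min that(3) meas that)
  have pPi: "prob_space (?\<Pi> N)" if "prob_space N" for N using that by (intro prob_space_PiM)
  have trunc: "\<bar>(\<integral>X. \<psi> (Min (emp_risk n p l r e X ` D')) \<partial>?\<Pi> N) - (\<integral>X. \<psi> (Min (emp_risk n p lB r e X ` D')) \<partial>?\<Pi> N)\<bar>
      \<le> L * (A / B * (k * c + m))"
    if N: "prob_space N" "sets N = sets (borel_vec p)"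
      and mom: "\<And>\<Theta> j. \<Theta> \<in> D' \<Longrightarrow> (\<integral>\<^sup>+x. ennreal (exp (\<bar>dot p (\<Theta> j) x\<bar> / t)) \<partial>N) \<le> ennreal c" for N
  proof (rule lipschitz_expectation_diff[OF pPi[OF N(1)] Minm[OF l(1) N(2) D'fin] Minm[OF lB(1) N(2) D'fin] \<psi>])
    interpret N: prob_space N by fact
    note [measurable_cong] = N(2)
    define ci where "ci i = A / B * (k * c + exp (\<bar>e i\<bar> / t))" for i
    have ci0: "0 \<le> ci i" for i unfolding ci_def using A(1) B(1) k0 c by (intro mult_nonneg_nonneg add_nonneg_nonneg) auto
    have ex: "(\<integral>\<^sup>+x. ennreal (max 0 (l (tmat_vec p \<Theta> x) (e i) - B)) \<partial>N) \<le> ennreal (ci i)" if \<Theta>: "\<Theta> \<in> D'" for \<Theta> i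
    proof -
      \<comment> \<open>Where l exceeds B, the product of B and l - B is at most l^2.\<close>
      have pt: "max 0 (l v e' - B) \<le> A / B * ((\<Sum>j\<in>UNIV. exp (\<bar>v $ j\<bar> / t)) + exp (\<bar>e'\<bar> / t))" for v e'
      proof -
        have "max 0 (l v e' - B) \<le> (l v e')\<^sup>2 / B"
        proof (cases "l v e' \<le> B")
          case True then show ?thesis using B(1) by simp
        next
          case False
          then have "B * (l v e' - B) \<le> l v e' * l v e'" using B(1) l(2)[of v e'] by (intro mult_mono) auto
          then show ?thesis using False B(1) by (simp add: pos_le_divide_eq power2_eq_square mult.commute)
        qed
        also have "\<dots> \<le> A * ((\<Sum>j\<in>UNIV. exp (\<bar>v $ j\<bar> / t)) + exp (\<bar>e'\<bar> / t)) / B"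
          using B(1) by (intro divide_right_mono A(2)) auto
        finally show ?thesis by simp
      qed
      have AB: "0 \<le> A / B" using A(1) B(1) by simp
      have "(\<integral>\<^sup>+x. ennreal (max 0 (l (tmat_vec p \<Theta> x) (e i) - B)) \<partial>N) \<le>
        (\<integral>\<^sup>+x. ennreal (A / B) * ((\<Sum>j\<in>UNIV. ennreal (exp (\<bar>dot p (\<Theta> j) x\<bar> / t))) + ennreal (exp (\<bar>e i\<bar> / t))) \<partial>N)"
      proof (rule nn_integral_mono)
        fix x
        have "ennreal (max 0 (l (tmat_vec p \<Theta> x) (e i) - B)) \<le>
           ennreal (A / B * ((\<Sum>j\<in>UNIV. exp (\<bar>dot p (\<Theta> j) x\<bar> / t)) + exp (\<bar>e i\<bar> / t)))"
          using pt[of "tmat_vec p \<Theta> x" "e i"] by (intro ennreal_leI) (simp add: tmat_vec_def)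
        also have "\<dots> = ennreal (A / B) * ((\<Sum>j\<in>UNIV. ennreal (exp (\<bar>dot p (\<Theta> j) x\<bar> / t))) + ennreal (exp (\<bar>e i\<bar> / t)))"
          using AB by (subst ennreal_mult) (auto simp: ennreal_plus sum_nonneg intro!: add_nonneg_nonneg)
        finally show "ennreal (max 0 (l (tmat_vec p \<Theta> x) (e i) - B)) \<le> \<dots>" .
      qed
      also have "\<dots> = ennreal (A / B) * ((\<Sum>j\<in>UNIV. \<integral>\<^sup>+x. ennreal (exp (\<bar>dot p (\<Theta> j) x\<bar> / t)) \<partial>N) + ennreal (exp (\<bar>e i\<bar> / t)))"
        by (simp add: nn_integral_cmult nn_integral_add nn_integral_sum N.emeasure_space_1 del: sum_ennreal)
      also have "\<dots> \<le> ennreal (A / B) * ((\<Sum>j\<in>(UNIV :: 'k set). ennreal c) + ennreal (exp (\<bar>e i\<bar> / t)))"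
        by (intro mult_left_mono add_right_mono sum_mono mom \<Theta>) auto
      also have "(\<Sum>j\<in>(UNIV :: 'k set). ennreal c) = ennreal (k * c)"
        using c by (simp add: k_def ennreal_mult ennreal_of_nat_eq_real_of_nat)
      also have "ennreal (A / B) * (ennreal (k * c) + ennreal (exp (\<bar>e i\<bar> / t))) = ennreal (ci i)"
      proof -
        have "0 \<le> k * c" using k0 c by simp
        then have "ennreal (k * c) + ennreal (exp (\<bar>e i\<bar> / t)) = ennreal (k * c + exp (\<bar>e i\<bar> / t))"
          by (rule ennreal_plus[symmetric]) simp
        then show ?thesis unfolding ci_def using \<open>0 \<le> k * c\<close> AB by (simp only: ennreal_mult[OF AB add_nonneg_nonneg] exp_ge_zero)
      qed
      finally show ?thesis .
    qed
    have le: "Min (emp_risk n p lB r e X ` D') \<le> Min (emp_risk n p l r e X ` D')" for X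
    proof -
      have "Min (emp_risk n p l r e X ` D') \<in> emp_risk n p l r e X ` D'" using D'fin D'ne by (intro Min_in) auto
      then obtain \<Theta> where "\<Theta> \<in> D'" "Min (emp_risk n p l r e X ` D') = emp_risk n p l r e X \<Theta>" by auto
      moreover have "emp_risk n p lB r e X \<Theta> \<le> emp_risk n p l r e X \<Theta>"
        unfolding emp_risk_def lB_def by (intro add_right_mono divide_right_mono sum_mono) auto
      moreover have "Min (emp_risk n p lB r e X ` D') \<le> emp_risk n p lB r e X \<Theta>"
        using D'fin \<open>\<Theta> \<in> D'\<close> by (intro Min_le) auto
      ultimately show ?thesis by linarith
    qed
    have "(\<integral>\<^sup>+X. ennreal \<bar>Min (emp_risk n p l r e X ` D') - Min (emp_risk n p lB r e X ` D')\<bar> \<partial>?\<Pi> N)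
       = (\<integral>\<^sup>+X. ennreal (Min (emp_risk n p l r e X ` D') - Min (emp_risk n p (\<lambda>v e. min (l v e) B) r e X ` D')) \<partial>?\<Pi> N)"
      using le unfolding lB_def[abs_def] by (intro nn_integral_cong) simp
    also have "\<dots> \<le> ennreal ((\<Sum>i<n. ci i) / real n)"
      by (rule truncation_bound[OF N D'fin D'ne n l(1) ci0 ex])
    also have "(\<Sum>i<n. ci i) / real n = A / B * (k * c + m)"
    proof -
      have "(\<Sum>i<n. ci i) = A / B * (real n * (k * c) + (\<Sum>i<n. exp (\<bar>e i\<bar> / t)))"
        by (simp only: ci_def sum_distrib_left[symmetric] sum.distrib) simp
      then show ?thesis using n by (simp add: m_def field_simps)
    qed
    finally show "(\<integral>\<^sup>+X. ennreal \<bar>Min (emp_risk n p l r e X ` D') - Min (emp_risk n p lB r e X ` D')\<bar> \<partial>?\<Pi> N) \<le> ennreal (A / B * (k * c + m))" .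
    show "0 \<le> A / B * (k * c + m)" using A(1) B(1) k0 c unfolding m_def
      by (intro mult_nonneg_nonneg add_nonneg_nonneg divide_nonneg_nonneg sum_nonneg) auto
  qed
  define nb where "nb x y \<longleftrightarrow> (\<lambda>i\<in>{..<p}. (x i - y i) / \<epsilon>) \<in> exp_body p t c R P Q" for x y :: "nat \<Rightarrow> real"
  have "\<exists>F. finite F \<and> F \<subseteq> D j \<and> real (card F) \<le> (1 + 2 / \<epsilon>) ^ p \<and> (\<forall>x\<in>D j. \<exists>y\<in>F. nb x y)" for j
  proof (rule exp_body_net[OF PQ sets t c R pos(1) D(3)[of j]])
    fix F assume "finite F" "F \<subseteq> D j" "real (card F) \<le> (1 + 2 / \<epsilon>) ^ p"
      "\<And>x. x \<in> D j \<Longrightarrow> \<exists>y\<in>F. (\<lambda>i\<in>{..<p}. (x i - y i) / \<epsilon>) \<in> exp_body p t c R P Q"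
    then show ?thesis unfolding nb_def by (intro exI[of _ F] conjI ballI)
  qed
  then obtain F where F: "\<And>j. finite (F j)" "\<And>j. F j \<subseteq> D j" "\<And>j. real (card (F j)) \<le> (1 + 2 / \<epsilon>) ^ p"
    "\<And>j x. x \<in> D j \<Longrightarrow> \<exists>y\<in>F j. nb x y" by metis
  define F' where "F' = {\<Theta>. \<forall>j. \<Theta> j \<in> F j}"
  have F'D: "F' \<subseteq> D'" using F(2) unfolding F'_def D'_def by blast
  have F'fin: "finite F'" and F'card: "real (card F') \<le> ((1 + 2 / \<epsilon>) ^ p) ^ CARD('k)"
    unfolding F'_def by (rule card_Pi_UNIV_le; rule F)+
  have net: "\<exists>\<Theta>'\<in>F'. \<forall>j. nb (\<Theta> j) (\<Theta>' j)" if "\<Theta> \<in> D'" for \<Theta>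
  proof -
    have "\<forall>j. \<exists>y. y \<in> F j \<and> nb (\<Theta> j) y"
      using that F(4) unfolding D'_def by blast
    then obtain \<Theta>' where "\<And>j. \<Theta>' j \<in> F j" "\<And>j. nb (\<Theta> j) (\<Theta>' j)" by metis
    then show ?thesis unfolding F'_def by blast
  qed
  have F'ne: "F' \<noteq> {}"
  proof -
    obtain \<Theta> where "\<Theta> \<in> D'" using D'ne by auto
    from net[OF this] show ?thesis by auto
  qed
  obtain W where W: "W \<in> borel_measurable (Pi\<^sub>M {..<n} (\<lambda>_. borel_vec p))" "\<And>X. 0 \<le> W X"
    "\<And>X \<theta>. \<theta> \<in> exp_body p t c R P Q \<Longrightarrow> (\<Sum>i<n. \<bar>dot p \<theta> (X i)\<bar>) / real n \<le> W X"
    "(\<integral>\<^sup>+X. ennreal (W X) \<partial>?\<Pi> P) \<le> ennreal (2 * t * (C0 * ln 5 + ln c + 1))"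
    "(\<integral>\<^sup>+X. ennreal (W X) \<partial>?\<Pi> Q) \<le> ennreal (2 * t * (C0 * ln 5 + ln c + 1))"
    by (rule exp_body_avg_bound[OF PQ sets t c R n pn]) (rule that)
  define w0 where "w0 = 2 * t * (C0 * ln 5 + ln c + 1)"
  have w0: "0 \<le> w0" using t C0 c by (simp add: w0_def)
  have netdiff: "\<bar>(\<integral>X. \<psi> (Min (emp_risk n p lB r e X ` D')) \<partial>?\<Pi> N) - (\<integral>X. \<psi> (Min (emp_risk n p lB r e X ` F')) \<partial>?\<Pi> N)\<bar>
      \<le> L * (\<epsilon> * k * (KB * w0 + Kr * R))"
    if N: "prob_space N" "sets N = sets (borel_vec p)" and WN: "(\<integral>\<^sup>+X. ennreal (W X) \<partial>?\<Pi> N) \<le> ennreal w0" for N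
  proof (rule lipschitz_expectation_diff[OF pPi[OF N(1)] Minm[OF lB(1) N(2) D'fin] Minm[OF lB(1) N(2) F'fin] \<psi>])
    interpret \<Pi>: prob_space "?\<Pi> N" by (rule pPi[OF N(1)])
    have sPi: "sets (?\<Pi> N) = sets (Pi\<^sub>M {..<n} (\<lambda>_. borel_vec p))" by (intro sets_PiM_cong N(2) refl)
    have Wm: "W \<in> borel_measurable (?\<Pi> N)" using W(1) sPi by (simp cong: measurable_cong_sets)
    have pt: "\<bar>Min (emp_risk n p lB r e X ` D') - Min (emp_risk n p lB r e X ` F')\<bar> \<le> \<epsilon> * k * KB * W X + \<epsilon> * k * (Kr * R)" for X
    proof -
      have "\<bar>Min (emp_risk n p lB r e X ` D') - Min (emp_risk n p lB r e X ` F')\<bar> \<le> \<epsilon> * real CARD('k) * (KB * W X + Kr * R)"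
      proof (rule Min_net_le[where E="exp_body p t c R P Q", OF D'fin F'D F'ne n pos(1) B(2) r(1) _ r(2) net[unfolded nb_def]])
        show "\<bar>lB v e - lB v' e\<bar> \<le> KB * norm (v - v')" for v v' e unfolding lB_def by (rule B(3))
      qed (auto simp: exp_body_def intro: W(3))
      then show ?thesis by (simp add: k_def algebra_simps)
    qed
    have a0: "0 \<le> \<epsilon> * k * KB" "0 \<le> \<epsilon> * k * (Kr * R)" using pos k0 B r R by auto
    have "(\<integral>\<^sup>+X. ennreal \<bar>Min (emp_risk n p lB r e X ` D') - Min (emp_risk n p lB r e X ` F')\<bar> \<partial>?\<Pi> N)
      \<le> (\<integral>\<^sup>+X. ennreal (\<epsilon> * k * KB) * ennreal (W X) + ennreal (\<epsilon> * k * (Kr * R)) \<partial>?\<Pi> N)"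
    proof (rule nn_integral_mono)
      fix X
      have "ennreal \<bar>Min (emp_risk n p lB r e X ` D') - Min (emp_risk n p lB r e X ` F')\<bar> \<le> ennreal (\<epsilon> * k * KB * W X + \<epsilon> * k * (Kr * R))"
        by (intro ennreal_leI pt)
      also have "\<dots> = ennreal (\<epsilon> * k * KB * W X) + ennreal (\<epsilon> * k * (Kr * R))"
        using a0 W(2) by (intro ennreal_plus mult_nonneg_nonneg[of "\<epsilon> * k * KB"]) auto
      also have "ennreal (\<epsilon> * k * KB * W X) = ennreal (\<epsilon> * k * KB) * ennreal (W X)"
        using a0 W(2) by (intro ennreal_mult) auto
      finally show "ennreal \<bar>Min (emp_risk n p lB r e X ` D') - Min (emp_risk n p lB r e X ` F')\<bar> \<le>
        ennreal (\<epsilon> * k * KB) * ennreal (W X) + ennreal (\<epsilon> * k * (Kr * R))" .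
    qed
    also have "\<dots> = ennreal (\<epsilon> * k * KB) * (\<integral>\<^sup>+X. ennreal (W X) \<partial>?\<Pi> N) + ennreal (\<epsilon> * k * (Kr * R))"
      using Wm by (simp add: nn_integral_add nn_integral_cmult \<Pi>.emeasure_space_1)
    also have "\<dots> \<le> ennreal (\<epsilon> * k * KB) * ennreal w0 + ennreal (\<epsilon> * k * (Kr * R))"
      by (intro add_right_mono mult_left_mono WN) auto
    also have "\<dots> = ennreal (\<epsilon> * k * KB * w0 + \<epsilon> * k * (Kr * R))"
      using a0 w0 by (subst ennreal_plus) (auto simp: ennreal_mult intro!: mult_nonneg_nonneg[of "\<epsilon> * k * KB"])
    also have "\<epsilon> * k * KB * w0 + \<epsilon> * k * (Kr * R) = \<epsilon> * k * (KB * w0 + Kr * R)" by (simp add: algebra_simps)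
    finally show "(\<integral>\<^sup>+X. ennreal \<bar>Min (emp_risk n p lB r e X ` D') - Min (emp_risk n p lB r e X ` F')\<bar> \<partial>?\<Pi> N)
      \<le> ennreal (\<epsilon> * k * (KB * w0 + Kr * R))" .
    show "0 \<le> \<epsilon> * k * (KB * w0 + Kr * R)" using a0 w0 pos k0 B r R by (intro mult_nonneg_nonneg add_nonneg_nonneg) auto
  qed
  let ?a = "\<beta> * real n"
  have a: "0 < ?a" using pos n by simp
  define f where "f X = softmin ?a F' (emp_risk n p lB r e X)" for X
  have fm: "f \<in> borel_measurable (?\<Pi> N)" if "sets N = sets (borel_vec p)" for N
    unfolding f_def[abs_def] softmin_def using meas[OF lB(1) that] by measurable
  \<comment> \<open>The logarithm of the size of the product net is at most k p ln (1 + 2 /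
    \<epsilon>); p \<le> C0 n cancels the n of the inverse temperature.\<close>
  define s0 where "s0 = k * C0 * ln (1 + 2 / \<epsilon>) / \<beta>"
  have ln0: "0 \<le> ln (1 + 2 / \<epsilon>)" using pos by simp
  have s0: "0 \<le> s0" unfolding s0_def using k0 C0 ln0 pos by simp
  have lnc: "ln (real (card F')) / ?a \<le> s0"
  proof -
    have c0: "0 < real (card F')" using F'fin F'ne by (simp add: card_gt_0_iff)
    have "ln (real (card F')) \<le> ln (((1 + 2 / \<epsilon>) ^ p) ^ CARD('k))"
      using c0 F'card by (subst ln_le_cancel_iff) auto
    also have "\<dots> = k * (real p * ln (1 + 2 / \<epsilon>))" using pos by (simp add: ln_realpow k_def)
    also have "\<dots> \<le> k * (C0 * real n * ln (1 + 2 / \<epsilon>))"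
      using pn k0 ln0 by (intro mult_left_mono mult_right_mono) auto
    finally have "ln (real (card F')) / ?a \<le> k * (C0 * real n * ln (1 + 2 / \<epsilon>)) / ?a" using a by (intro divide_right_mono) auto
    also have "\<dots> = s0" using n pos by (simp add: s0_def)
    finally show ?thesis .
  qed
  have softdiff: "\<bar>(\<integral>X. \<psi> (Min (emp_risk n p lB r e X ` F')) \<partial>?\<Pi> N) - (\<integral>X. \<psi> (f X) \<partial>?\<Pi> N)\<bar> \<le> L * s0"
    if N: "prob_space N" "sets N = sets (borel_vec p)" for N
  proof (rule lipschitz_expectation_diff[OF pPi[OF N(1)] Minm[OF lB(1) N(2) F'fin] fm[OF N(2)] \<psi> _ s0])
    interpret \<Pi>: prob_space "?\<Pi> N" by (rule pPi[OF N(1)])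
    have "\<bar>Min (emp_risk n p lB r e X ` F') - f X\<bar> \<le> s0" for X
      using softmin_bounds[OF F'fin F'ne a, of "emp_risk n p lB r e X"] lnc unfolding f_def by linarith
    then have "(\<integral>\<^sup>+X. ennreal \<bar>Min (emp_risk n p lB r e X ` F') - f X\<bar> \<partial>?\<Pi> N) \<le> (\<integral>\<^sup>+X. ennreal s0 \<partial>?\<Pi> N)"
      by (intro nn_integral_mono ennreal_leI)
    then show "(\<integral>\<^sup>+X. ennreal \<bar>Min (emp_risk n p lB r e X ` F') - f X\<bar> \<partial>?\<Pi> N) \<le> ennreal s0"
      by (simp add: \<Pi>.emeasure_space_1)
  qed
  obtain g g' :: "real \<Rightarrow> real" where g: "\<And>x. \<bar>g x - \<psi> x\<bar> \<le> L * h" "\<And>x. \<bar>g' x\<bar> \<le> L"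
    "\<And>x y. \<bar>g y - g x - g' x * (y - x)\<bar> \<le> 2 * L / h * (y - x)\<^sup>2" "continuous_on UNIV g"
    by (rule lipschitz_smoothing[OF \<psi>(1) pos(3)]) (rule that)
  have Lh: "0 \<le> L * h" using L0 pos by simp
  have gb: "\<bar>g x\<bar> \<le> G + L * h" for x using g(1)[of x] \<psi>(2)[of x] by linarith
  have \<psi>m: "\<psi> \<in> borel_measurable borel"
    using lipschitz_on_continuous_on[OF \<psi>(1)] by (rule borel_measurable_continuous_onI)
  have gm: "g \<in> borel_measurable borel" using g(4) by (rule borel_measurable_continuous_onI)
  have gdiff: "\<bar>(\<integral>X. \<psi> (f X) \<partial>?\<Pi> N) - (\<integral>X. g (f X) \<partial>?\<Pi> N)\<bar> \<le> L * h"
    if N: "prob_space N" "sets N = sets (borel_vec p)" for N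
  proof -
    interpret \<Pi>: prob_space "?\<Pi> N" by (rule pPi[OF N(1)])
    have "integrable (?\<Pi> N) (\<lambda>X. \<psi> (f X))"
      by (rule \<Pi>.integrable_const_bound[of _ G]) (use \<psi>(2) measurable_compose[OF fm[OF N(2)] \<psi>m] in auto)
    moreover have "integrable (?\<Pi> N) (\<lambda>X. g (f X))"
      by (rule \<Pi>.integrable_const_bound[of _ "G + L * h"]) (use gb measurable_compose[OF fm[OF N(2)] gm] in auto)
    ultimately have "\<bar>(\<integral>X. \<psi> (f X) \<partial>?\<Pi> N) - (\<integral>X. g (f X) \<partial>?\<Pi> N)\<bar> = \<bar>\<integral>X. \<psi> (f X) - g (f X) \<partial>?\<Pi> N\<bar>" by simp
    moreover have "- (L * h) \<le> \<psi> (f X) - g (f X)" "\<psi> (f X) - g (f X) \<le> L * h" for X using g(1)[of "f X"] by linarith+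
    then have "- (L * h) \<le> (\<integral>X. \<psi> (f X) - g (f X) \<partial>?\<Pi> N)" "(\<integral>X. \<psi> (f X) - g (f X) \<partial>?\<Pi> N) \<le> L * h"
      by (rule \<Pi>.integral_between; use Lh in simp)+
    ultimately show ?thesis by linarith
  qed
  \<comment> \<open>The added term pays for rows with noise beyond b1: there the logarithm lies
    between - \<beta> B and 0 under either law, and \<open>\<bar>e i\<bar> / b1\<close> exceeds
    1.\<close>
  define \<zeta>i where "\<zeta>i i = \<zeta> + 2 * \<beta> * B / b1 * \<bar>e i\<bar>" for i
  have sw: "\<bar>(\<integral>x. ln (\<Sum>\<Theta>\<in>F'. w \<Theta> * exp (- \<beta> * lB (tmat_vec p \<Theta> x) (e i))) \<partial>P) -
       (\<integral>x. ln (\<Sum>\<Theta>\<in>F'. w \<Theta> * exp (- \<beta> * lB (tmat_vec p \<Theta> x) (e i))) \<partial>Q)\<bar> \<le> \<zeta>i i"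
    if w: "\<And>\<Theta>. \<Theta> \<in> F' \<Longrightarrow> 0 \<le> w \<Theta>" "sum w F' = 1" for w i
  proof (cases "\<bar>e i\<bar> \<le> b1")
    case True
    have "0 \<le> 2 * \<beta> * B / b1 * \<bar>e i\<bar>" using pos B by simp
    then show ?thesis using swap[OF F'D w True] unfolding \<zeta>i_def lB_def by linarith
  next
    case False
    define Y where "Y x = (\<Sum>\<Theta>\<in>F'. w \<Theta> * exp (- \<beta> * lB (tmat_vec p \<Theta> x) (e i)))" for x
    have lnY: "- (\<beta> * B) \<le> ln (Y x)" "ln (Y x) \<le> 0" for x
    proof -
      have ee: "exp (- \<beta> * B) \<le> exp (- \<beta> * lB (tmat_vec p \<Theta> x) (e i))" "exp (- \<beta> * lB (tmat_vec p \<Theta> x) (e i)) \<le> 1" for \<Theta>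
        using pos lB(2,3) by (auto simp: mult_left_mono)
      have "exp (- \<beta> * B) = (\<Sum>\<Theta>\<in>F'. w \<Theta> * exp (- \<beta> * B))" using w(2) by (simp add: sum_distrib_right[symmetric])
      also have "\<dots> \<le> Y x" unfolding Y_def using w(1) ee by (intro sum_mono mult_left_mono) auto
      finally have lo: "exp (- \<beta> * B) \<le> Y x" .
      have "Y x \<le> (\<Sum>\<Theta>\<in>F'. w \<Theta> * 1)" unfolding Y_def using w(1) ee by (intro sum_mono mult_left_mono) auto
      then have hi: "Y x \<le> 1" using w(2) by simp
      have Y0: "0 < Y x" using lo exp_gt_zero[of "- \<beta> * B"] by linarith
      have "ln (exp (- \<beta> * B)) \<le> ln (Y x)" using lo Y0 by (subst ln_le_cancel_iff) auto
      then show "- (\<beta> * B) \<le> ln (Y x)" by simp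
      show "ln (Y x) \<le> 0" using hi Y0 by (subst ln_le_zero_iff) auto
    qed
    have bB: "0 \<le> \<beta> * B" using pos B by simp
    have "- (\<beta> * B) \<le> (\<integral>x. ln (Y x) \<partial>P)" "(\<integral>x. ln (Y x) \<partial>P) \<le> 0"
      by (rule P.integral_between[OF lnY]; use bB in simp)+
    moreover have "- (\<beta> * B) \<le> (\<integral>x. ln (Y x) \<partial>Q)" "(\<integral>x. ln (Y x) \<partial>Q) \<le> 0"
      by (rule Q.integral_between[OF lnY]; use bB in simp)+
    moreover have "2 * (\<beta> * B) * 1 \<le> 2 * (\<beta> * B) * (\<bar>e i\<bar> / b1)"
      using False pos bB by (intro mult_left_mono) auto
    ultimately have "\<bar>(\<integral>x. ln (Y x) \<partial>P) - (\<integral>x. ln (Y x) \<partial>Q)\<bar> \<le> 2 * (\<beta> * B) * (\<bar>e i\<bar> / b1)" by linarith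
    also have "\<dots> \<le> \<zeta>i i" using pos by (simp add: \<zeta>i_def mult.assoc)
    finally show ?thesis unfolding Y_def .
  qed
  have uni: "\<bar>(\<integral>X. g (f X) \<partial>?\<Pi> P) - (\<integral>X. g (f X) \<partial>?\<Pi> Q)\<bar> \<le> L / \<beta> * \<zeta> + 2 * L * B * t / b1 * m + 4 * L / h * B\<^sup>2 / real n"
  proof -
    have "\<bar>(\<integral>X. g (f X) \<partial>?\<Pi> P) - (\<integral>X. g (f X) \<partial>?\<Pi> Q)\<bar> \<le> (\<Sum>i<n. L / ?a * \<zeta>i i + 2 * (2 * L / h) * (B / real n)\<^sup>2)"
      unfolding f_def
      by (rule softmin_universality[OF PQ sets F'fin F'ne n pos(2) lB g(2,3) gb g(4) sw])
    also have "\<dots> = L / ?a * (\<Sum>i<n. \<zeta>i i) + real n * (2 * (2 * L / h) * (B / real n)\<^sup>2)"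
      by (simp add: sum.distrib sum_distrib_left)
    also have "real n * (2 * (2 * L / h) * (B / real n)\<^sup>2) = 4 * L / h * B\<^sup>2 / real n"
      using n by (simp add: power2_eq_square)
    also have "L / ?a * (\<Sum>i<n. \<zeta>i i) \<le> L / \<beta> * \<zeta> + 2 * L * B * t / b1 * m"
    proof -
      \<comment> \<open>Turns the size of the noise into the exponential moment that m
        averages.\<close>
      have ab: "\<bar>y\<bar> \<le> t * exp (\<bar>y\<bar> / t)" for y
        using exp_ge_add_one_self[of "\<bar>y\<bar> / t"] t by (simp add: field_simps)
      have "(\<Sum>i<n. \<zeta>i i) \<le> (\<Sum>i<n. \<zeta> + 2 * \<beta> * B / b1 * (t * exp (\<bar>e i\<bar> / t)))"
        unfolding \<zeta>i_def using pos B(1) ab by (intro sum_mono add_left_mono mult_left_mono) auto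
      also have "\<dots> = (\<Sum>i<n. \<zeta>) + 2 * \<beta> * B / b1 * (t * (\<Sum>i<n. exp (\<bar>e i\<bar> / t)))"
        by (simp only: sum.distrib sum_distrib_left)
      also have "(\<Sum>i<n. exp (\<bar>e i\<bar> / t)) = real n * m" using n by (simp add: m_def)
      also have "(\<Sum>i<n. \<zeta>) + 2 * \<beta> * B / b1 * (t * (real n * m)) = real n * (\<zeta> + 2 * \<beta> * B / b1 * (t * m))"
        by (simp add: algebra_simps)
      finally have "L / ?a * (\<Sum>i<n. \<zeta>i i) \<le> L / ?a * (real n * (\<zeta> + 2 * \<beta> * B / b1 * (t * m)))"
        using L0 a by (intro mult_left_mono) auto
      also have "\<dots> = L / \<beta> * \<zeta> + 2 * L * B * t / b1 * m"
        using n pos by (simp add: field_simps)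
      finally show ?thesis .
    qed
    finally show ?thesis by simp
  qed
  have bP: "(\<integral>\<^sup>+x. ennreal (exp (\<bar>dot p (\<Theta> j) x\<bar> / t)) \<partial>P) \<le> ennreal c"
    and bQ: "(\<integral>\<^sup>+x. ennreal (exp (\<bar>dot p (\<Theta> j) x\<bar> / t)) \<partial>Q) \<le> ennreal c" if "\<Theta> \<in> D'" for \<Theta> j
    using bod[OF that, of j] by (auto simp: exp_body_def)
  have tP: "\<bar>(\<integral>X. \<psi> (Min (emp_risk n p l r e X ` D')) \<partial>?\<Pi> P) - (\<integral>X. \<psi> (Min (emp_risk n p lB r e X ` D')) \<partial>?\<Pi> P)\<bar> \<le> L * (A / B * (k * c + m))"
  proof (rule trunc[OF PQ(1) sets(1)])
    fix \<Theta> and j :: 'k assume "\<Theta> \<in> D'"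
    then show "(\<integral>\<^sup>+x. ennreal (exp (\<bar>dot p (\<Theta> j) x\<bar> / t)) \<partial>P) \<le> ennreal c" by (rule bP)
  qed
  have tQ: "\<bar>(\<integral>X. \<psi> (Min (emp_risk n p l r e X ` D')) \<partial>?\<Pi> Q) - (\<integral>X. \<psi> (Min (emp_risk n p lB r e X ` D')) \<partial>?\<Pi> Q)\<bar> \<le> L * (A / B * (k * c + m))"
  proof (rule trunc[OF PQ(2) sets(2)])
    fix \<Theta> and j :: 'k assume "\<Theta> \<in> D'"
    then show "(\<integral>\<^sup>+x. ennreal (exp (\<bar>dot p (\<Theta> j) x\<bar> / t)) \<partial>Q) \<le> ennreal c" by (rule bQ)
  qed
  have WP: "(\<integral>\<^sup>+X. ennreal (W X) \<partial>?\<Pi> P) \<le> ennreal w0" unfolding w0_def by (rule W(4))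
  have nP: "\<bar>(\<integral>X. \<psi> (Min (emp_risk n p lB r e X ` D')) \<partial>?\<Pi> P) - (\<integral>X. \<psi> (Min (emp_risk n p lB r e X ` F')) \<partial>?\<Pi> P)\<bar>
      \<le> L * (\<epsilon> * k * (KB * w0 + Kr * R))"
    by (rule netdiff[OF PQ(1) sets(1) WP])
  have WQ: "(\<integral>\<^sup>+X. ennreal (W X) \<partial>?\<Pi> Q) \<le> ennreal w0" unfolding w0_def by (rule W(5))
  have nQ: "\<bar>(\<integral>X. \<psi> (Min (emp_risk n p lB r e X ` D')) \<partial>?\<Pi> Q) - (\<integral>X. \<psi> (Min (emp_risk n p lB r e X ` F')) \<partial>?\<Pi> Q)\<bar>
      \<le> L * (\<epsilon> * k * (KB * w0 + Kr * R))"
    by (rule netdiff[OF PQ(2) sets(2) WQ])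
  have sP: "\<bar>(\<integral>X. \<psi> (Min (emp_risk n p lB r e X ` F')) \<partial>?\<Pi> P) - (\<integral>X. \<psi> (f X) \<partial>?\<Pi> P)\<bar> \<le> L * s0"
    by (rule softdiff[OF PQ(1) sets(1)])
  have sQ: "\<bar>(\<integral>X. \<psi> (Min (emp_risk n p lB r e X ` F')) \<partial>?\<Pi> Q) - (\<integral>X. \<psi> (f X) \<partial>?\<Pi> Q)\<bar> \<le> L * s0"
    by (rule softdiff[OF PQ(2) sets(2)])
  have gP: "\<bar>(\<integral>X. \<psi> (f X) \<partial>?\<Pi> P) - (\<integral>X. g (f X) \<partial>?\<Pi> P)\<bar> \<le> L * h" by (rule gdiff[OF PQ(1) sets(1)])
  have gQ: "\<bar>(\<integral>X. \<psi> (f X) \<partial>?\<Pi> Q) - (\<integral>X. g (f X) \<partial>?\<Pi> Q)\<bar> \<le> L * h" by (rule gdiff[OF PQ(2) sets(2)])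
  \<comment> \<open>Four links for each law, and the two chains are joined by the exchange of
    rows.\<close>
  have chain: "\<bar>a0 - b0\<bar> \<le> 2 * u + 2 * v + 2 * w + 2 * x + z"
    if "\<bar>a0 - a1\<bar> \<le> u" "\<bar>b0 - b1\<bar> \<le> u" "\<bar>a1 - a2\<bar> \<le> v" "\<bar>b1 - b2\<bar> \<le> v"
      "\<bar>a2 - a3\<bar> \<le> w" "\<bar>b2 - b3\<bar> \<le> w" "\<bar>a3 - a4\<bar> \<le> x" "\<bar>b3 - b4\<bar> \<le> x" "\<bar>a4 - b4\<bar> \<le> z"
    for a0 a1 a2 a3 a4 b0 b1 b2 b3 b4 u v w x z :: real
    using that unfolding abs_le_iff by (elim conjE, intro conjI) linarith+
  show ?thesis unfolding w0_def[symmetric] s0_def[symmetric]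
    by (rule chain[OF tP tQ nP nQ sP sQ gP gQ uni])
qed

section \<open>Universality of the minimal risk\<close>

text \<open>Independence makes the joint law the product of the two laws, by agreement on
  rectangles; the rest is Fubini.\<close>

lemma indep_rv_integral:
  fixes H :: "'b \<times> 'c \<Rightarrow> real"
  assumes M: "prob_space M" and ind: "indep_rv M N1 Y1 N2 Y2"
    and H: "H \<in> borel_measurable (N1 \<Otimes>\<^sub>M N2)" "\<And>z. \<bar>H z\<bar> \<le> G"
  shows "(\<integral>\<omega>. H (Y1 \<omega>, Y2 \<omega>) \<partial>M) = (\<integral>a. (\<integral>b. H (a, b) \<partial>distr M N2 Y2) \<partial>distr M N1 Y1)"
proof -
  interpret M: prob_space M by fact
  have Y [measurable]: "Y1 \<in> measurable M N1" "Y2 \<in> measurable M N2"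
    and I: "M.indep_set {Y1 -` A \<inter> space M | A. A \<in> sets N1} {Y2 -` A \<inter> space M | A. A \<in> sets N2}"
    using ind by (auto simp: indep_rv_def)
  interpret D1: prob_space "distr M N1 Y1" by (rule M.prob_space_distr) (rule Y)
  interpret D2: prob_space "distr M N2 Y2" by (rule M.prob_space_distr) (rule Y)
  interpret D12: pair_prob_space "distr M N1 Y1" "distr M N2 Y2" ..
  have eq: "distr M N1 Y1 \<Otimes>\<^sub>M distr M N2 Y2 = distr M (N1 \<Otimes>\<^sub>M N2) (\<lambda>\<omega>. (Y1 \<omega>, Y2 \<omega>))"
  proof (rule pair_measure_eqI)
    show "sigma_finite_measure (distr M N1 Y1)" "sigma_finite_measure (distr M N2 Y2)" by unfold_locales
    show "sets (distr M N1 Y1 \<Otimes>\<^sub>M distr M N2 Y2) = sets (distr M (N1 \<Otimes>\<^sub>M N2) (\<lambda>\<omega>. (Y1 \<omega>, Y2 \<omega>)))"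
      by (simp cong: sets_pair_measure_cong)
    fix A B assume AB: "A \<in> sets (distr M N1 Y1)" "B \<in> sets (distr M N2 Y2)"
    then have AB': "A \<in> sets N1" "B \<in> sets N2" by auto
    have "M.prob ((Y1 -` A \<inter> space M) \<inter> (Y2 -` B \<inter> space M)) = M.prob (Y1 -` A \<inter> space M) * M.prob (Y2 -` B \<inter> space M)"
      using AB' by (intro M.indep_setD[OF I]) auto
    moreover have "(\<lambda>\<omega>. (Y1 \<omega>, Y2 \<omega>)) -` (A \<times> B) \<inter> space M = (Y1 -` A \<inter> space M) \<inter> (Y2 -` B \<inter> space M)" by auto
    ultimately show "emeasure (distr M N1 Y1) A * emeasure (distr M N2 Y2) B =
      emeasure (distr M (N1 \<Otimes>\<^sub>M N2) (\<lambda>\<omega>. (Y1 \<omega>, Y2 \<omega>))) (A \<times> B)"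
      using AB' by (simp add: emeasure_distr M.emeasure_eq_measure ennreal_mult)
  qed
  have Hm: "H \<in> borel_measurable (distr M N1 Y1 \<Otimes>\<^sub>M distr M N2 Y2)"
    unfolding eq using H(1) by simp
  have "integrable (distr M N1 Y1 \<Otimes>\<^sub>M distr M N2 Y2) H"
    by (rule D12.P.integrable_const_bound[of _ G]) (use Hm H(2) in auto)
  then have "(\<integral>a. (\<integral>b. H (a, b) \<partial>distr M N2 Y2) \<partial>distr M N1 Y1) = (\<integral>z. H z \<partial>(distr M N1 Y1 \<Otimes>\<^sub>M distr M N2 Y2))"
    by (rule D12.integral_fst')
  also have "\<dots> = (\<integral>\<omega>. H (Y1 \<omega>, Y2 \<omega>) \<partial>M)"
    unfolding eq using H(1) by (intro integral_distr) measurable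
  finally show ?thesis ..
qed

lemma emp_risk_restrict:
  "emp_risk n p l r (\<lambda>i\<in>{..<n}. e i) (\<lambda>i\<in>{..<n}. A i) = emp_risk n p l r e A"
  by (rule ext) (auto simp: emp_risk_def intro!: sum.cong)

text \<open>Conditioning on the noise: the inner integral runs over n independent rows with the
  noise vector held fixed, the situation of \<open>finite_universality_bound\<close>.\<close>

lemma iid_data_integral:
  fixes l :: "real ^ 'k::finite \<Rightarrow> real \<Rightarrow> real" and X :: "nat \<Rightarrow> 'a \<Rightarrow> nat \<Rightarrow> real"
  assumes M: "prob_space M" and n: "1 \<le> n"
    and X: "prob_space.indep_vars M (\<lambda>_. borel_vec p) X {..<n}" "\<And>i. i < n \<Longrightarrow> distr M (borel_vec p) (X i) = P"
    and ind: "indep_rv M (Pi\<^sub>M {..<n} (\<lambda>_. borel)) (\<lambda>\<omega>. \<lambda>i\<in>{..<n}. eps i \<omega>)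
         (Pi\<^sub>M {..<n} (\<lambda>_. borel_vec p)) (\<lambda>\<omega>. \<lambda>i\<in>{..<n}. X i \<omega>)"
    and l: "continuous_on UNIV (\<lambda>(v, e). l v e)" and D: "finite D"
    and \<psi>: "\<psi> \<in> borel_measurable borel" "\<And>x. \<bar>\<psi> x\<bar> \<le> (G::real)"
  shows "(\<integral>\<omega>. \<psi> (Min (emp_risk n p l r (\<lambda>i. eps i \<omega>) (\<lambda>i. X i \<omega>) ` D)) \<partial>M) =
    (\<integral>e. (\<integral>A. \<psi> (Min (emp_risk n p l r e A ` D)) \<partial>Pi\<^sub>M {..<n} (\<lambda>_. P))
      \<partial>distr M (Pi\<^sub>M {..<n} (\<lambda>_. borel)) (\<lambda>\<omega>. \<lambda>i\<in>{..<n}. eps i \<omega>))"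
    and "(\<lambda>e. \<integral>A. \<psi> (Min (emp_risk n p l r e A ` D)) \<partial>Pi\<^sub>M {..<n} (\<lambda>_. P)) \<in>
      borel_measurable (Pi\<^sub>M {..<n} (\<lambda>_. borel))"
proof -
  interpret M: prob_space M by fact
  have Xm: "X i \<in> measurable M (borel_vec p)" if "i < n" for i
    using X(1) that unfolding M.indep_vars_def by auto
  have "distr M (Pi\<^sub>M {..<n} (\<lambda>_. borel_vec p)) (\<lambda>\<omega>. \<lambda>i\<in>{..<n}. X i \<omega>) = Pi\<^sub>M {..<n} (\<lambda>i. distr M (borel_vec p) (X i))"
    using X(1) n Xm by (subst M.indep_vars_iff_distr_eq_PiM'[symmetric]) (auto simp: lessThan_empty_iff)
  also have "\<dots> = Pi\<^sub>M {..<n} (\<lambda>_. P)" by (intro PiM_cong refl X(2)) auto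
  finally have PX: "distr M (Pi\<^sub>M {..<n} (\<lambda>_. borel_vec p)) (\<lambda>\<omega>. \<lambda>i\<in>{..<n}. X i \<omega>) = Pi\<^sub>M {..<n} (\<lambda>_. P)" .
  let ?N = "Pi\<^sub>M {..<n} (\<lambda>_. borel) \<Otimes>\<^sub>M Pi\<^sub>M {..<n} (\<lambda>_. borel_vec p) :: ((nat \<Rightarrow> real) \<times> (nat \<Rightarrow> nat \<Rightarrow> real)) measure"
  define H where "H z = \<psi> (Min (emp_risk n p l r (fst z) (snd z) ` D))" for z
  have "(\<lambda>z. Min (emp_risk n p l r (fst z) (snd z) ` D)) \<in> borel_measurable ?N"
    by (intro borel_measurable_Min D measurable_emp_risk l) auto
  then have Hm: "H \<in> borel_measurable ?N" unfolding H_def[abs_def] by (rule measurable_compose[OF _ \<psi>(1)])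
  show "(\<integral>\<omega>. \<psi> (Min (emp_risk n p l r (\<lambda>i. eps i \<omega>) (\<lambda>i. X i \<omega>) ` D)) \<partial>M) =
    (\<integral>e. (\<integral>A. \<psi> (Min (emp_risk n p l r e A ` D)) \<partial>Pi\<^sub>M {..<n} (\<lambda>_. P))
      \<partial>distr M (Pi\<^sub>M {..<n} (\<lambda>_. borel)) (\<lambda>\<omega>. \<lambda>i\<in>{..<n}. eps i \<omega>))"
    using indep_rv_integral[OF M ind Hm, of G] \<psi>(2)
    unfolding H_def fst_conv snd_conv emp_risk_restrict PX by blast
  have pP: "prob_space P" using X(2)[of 0] n M.prob_space_distr[OF Xm[of 0]] by auto
  interpret PP: prob_space "Pi\<^sub>M {..<n} (\<lambda>_. P)" by (rule prob_space_PiM) (rule pP)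
  have sP: "sets P = sets (borel_vec p)" using X(2)[of 0] n by auto
  have "sets (Pi\<^sub>M {..<n} (\<lambda>_. P)) = sets (Pi\<^sub>M {..<n} (\<lambda>_. borel_vec p))" by (intro sets_PiM_cong sP refl)
  then have "sets (Pi\<^sub>M {..<n} (\<lambda>_. borel) \<Otimes>\<^sub>M Pi\<^sub>M {..<n} (\<lambda>_. P)) = sets ?N" by (intro sets_pair_measure_cong refl)
  then have "(\<lambda>(e, A). H (e, A)) \<in> borel_measurable (Pi\<^sub>M {..<n} (\<lambda>_. borel) \<Otimes>\<^sub>M Pi\<^sub>M {..<n} (\<lambda>_. P))"
    using Hm by (simp cong: measurable_cong_sets)
  from PP.borel_measurable_lebesgue_integral[OF this]
  show "(\<lambda>e. \<integral>A. \<psi> (Min (emp_risk n p l r e A ` D)) \<partial>Pi\<^sub>M {..<n} (\<lambda>_. P)) \<in> borel_measurable (Pi\<^sub>M {..<n} (\<lambda>_. borel))"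
    unfolding H_def fst_conv snd_conv .
qed

section \<open>Bounded Lipschitz test functions\<close>

lemma cos_sin_lipschitz:
  fixes \<tau> :: real
  assumes "0 \<le> \<tau>"
  shows "\<tau>-lipschitz_on UNIV (\<lambda>y. cos (\<tau> * y))" "\<tau>-lipschitz_on UNIV (\<lambda>y. sin (\<tau> * y))"
proof -
  have half: "\<bar>2 * (a * sin y)\<bar> \<le> \<bar>2 * y\<bar>" if "\<bar>a\<bar> \<le> 1" for a y :: real
  proof -
    have "\<bar>a\<bar> * \<bar>sin y\<bar> \<le> 1 * \<bar>y\<bar>" using that abs_sin_x_le_abs_x[of y] by (intro mult_mono) auto
    then show ?thesis by (simp add: abs_mult)
  qed
  have c: "\<bar>cos x - cos y\<bar> \<le> \<bar>x - y\<bar>" for x y :: real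
    using half[of "sin ((x + y) / 2)" "(y - x) / 2"] by (simp add: cos_diff_cos abs_minus_commute)
  have s: "\<bar>sin x - sin y\<bar> \<le> \<bar>x - y\<bar>" for x y :: real
    using half[of "cos ((x + y) / 2)" "(x - y) / 2"] by (simp add: sin_diff_sin mult.commute mult.left_commute)
  have e: "\<bar>\<tau> * x - \<tau> * y\<bar> = \<tau> * \<bar>x - y\<bar>" for x y using assms by (simp add: right_diff_distrib[symmetric] abs_mult)
  show "\<tau>-lipschitz_on UNIV (\<lambda>y. cos (\<tau> * y))"
    using c[of "\<tau> * _" "\<tau> * _"] by (intro lipschitz_onI assms) (simp add: dist_real_def e[symmetric])
  show "\<tau>-lipschitz_on UNIV (\<lambda>y. sin (\<tau> * y))"
    using s[of "\<tau> * _" "\<tau> * _"] by (intro lipschitz_onI assms) (simp add: dist_real_def e[symmetric])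
qed

text \<open>Uniformity over u in \<tau> S is contained in the supremum over S, taken for the test
  functions cos (\<tau> y) and sin (\<tau> y). The addition formula separates the phase, so these
  two functions settle all s at once.\<close>

lemma domain_of_gaussianity_trig:
  assumes dog: "domain_of_gaussianity p S law_x \<mu> \<Sigma>"
    and law: "\<And>n. n \<ge> 1 \<Longrightarrow> prob_space (law_x n) \<and> sets (law_x n) = sets (borel_vec (p n))"
    and \<tau>: "0 \<le> \<tau>" and \<delta>: "0 < \<delta>"
  shows "eventually (\<lambda>n. \<forall>u s. freq (p n) (S n) \<tau> u \<longrightarrow>
    \<bar>(\<integral>x. cos (dot (p n) u x + s) \<partial>law_x n) - (\<integral>x. cos (dot (p n) u x + s) \<partial>mv_normal (p n) (\<mu> n) (\<Sigma> n))\<bar> \<le> \<delta>) sequentially"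
proof -
  have ev: "eventually (\<lambda>n. \<forall>\<theta>\<in>S n. \<bar>(\<integral>g. \<phi> (dot (p n) \<theta> g) \<partial>mv_normal (p n) (\<mu> n) (\<Sigma> n)) - (\<integral>x. \<phi> (dot (p n) \<theta> x) \<partial>law_x n)\<bar> \<le> \<delta> / 2) sequentially"
    if "bounded (range \<phi>)" "\<exists>L. L-lipschitz_on UNIV \<phi>" for \<phi> :: "real \<Rightarrow> real"
  proof -
    have "(\<lambda>n. SUP \<theta>\<in>S n. ennreal \<bar>(\<integral>g. \<phi> (dot (p n) \<theta> g) \<partial>mv_normal (p n) (\<mu> n) (\<Sigma> n))
                              - (\<integral>x. \<phi> (dot (p n) \<theta> x) \<partial>law_x n)\<bar>) \<longlonglongrightarrow> 0"
      using dog that unfolding domain_of_gaussianity_def by blast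
    moreover have "(0::ennreal) < ennreal (\<delta> / 2)" using \<delta> by simp
    ultimately have "eventually (\<lambda>n. (SUP \<theta>\<in>S n. ennreal \<bar>(\<integral>g. \<phi> (dot (p n) \<theta> g) \<partial>mv_normal (p n) (\<mu> n) (\<Sigma> n))
                              - (\<integral>x. \<phi> (dot (p n) \<theta> x) \<partial>law_x n)\<bar>) < ennreal (\<delta> / 2)) sequentially"
      by (rule order_tendstoD(2))
    then show ?thesis
    proof (rule eventually_mono, intro ballI)
      fix n \<theta>
      assume lt: "(SUP \<theta>\<in>S n. ennreal \<bar>(\<integral>g. \<phi> (dot (p n) \<theta> g) \<partial>mv_normal (p n) (\<mu> n) (\<Sigma> n))
                              - (\<integral>x. \<phi> (dot (p n) \<theta> x) \<partial>law_x n)\<bar>) < ennreal (\<delta> / 2)" and \<theta>: "\<theta> \<in> S n"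
      have "ennreal \<bar>(\<integral>g. \<phi> (dot (p n) \<theta> g) \<partial>mv_normal (p n) (\<mu> n) (\<Sigma> n)) - (\<integral>x. \<phi> (dot (p n) \<theta> x) \<partial>law_x n)\<bar> < ennreal (\<delta> / 2)"
        by (rule le_less_trans[OF SUP_upper[OF \<theta>] lt])
      then show "\<bar>(\<integral>g. \<phi> (dot (p n) \<theta> g) \<partial>mv_normal (p n) (\<mu> n) (\<Sigma> n)) - (\<integral>x. \<phi> (dot (p n) \<theta> x) \<partial>law_x n)\<bar> \<le> \<delta> / 2"
        by (simp add: ennreal_less_iff)
    qed
  qed
  have bc: "bounded (range (\<lambda>y. cos (\<tau> * y)))" "bounded (range (\<lambda>y. sin (\<tau> * y)))"
    by (rule boundedI[of _ 1]; auto)+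
  have Lc: "\<exists>L. L-lipschitz_on UNIV (\<lambda>y. cos (\<tau> * y))" "\<exists>L. L-lipschitz_on UNIV (\<lambda>y. sin (\<tau> * y))"
    using cos_sin_lipschitz[OF \<tau>] by blast+
  from ev[OF bc(1) Lc(1)] ev[OF bc(2) Lc(2)] eventually_ge_at_top[of 1] show ?thesis
  proof eventually_elim
    case (elim n)
    show ?case
    proof (intro allI impI)
      fix u :: "nat \<Rightarrow> real" and s :: real assume "freq (p n) (S n) \<tau> u"
      then obtain \<theta> where \<theta>: "\<theta> \<in> S n" "\<forall>i<p n. u i = \<tau> * \<theta> i" by (auto simp: freq_def)
      have du: "dot (p n) u x = \<tau> * dot (p n) \<theta> x" for x
        using \<theta>(2) by (simp add: dot_def sum_distrib_left mult.assoc)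
      have split: "(\<integral>x. cos (dot (p n) u x + s) \<partial>N) = cos s * (\<integral>x. cos (\<tau> * dot (p n) \<theta> x) \<partial>N) - sin s * (\<integral>x. sin (\<tau> * dot (p n) \<theta> x) \<partial>N)"
        if N: "prob_space N" "sets N = sets (borel_vec (p n))" for N
      proof -
        interpret N: prob_space N by fact
        note [measurable_cong] = N(2)
        have "integrable N (\<lambda>x. cos (\<tau> * dot (p n) \<theta> x))" "integrable N (\<lambda>x. sin (\<tau> * dot (p n) \<theta> x))"
          by (rule N.integrable_const_bound[of _ 1]; simp)+
        then show ?thesis unfolding du cos_add by (simp add: mult.commute)
      qed
      define a1 where "a1 = (\<integral>x. cos (\<tau> * dot (p n) \<theta> x) \<partial>law_x n) - (\<integral>x. cos (\<tau> * dot (p n) \<theta> x) \<partial>mv_normal (p n) (\<mu> n) (\<Sigma> n))"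
      define a2 where "a2 = (\<integral>x. sin (\<tau> * dot (p n) \<theta> x) \<partial>law_x n) - (\<integral>x. sin (\<tau> * dot (p n) \<theta> x) \<partial>mv_normal (p n) (\<mu> n) (\<Sigma> n))"
      have a: "\<bar>a1\<bar> \<le> \<delta> / 2" "\<bar>a2\<bar> \<le> \<delta> / 2"
        using elim(1,2) \<theta>(1) unfolding a1_def a2_def by (auto simp: abs_minus_commute)
      have lw: "prob_space (law_x n)" "sets (law_x n) = sets (borel_vec (p n))" using law[OF elim(3)] by auto
      have "(\<integral>x. cos (dot (p n) u x + s) \<partial>law_x n) - (\<integral>x. cos (dot (p n) u x + s) \<partial>mv_normal (p n) (\<mu> n) (\<Sigma> n)) = cos s * a1 - sin s * a2"
        unfolding split[OF lw] split[OF prob_space_mv_normal sets_mv_normal] a1_def a2_def by (simp add: algebra_simps)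
      also have "\<bar>\<dots>\<bar> \<le> \<bar>cos s * a1\<bar> + \<bar>sin s * a2\<bar>" by (rule abs_triangle_ineq4)
      also have "\<dots> = \<bar>cos s\<bar> * \<bar>a1\<bar> + \<bar>sin s\<bar> * \<bar>a2\<bar>" by (simp add: abs_mult)
      also have "\<dots> \<le> 1 * (\<delta> / 2) + 1 * (\<delta> / 2)" by (intro add_mono mult_mono a) auto
      finally show "\<bar>(\<integral>x. cos (dot (p n) u x + s) \<partial>law_x n) - (\<integral>x. cos (dot (p n) u x + s) \<partial>mv_normal (p n) (\<mu> n) (\<Sigma> n))\<bar> \<le> \<delta>"
        by simp
    qed
  qed
qed

text \<open>The right-hand side is the expectation of one bounded Lipschitz function of Z, so
  convergence in probability comes under the comparison of such expectations.\<close>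

lemma converges_in_prob_iff_expectation:
  assumes M: "\<And>n. n \<ge> 1 \<Longrightarrow> prob_space (M n)" and Z: "\<And>n. n \<ge> 1 \<Longrightarrow> Z n \<in> borel_measurable (M n)"
  shows "converges_in_prob M Z \<rho> \<longleftrightarrow> (\<lambda>n. \<integral>\<omega>. min 1 \<bar>Z n \<omega> - \<rho>\<bar> \<partial>M n) \<longlonglongrightarrow> 0"
proof -
  have int: "integrable (M n) (\<lambda>\<omega>. min 1 \<bar>Z n \<omega> - \<rho>\<bar>)" if "n \<ge> 1" for n
  proof -
    interpret prob_space "M n" by (rule M[OF that])
    show ?thesis using Z[OF that] by (intro integrable_const_bound[of _ 1]) auto
  qed
  have nn: "0 \<le> (\<integral>\<omega>. min 1 \<bar>Z n \<omega> - \<rho>\<bar> \<partial>M n)" for n by (rule Bochner_Integration.integral_nonneg) auto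
  have set: "{\<omega> \<in> space (M n). \<delta> < \<bar>Z n \<omega> - \<rho>\<bar>} \<in> sets (M n)" if "n \<ge> 1" for n \<delta>
    using Z[OF that] by measurable
  have up: "(\<integral>\<omega>. min 1 \<bar>Z n \<omega> - \<rho>\<bar> \<partial>M n) \<le> \<delta> + measure (M n) {\<omega> \<in> space (M n). \<delta> < \<bar>Z n \<omega> - \<rho>\<bar>}"
    if n: "n \<ge> 1" and \<delta>: "0 < \<delta>" for n \<delta>
  proof -
    interpret prob_space "M n" by (rule M[OF n])
    let ?A = "{\<omega> \<in> space (M n). \<delta> < \<bar>Z n \<omega> - \<rho>\<bar>}"
    have "(\<integral>\<omega>. min 1 \<bar>Z n \<omega> - \<rho>\<bar> \<partial>M n) \<le> (\<integral>\<omega>. \<delta> + indicator ?A \<omega> \<partial>M n)"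
    proof (rule integral_mono[OF int[OF n]])
      show "integrable (M n) (\<lambda>\<omega>. \<delta> + indicator ?A \<omega>)"
        by (intro Bochner_Integration.integrable_add integrable_const integrable_real_indicator set[OF n])
          (simp add: emeasure_eq_measure)
      fix \<omega> assume "\<omega> \<in> space (M n)"
      then show "min 1 \<bar>Z n \<omega> - \<rho>\<bar> \<le> \<delta> + indicator ?A \<omega>" using \<delta> by (cases "\<delta> < \<bar>Z n \<omega> - \<rho>\<bar>") auto
    qed
    also have "\<dots> = \<delta> + prob ?A" using set[OF n] by (simp add: prob_space emeasure_eq_measure)
    finally show ?thesis .
  qed
  have lo: "min 1 \<delta> * measure (M n) {\<omega> \<in> space (M n). \<delta> < \<bar>Z n \<omega> - \<rho>\<bar>} \<le> (\<integral>\<omega>. min 1 \<bar>Z n \<omega> - \<rho>\<bar> \<partial>M n)"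
    if n: "n \<ge> 1" and \<delta>: "0 < \<delta>" for n \<delta>
  proof -
    interpret prob_space "M n" by (rule M[OF n])
    let ?A = "{\<omega> \<in> space (M n). \<delta> < \<bar>Z n \<omega> - \<rho>\<bar>}"
    have "min 1 \<delta> * prob ?A = (\<integral>\<omega>. min 1 \<delta> * indicator ?A \<omega> \<partial>M n)" using set[OF n] by simp
    also have "\<dots> \<le> (\<integral>\<omega>. min 1 \<bar>Z n \<omega> - \<rho>\<bar> \<partial>M n)"
    proof (rule integral_mono[OF _ int[OF n]])
      show "integrable (M n) (\<lambda>\<omega>. min 1 \<delta> * indicator ?A \<omega>)"
        by (intro integrable_mult_right integrable_real_indicator set[OF n]) (simp add: emeasure_eq_measure)
      fix \<omega> assume "\<omega> \<in> space (M n)"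
      then show "min 1 \<delta> * indicator ?A \<omega> \<le> min 1 \<bar>Z n \<omega> - \<rho>\<bar>" using \<delta> by (cases "\<delta> < \<bar>Z n \<omega> - \<rho>\<bar>") auto
    qed
    finally show ?thesis .
  qed
  show ?thesis
  proof
    assume cp: "converges_in_prob M Z \<rho>"
    show "(\<lambda>n. \<integral>\<omega>. min 1 \<bar>Z n \<omega> - \<rho>\<bar> \<partial>M n) \<longlonglongrightarrow> 0"
    proof (rule tendstoI)
      fix \<epsilon> :: real assume \<epsilon>: "0 < \<epsilon>"
      then have e2: "0 < \<epsilon> / 2" by simp
      from order_tendstoD(2)[OF cp[unfolded converges_in_prob_def, rule_format, OF e2] e2]
      show "eventually (\<lambda>n. dist (\<integral>\<omega>. min 1 \<bar>Z n \<omega> - \<rho>\<bar> \<partial>M n) 0 < \<epsilon>) sequentially"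
        using eventually_ge_at_top[of 1]
      proof eventually_elim
        case (elim n)
        then show ?case using up[of n "\<epsilon> / 2"] nn[of n] \<epsilon> by (simp add: dist_real_def)
      qed
    qed
  next
    assume lim: "(\<lambda>n. \<integral>\<omega>. min 1 \<bar>Z n \<omega> - \<rho>\<bar> \<partial>M n) \<longlonglongrightarrow> 0"
    show "converges_in_prob M Z \<rho>" unfolding converges_in_prob_def
    proof (intro allI impI)
      fix \<delta> :: real assume \<delta>: "0 < \<delta>"
      show "(\<lambda>n. measure (M n) {\<omega> \<in> space (M n). \<delta> < \<bar>Z n \<omega> - \<rho>\<bar>}) \<longlonglongrightarrow> 0"
      proof (rule Lim_null_comparison)
        show "(\<lambda>n. (\<integral>\<omega>. min 1 \<bar>Z n \<omega> - \<rho>\<bar> \<partial>M n) / min 1 \<delta>) \<longlonglongrightarrow> 0"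
          using tendsto_divide[OF lim tendsto_const[of "min 1 \<delta>"]] \<delta> by simp
        show "eventually (\<lambda>n. norm (measure (M n) {\<omega> \<in> space (M n). \<delta> < \<bar>Z n \<omega> - \<rho>\<bar>}) \<le> (\<integral>\<omega>. min 1 \<bar>Z n \<omega> - \<rho>\<bar> \<partial>M n) / min 1 \<delta>) sequentially"
          using eventually_ge_at_top[of 1]
        proof eventually_elim
          case (elim n)
          have "0 < min 1 \<delta>" using \<delta> by simp
          then show ?case using lo[OF elim \<delta>] by (simp only: pos_le_divide_eq real_norm_def abs_of_nonneg[OF measure_nonneg] mult.commute)
        qed
      qed
    qed
  qed
qed

section \<open>Choice of constants and conclusion\<close>

lemma ex_divide_le: "0 \<le> a \<Longrightarrow> 0 < \<delta> \<Longrightarrow> \<exists>x>0. a / x \<le> (\<delta>::real)"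
  by (intro exI[of _ "a / \<delta> + 1"]) (auto simp: divide_le_eq field_simps add_pos_nonneg add_nonneg_pos)

lemma ex_mult_le: "0 \<le> a \<Longrightarrow> 0 < \<delta> \<Longrightarrow> \<exists>x>0. x * a \<le> (\<delta>::real)"
  by (intro exI[of _ "\<delta> / (a + 1)"]) (auto simp: divide_le_eq field_simps)

theorem theorem1:
  fixes p :: "nat \<Rightarrow> nat"
    and M :: "nat \<Rightarrow> 'a measure"
    and X G :: "nat \<Rightarrow> nat \<Rightarrow> 'a \<Rightarrow> nat \<Rightarrow> real"
    and eps :: "nat \<Rightarrow> nat \<Rightarrow> 'a \<Rightarrow> real"
    and law_x :: "nat \<Rightarrow> (nat \<Rightarrow> real) measure"
    and \<mu> :: "nat \<Rightarrow> nat \<Rightarrow> real"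
    and \<Sigma> :: "nat \<Rightarrow> nat \<Rightarrow> nat \<Rightarrow> real"
    and C :: "nat \<Rightarrow> 'k::finite \<Rightarrow> (nat \<Rightarrow> real) set"
    and S :: "nat \<Rightarrow> (nat \<Rightarrow> real) set"
    and l :: "real ^ 'k \<Rightarrow> real \<Rightarrow> real"
    and r :: "nat \<Rightarrow> ('k \<Rightarrow> nat \<Rightarrow> real) \<Rightarrow> real"
    and C0 R K K_eps :: real
  assumes regime: "0 < C0" "\<And>n. n \<ge> 1 \<Longrightarrow> 1 / C0 \<le> real (p n) / real n \<and> real (p n) / real n \<le> C0"
    and constraint_sets:
      "\<And>n j. n \<ge> 1 \<Longrightarrow> C n j \<subseteq> Rvec (p n) \<and> C n j \<noteq> {} \<and> compact (C n j)"
      "\<And>n j \<theta>. n \<ge> 1 \<Longrightarrow> \<theta> \<in> C n j \<Longrightarrow> L2_set \<theta> {..<p n} \<le> R"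
    and penalty:
      "\<And>n \<Theta>. n \<ge> 1 \<Longrightarrow> (\<forall>j. \<Theta> j \<in> Rvec (p n)) \<Longrightarrow> 0 \<le> r n \<Theta>"
      "\<And>n. n \<ge> 1 \<Longrightarrow> continuous_on {\<Theta>. \<forall>j. \<Theta> j \<in> Rvec (p n)} (r n)"
      "\<forall>B>0. \<exists>Kr>0. \<forall>n\<ge>1. \<forall>\<Theta> \<Theta>'.
         (\<forall>j. \<Theta> j \<in> Rvec (p n) \<and> \<Theta>' j \<in> Rvec (p n)) \<longrightarrow>
         frob_norm (p n) \<Theta> \<le> B \<longrightarrow> frob_norm (p n) \<Theta>' \<le> B \<longrightarrow>
         \<bar>r n \<Theta> - r n \<Theta>'\<bar> \<le> Kr * frob_norm (p n) (\<lambda>j i. \<Theta> j i - \<Theta>' j i)"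
    and loss:
      "\<And>v e. 0 \<le> l v e"
      "continuous_on UNIV (\<lambda>(v, e). l v e)"
      "lipschitz_loss l \<or> poly_growth_loss l"
    and law_of_x: "\<And>n. n \<ge> 1 \<Longrightarrow> prob_space (law_x n) \<and> sets (law_x n) = sets (borel_vec (p n))"
    and covariance: "\<And>n. n \<ge> 1 \<Longrightarrow> psd (p n) (\<Sigma> n)"
    and restricted_subgaussianity:
      "\<And>n j \<theta>. n \<ge> 1 \<Longrightarrow> \<theta> \<in> star_hull (p n) (C n j) \<Longrightarrow> L2_set \<theta> {..<p n} \<le> 1 \<Longrightarrow>
         psi2_norm (law_x n) (\<lambda>x. dot (p n) x \<theta>) \<le> ennreal K"
      "\<And>n j \<theta>. n \<ge> 1 \<Longrightarrow> \<theta> \<in> star_hull (p n) (C n j) \<Longrightarrow> L2_set \<theta> {..<p n} \<le> 1 \<Longrightarrow>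
         L2_set (mat_vec (p n) (psd_sqrt (p n) (\<Sigma> n)) \<theta>) {..<p n} \<le> K"
      "\<And>n. n \<ge> 1 \<Longrightarrow> L2_set (\<mu> n) {..<p n} \<le> K"
    and gaussianity: "domain_of_gaussianity p S law_x \<mu> \<Sigma>"
    and prob_spaces: "\<And>n. n \<ge> 1 \<Longrightarrow> prob_space (M n)"
    and X_iid:
      "\<And>n. n \<ge> 1 \<Longrightarrow> prob_space.indep_vars (M n) (\<lambda>_. borel_vec (p n)) (X n) {..<n}"
      "\<And>n i. n \<ge> 1 \<Longrightarrow> i < n \<Longrightarrow> distr (M n) (borel_vec (p n)) (X n i) = law_x n"
    and G_iid:
      "\<And>n. n \<ge> 1 \<Longrightarrow> prob_space.indep_vars (M n) (\<lambda>_. borel_vec (p n)) (G n) {..<n}"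
      "\<And>n i. n \<ge> 1 \<Longrightarrow> i < n \<Longrightarrow>
         distr (M n) (borel_vec (p n)) (G n i) = mv_normal (p n) (\<mu> n) (\<Sigma> n)"
    and eps_iid:
      "\<And>n. n \<ge> 1 \<Longrightarrow> prob_space.indep_vars (M n) (\<lambda>_. borel) (eps n) {..<n}"
      "\<And>n i i'. n \<ge> 1 \<Longrightarrow> i < n \<Longrightarrow> i' < n \<Longrightarrow>
         distr (M n) borel (eps n i) = distr (M n) borel (eps n i')"
    and eps_subgaussian:
      "\<And>n i. n \<ge> 1 \<Longrightarrow> i < n \<Longrightarrow> psi2_norm (M n) (eps n i) \<le> ennreal K_eps"
    and eps_indep:
      "\<And>n. n \<ge> 1 \<Longrightarrow> indep_rv (M n)
         (Pi\<^sub>M {..<n} (\<lambda>_. borel)) (\<lambda>\<omega>. \<lambda>i\<in>{..<n}. eps n i \<omega>)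
         (Pi\<^sub>M {..<n} (\<lambda>_. borel_vec (p n))) (\<lambda>\<omega>. \<lambda>i\<in>{..<n}. X n i \<omega>)"
      "\<And>n. n \<ge> 1 \<Longrightarrow> indep_rv (M n)
         (Pi\<^sub>M {..<n} (\<lambda>_. borel)) (\<lambda>\<omega>. \<lambda>i\<in>{..<n}. eps n i \<omega>)
         (Pi\<^sub>M {..<n} (\<lambda>_. borel_vec (p n))) (\<lambda>\<omega>. \<lambda>i\<in>{..<n}. G n i \<omega>)"
    and contained: "\<And>n j. n \<ge> 1 \<Longrightarrow> C n j \<subseteq> S n"
  shows "(\<forall>\<psi> :: real \<Rightarrow> real. bounded (range \<psi>) \<longrightarrow> (\<exists>L. L-lipschitz_on UNIV \<psi>) \<longrightarrow>
            (\<lambda>n. \<bar>(\<integral>\<omega>. \<psi> (opt_risk p l r C eps X n \<omega>) \<partial>M n)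
               - (\<integral>\<omega>. \<psi> (opt_risk p l r C eps G n \<omega>) \<partial>M n)\<bar>) \<longlonglongrightarrow> 0) \<and>
         (\<forall>\<rho>. converges_in_prob M (opt_risk p l r C eps X) \<rho> \<longleftrightarrow>
               converges_in_prob M (opt_risk p l r C eps G) \<rho>)"
proof -
  define Q where "Q n = mv_normal (p n) (\<mu> n) (\<Sigma> n)" for n
  define k where "k = real CARD('k)"
  have k: "0 < k" by (simp add: k_def)
  \<comment> \<open>At least 1, so that dividing a constraint vector by R1 keeps it in
    \<open>star_hull\<close> and brings it into the unit ball.\<close>
  define R1 where "R1 = max 1 R"
  have R1: "1 \<le> R1" "R \<le> R1" "0 < R1" by (auto simp: R1_def)
  \<comment> \<open>A common scale for rows and noise, strictly above K R1 and K_eps as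
    \<open>psi2_norm_exp_moment\<close> requires.\<close>
  define t where "t = (\<bar>K\<bar> + \<bar>K_eps\<bar> + 1) * R1"
  have t: "0 < t" using R1 unfolding t_def by (intro mult_pos_pos) auto
  have tR: "K < t / R1" "0 < t / R1" using R1 by (auto simp: t_def)
  have tK: "K_eps < t"
  proof -
    have "K_eps < (\<bar>K\<bar> + \<bar>K_eps\<bar> + 1) * 1" by simp
    also have "\<dots> \<le> t" unfolding t_def using R1 by (intro mult_left_mono) auto
    finally show ?thesis .
  qed
  define c0 :: real where "c0 = 2 * exp 1"
  have c0: "1 < c0" using exp_ge_add_one_self[of "1::real"] by (simp add: c0_def)
  \<comment> \<open>The first entry bounds the moment of x; the second is the bound of
    \<open>mv_normal_exp_moment\<close> with c0 in place of c, where R1 \<bar>K\<bar> bounds the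
    mean of the Gaussian linear form.\<close>
  define c where "c = max c0 (2 * exp (R1 * \<bar>K\<bar> / t + 16 * ln 2 * c0\<^sup>2))"
  have c: "1 < c" "c0 \<le> c" using c0 by (auto simp: c_def)
  have law: "prob_space (law_x n)" "sets (law_x n) = sets (borel_vec (p n))" if "n \<ge> 1" for n using law_of_x[OF that] by auto
  have Ql: "prob_space (Q n)" "sets (Q n) = sets (borel_vec (p n))" for n
    unfolding Q_def by (rule prob_space_mv_normal) (rule sets_mv_normal)
  have CL2: "L2_set \<theta> {..<p n} \<le> R1" if "n \<ge> 1" "\<theta> \<in> C n j" for n j \<theta>
    using constraint_sets(2)[OF that] R1 by linarith

  have xmom: "(\<integral>\<^sup>+x. ennreal (exp (\<bar>dot (p n) \<theta> x\<bar> / t)) \<partial>law_x n) \<le> ennreal c0" if n: "n \<ge> 1" and \<theta>: "\<theta> \<in> C n j" for n j \<theta>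
  proof -
    note [measurable_cong] = law(2)[OF n]
    define \<theta>' where "\<theta>' = (\<lambda>i\<in>{..<p n}. 1 / R1 * \<theta> i)"
    have "\<theta>' \<in> star_hull (p n) (C n j)" unfolding star_hull_def \<theta>'_def using \<theta> R1
      by (intro CollectI exI[of _ "1 / R1"] exI[of _ \<theta>]) auto
    moreover have "L2_set \<theta>' {..<p n} \<le> 1"
    proof -
      have "L2_set \<theta>' {..<p n} = 1 / R1 * L2_set \<theta> {..<p n}"
        unfolding \<theta>'_def L2_set_restrict using R1 by (subst L2_set_right_distrib) auto
      also have "\<dots> \<le> 1 / R1 * R1" using CL2[OF n \<theta>] R1 by (intro mult_left_mono) auto
      finally show ?thesis using R1 by simp
    qed
    ultimately have "psi2_norm (law_x n) (\<lambda>x. dot (p n) x \<theta>') \<le> ennreal K" by (rule restricted_subgaussianity(1)[OF n])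
    moreover have dd: "dot (p n) x \<theta>' = dot (p n) \<theta> x / R1" for x
      unfolding \<theta>'_def by (simp add: dot_def sum_divide_distrib mult.commute)
    ultimately have "psi2_norm (law_x n) (\<lambda>x. dot (p n) \<theta> x / R1) \<le> ennreal K" by simp
    then have "(\<integral>\<^sup>+x. ennreal (exp (\<bar>dot (p n) \<theta> x / R1\<bar> / (t / R1))) \<partial>law_x n) \<le> ennreal (2 * exp 1)"
      by (rule psi2_norm_exp_moment[OF _ tR]) measurable
    then show ?thesis using R1 by (simp add: c0_def)
  qed

  \<comment> \<open>The frequency and the tolerance 1 / 4 are those of
    \<open>mv_normal_exp_moment\<close>. The tolerance is reached for large n only, so the
    constraint sets lie in the body eventually.\<close>
  have "0 \<le> 1 / (4 * t * c0)" using t c0 by simp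
  from domain_of_gaussianity_trig[OF gaussianity law_of_x this, of "1/4"]
  have "eventually (\<lambda>n. \<forall>u s. freq (p n) (S n) (1 / (4 * t * c0)) u \<longrightarrow>
    \<bar>(\<integral>x. cos (dot (p n) u x + s) \<partial>law_x n) - (\<integral>x. cos (dot (p n) u x + s) \<partial>Q n)\<bar> \<le> 1 / 4) sequentially"
    unfolding Q_def by simp
  then have body: "eventually (\<lambda>n. \<forall>j. C n j \<subseteq> exp_body (p n) t c R1 (law_x n) (Q n)) sequentially"
    using eventually_ge_at_top[of 1]
  proof eventually_elim
    case (elim n)
    show ?case
    proof (intro allI subsetI)
      fix j \<theta> assume \<theta>: "\<theta> \<in> C n j"
      have sc: "symmetric_convex (p n) (S n)" using gaussianity elim(2) unfolding domain_of_gaussianity_def by blast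
      have "\<theta> \<in> S n" using contained[OF elim(2)] \<theta> by blast
      then have "freq (p n) (S n) (\<bar>1 / (4 * t * c0)\<bar> * 1) (\<lambda>i. 1 / (4 * t * c0) * \<theta> i)" by (intro freq_scale sc freq_memI)
      then have fr: "freq (p n) (S n) (1 / (4 * t * c0)) (\<lambda>i. 1 / (4 * t * c0) * \<theta> i)" using t c0 by simp
      have dd: "dot (p n) (\<lambda>i. a * \<theta> i) x + 0 = a * dot (p n) \<theta> x" for a x by (simp add: dot_def sum_distrib_left mult.assoc)
      have close: "\<bar>(\<integral>x. cos (1 / (4 * t * c0) * dot (p n) \<theta> x) \<partial>law_x n) - (\<integral>x. cos (1 / (4 * t * c0) * dot (p n) \<theta> x) \<partial>Q n)\<bar> \<le> 1 / 4"
        using elim(1)[rule_format, OF fr, of 0] unfolding dd .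
      have m: "\<bar>dot (p n) \<theta> (\<mu> n)\<bar> \<le> R1 * \<bar>K\<bar>"
      proof -
        have "\<bar>dot (p n) \<theta> (\<mu> n)\<bar> \<le> (\<Sum>i<p n. \<bar>\<theta> i\<bar> * \<bar>\<mu> n i\<bar>)"
          unfolding dot_def by (rule order_trans[OF sum_abs]) (simp add: abs_mult)
        also have "\<dots> \<le> L2_set \<theta> {..<p n} * L2_set (\<mu> n) {..<p n}" by (rule L2_set_mult_ineq)
        also have "\<dots> \<le> R1 * \<bar>K\<bar>"
          using CL2[OF elim(2) \<theta>] restricted_subgaussianity(3)[OF elim(2)] R1
          by (intro mult_mono) (auto intro: order_trans[OF _ abs_ge_self] L2_set_nonneg)
        finally show ?thesis .
      qed
      have qm: "(\<integral>\<^sup>+x. ennreal (exp (\<bar>dot (p n) \<theta> x\<bar> / t)) \<partial>Q n) \<le> ennreal (2 * exp (R1 * \<bar>K\<bar> / t + 16 * ln 2 * c0\<^sup>2))"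
        using close c0 m unfolding Q_def
        by (intro mv_normal_exp_moment[OF law[OF elim(2)] t _ xmom[OF elim(2) \<theta>]]) auto
      have "\<theta> \<in> Rvec (p n)" using constraint_sets(1)[OF elim(2)] \<theta> by blast
      moreover have "(\<integral>\<^sup>+x. ennreal (exp (\<bar>dot (p n) \<theta> x\<bar> / t)) \<partial>law_x n) \<le> ennreal c"
        by (rule order_trans[OF xmom[OF elim(2) \<theta>]]) (simp add: c ennreal_leI)
      moreover have "(\<integral>\<^sup>+x. ennreal (exp (\<bar>dot (p n) \<theta> x\<bar> / t)) \<partial>Q n) \<le> ennreal c"
        by (rule order_trans[OF qm]) (simp add: c_def ennreal_leI)
      ultimately show "\<theta> \<in> exp_body (p n) t c R1 (law_x n) (Q n)"
        using CL2[OF elim(2) \<theta>] by (simp add: exp_body_def)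
    qed
  qed

  obtain A where A: "0 \<le> A" "\<And>v e. (l v e)\<^sup>2 \<le> A * ((\<Sum>j\<in>UNIV. exp (\<bar>v $ j\<bar> / t)) + exp (\<bar>e\<bar> / t))"
    using loss_square_bound[OF loss(3,1) t] by metis
  \<comment> \<open>k columns of norm at most R1 have Frobenius norm at most k R1, so this Lipschitz
    constant is valid on the constraint sets for every n.\<close>
  define Kprop where "Kprop Kr \<longleftrightarrow> (\<forall>n\<ge>1. \<forall>\<Theta> \<Theta>'.
         (\<forall>j. \<Theta> j \<in> Rvec (p n) \<and> \<Theta>' j \<in> Rvec (p n)) \<longrightarrow>
         frob_norm (p n) \<Theta> \<le> k * R1 \<longrightarrow> frob_norm (p n) \<Theta>' \<le> k * R1 \<longrightarrow>
         \<bar>r n \<Theta> - r n \<Theta>'\<bar> \<le> Kr * frob_norm (p n) (\<lambda>j i. \<Theta> j i - \<Theta>' j i))" for Kr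
  have "0 < k * R1" using k R1 by simp
  from mp[OF spec[OF penalty(3)] this] obtain Kr where Kr0: "0 < Kr" "Kprop Kr"
    unfolding Kprop_def[symmetric] by blast
  have Kr: "0 < Kr" "\<And>n \<Theta> \<Theta>'. n \<ge> 1 \<Longrightarrow> (\<forall>j. \<Theta> j \<in> Rvec (p n) \<and> \<Theta>' j \<in> Rvec (p n)) \<Longrightarrow>
         frob_norm (p n) \<Theta> \<le> k * R1 \<Longrightarrow> frob_norm (p n) \<Theta>' \<le> k * R1 \<Longrightarrow>
         \<bar>r n \<Theta> - r n \<Theta>'\<bar> \<le> Kr * frob_norm (p n) (\<lambda>j i. \<Theta> j i - \<Theta>' j i)"
    using Kr0(2) unfolding Kprop_def by (simp_all add: Kr0(1))
  have frobC: "frob_norm (p n) \<Theta> \<le> k * R1" if "n \<ge> 1" "\<And>j. \<Theta> j \<in> C n j" for n and \<Theta> :: "'k \<Rightarrow> nat \<Rightarrow> real"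
  proof -
    have "(\<Sum>j\<in>UNIV. L2_set (\<Theta> j) {..<p n}) \<le> (\<Sum>j\<in>(UNIV::'k set). R1)"
      by (intro sum_mono) (rule CL2[OF that(1) that(2)])
    then show ?thesis using frob_norm_le_sum[of "p n" \<Theta>] by (simp add: k_def)
  qed
  have Rv: "C n j \<subseteq> Rvec (p n)" if "n \<ge> 1" for n j using constraint_sets(1)[OF that] by blast
  have pn: "real (p n) \<le> C0 * real n" if "n \<ge> 1" for n
    using regime(2)[OF that] that by (simp add: divide_le_eq)

  define exhausts where "exhausts n E \<longleftrightarrow> (\<forall>i j. finite (E i j)) \<and> (\<forall>i j. E i j \<noteq> {}) \<and> (\<forall>i j. E i j \<subseteq> C n j) \<and>
     (\<forall>e X. (\<lambda>i. Min (emp_risk n (p n) l (r n) e X ` {\<Theta>. \<forall>j. \<Theta> j \<in> E i j})) \<longlonglongrightarrow> min_risk n (p n) l (r n) (C n) e X)"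
    for n and E :: "nat \<Rightarrow> 'k \<Rightarrow> (nat \<Rightarrow> real) set"
  have "\<exists>E. exhausts n E" if n: "n \<ge> 1" for n
  proof -
    have cp: "compact (C n j)" "C n j \<noteq> {}" for j using constraint_sets(1)[OF n] by auto
    obtain E :: "nat \<Rightarrow> 'k \<Rightarrow> (nat \<Rightarrow> real) set" where
      E: "\<And>m j. finite (E m j)" "\<And>m j. E m j \<noteq> {}" "\<And>m j. E m j \<subseteq> C n j"
      "\<And>f :: ('k \<Rightarrow> nat \<Rightarrow> real) \<Rightarrow> real. continuous_on {\<Theta>. \<forall>j. \<Theta> j \<in> C n j} f \<Longrightarrow>
        (\<lambda>m. Min (f ` {\<Theta>. \<forall>j. \<Theta> j \<in> E m j})) \<longlonglongrightarrow> (LEAST v. v \<in> f ` {\<Theta>. \<forall>j. \<Theta> j \<in> C n j})"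
      by (rule finite_exhaustion[OF cp]) (rule that)
    have sub: "{\<Theta>. \<forall>j. \<Theta> j \<in> C n j} \<subseteq> {\<Theta>. \<forall>j. \<Theta> j \<in> Rvec (p n)}" using Rv[OF n] by blast
    have "continuous_on {\<Theta>. \<forall>j. \<Theta> j \<in> C n j} (emp_risk n (p n) l (r n) e X)" for e X
      by (rule continuous_on_emp_risk[OF loss(2) continuous_on_subset[OF penalty(2)[OF n] sub]])
    from E(4)[OF this] show ?thesis unfolding exhausts_def min_risk_def
      by (intro exI[of _ E] conjI allI E(1-3))
  qed
  then obtain D where Dex: "\<And>n. n \<ge> 1 \<Longrightarrow> exhausts n (D n)" by metis
  have D: "finite (D n i j)" "D n i j \<noteq> {}" "D n i j \<subseteq> C n j" if "n \<ge> 1" for n i j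
    using Dex[OF that] unfolding exhausts_def by simp_all
  have Dlim: "(\<lambda>i. Min (emp_risk n (p n) l (r n) e X ` {\<Theta>. \<forall>j. \<Theta> j \<in> D n i j})) \<longlonglongrightarrow> min_risk n (p n) l (r n) (C n) e X"
    if "n \<ge> 1" for n e X
    using Dex[OF that] unfolding exhausts_def by simp
  define D' where "D' n i = {\<Theta>. \<forall>j. \<Theta> j \<in> D n i j}" for n i
  have D'fin: "finite (D' n i)" if "n \<ge> 1" for n i unfolding D'_def
    by (rule card_Pi_UNIV_le(1)[of _ "\<Sum>j\<in>UNIV. real (card (D n i j))"]) (auto simp: D(1)[OF that] intro!: member_le_sum)
  have eps_m: "eps n i \<in> borel_measurable (M n)" if "n \<ge> 1" "i < n" for n i
    using eps_iid(1)[OF that(1)] that(2) unfolding prob_space.indep_vars_def[OF prob_spaces[OF that(1)]] by auto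

  \<comment> \<open>For fixed n, the measurability of the optimum and the expectation of \<psi> at
    it are both obtained as limits along the finite sets.\<close>
  have limM: "(\<lambda>i. \<integral>\<omega>. \<psi> (Min (emp_risk n (p n) l (r n) (\<lambda>i. eps n i \<omega>) (\<lambda>i. A n i \<omega>) ` D' n i)) \<partial>M n)
       \<longlonglongrightarrow> (\<integral>\<omega>. \<psi> (opt_risk p l r C eps A n \<omega>) \<partial>M n)"
      "opt_risk p l r C eps A n \<in> borel_measurable (M n)"
    if n: "n \<ge> 1" and Am: "\<And>i. i < n \<Longrightarrow> A n i \<in> measurable (M n) (borel_vec (p n))"
      and \<psi>: "continuous_on UNIV \<psi>" "\<And>x. \<bar>\<psi> x\<bar> \<le> (Gb::real)" for n A \<psi> Gb
  proof -
    interpret prob_space "M n" by (rule prob_spaces[OF n])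
    have m: "(\<lambda>\<omega>. Min (emp_risk n (p n) l (r n) (\<lambda>i. eps n i \<omega>) (\<lambda>i. A n i \<omega>) ` D' n i)) \<in> borel_measurable (M n)" for i
      by (intro borel_measurable_Min D'fin n measurable_emp_risk loss(2) Am eps_m)
    have lim: "(\<lambda>i. Min (emp_risk n (p n) l (r n) (\<lambda>i. eps n i \<omega>) (\<lambda>i. A n i \<omega>) ` D' n i)) \<longlonglongrightarrow> opt_risk p l r C eps A n \<omega>" for \<omega>
      unfolding D'_def opt_risk_def by (rule Dlim[OF n])
    show om: "opt_risk p l r C eps A n \<in> borel_measurable (M n)"
      by (rule borel_measurable_LIMSEQ_metric[OF m lim])
    have \<psi>m: "\<psi> \<in> borel_measurable borel" using \<psi>(1) by (rule borel_measurable_continuous_onI)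
    show "(\<lambda>i. \<integral>\<omega>. \<psi> (Min (emp_risk n (p n) l (r n) (\<lambda>i. eps n i \<omega>) (\<lambda>i. A n i \<omega>) ` D' n i)) \<partial>M n)
       \<longlonglongrightarrow> (\<integral>\<omega>. \<psi> (opt_risk p l r C eps A n \<omega>) \<partial>M n)"
    proof (rule integral_dominated_convergence[where w="\<lambda>_. Gb"])
      show "AE \<omega> in M n. (\<lambda>i. \<psi> (Min (emp_risk n (p n) l (r n) (\<lambda>i. eps n i \<omega>) (\<lambda>i. A n i \<omega>) ` D' n i))) \<longlonglongrightarrow> \<psi> (opt_risk p l r C eps A n \<omega>)"
        by (intro AE_I2 continuous_on_tendsto_compose[OF \<psi>(1) lim]) auto
    qed (auto intro: measurable_compose[OF m \<psi>m] measurable_compose[OF om \<psi>m] \<psi>(2))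
  qed
  have Xm: "X n i \<in> measurable (M n) (borel_vec (p n))" if "n \<ge> 1" "i < n" for n i
    using X_iid(1)[OF that(1)] that(2) unfolding prob_space.indep_vars_def[OF prob_spaces[OF that(1)]] by auto
  have Gm: "G n i \<in> measurable (M n) (borel_vec (p n))" if "n \<ge> 1" "i < n" for n i
    using G_iid(1)[OF that(1)] that(2) unfolding prob_space.indep_vars_def[OF prob_spaces[OF that(1)]] by auto

  have main: "(\<lambda>n. \<bar>(\<integral>\<omega>. \<psi> (opt_risk p l r C eps X n \<omega>) \<partial>M n)
               - (\<integral>\<omega>. \<psi> (opt_risk p l r C eps G n \<omega>) \<partial>M n)\<bar>) \<longlonglongrightarrow> 0"
    if bdd: "bounded (range \<psi>)" and lip: "\<exists>L. L-lipschitz_on UNIV \<psi>" for \<psi> :: "real \<Rightarrow> real"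
  proof (rule tendstoI)
    fix \<delta> :: real assume \<delta>: "0 < \<delta>"
    obtain L where L: "L-lipschitz_on UNIV \<psi>" using lip by blast
    have L0: "0 \<le> L" using L by (rule lipschitz_on_nonneg)
    obtain Gb where Gb0: "\<forall>x\<in>range \<psi>. norm x \<le> Gb" using bdd unfolding bounded_iff by blast
    have Gb: "\<bar>\<psi> x\<bar> \<le> Gb" for x using Gb0 by simp
    have \<psi>c: "continuous_on UNIV \<psi>" by (rule lipschitz_on_continuous_on[OF L])
    have \<psi>m: "\<psi> \<in> borel_measurable borel" using \<psi>c by (rule borel_measurable_continuous_onI)
    \<comment> \<open>Seven errors of at most \<delta> / 8 stay below \<delta>. The exchange error
      \<zeta> = \<delta> / 8 consists of \<delta> / 16 for approximation by cosines and \<delta> /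
      16 for their expectations.\<close>
    have \<delta>8: "0 < \<delta> / 8" "0 < \<delta> / 16" using \<delta> by auto
    have C0: "0 \<le> C0" using regime(1) by simp
    \<comment> \<open>B depends on no later choice: KB comes from B, \<epsilon> from KB, \<beta>
      from \<epsilon>, and b1 from B.\<close>
    obtain B where B: "0 < B" "2 * L * A * (k * c + c) / B \<le> \<delta> / 8"
      using ex_divide_le[OF _ \<delta>8(1), of "2 * L * A * (k * c + c)"] L0 A(1) k c by auto
    obtain KB where KB: "0 \<le> KB" "\<And>v v' e. \<bar>min (l v e) B - min (l v' e) B\<bar> \<le> KB * norm (v - v')"
      using truncated_loss_lipschitz[OF loss(3,1) B(1)] by metis
    define w where "w = KB * (2 * t * (C0 * ln 5 + ln c + 1)) + Kr * R1"
    have w: "0 \<le> w" unfolding w_def using KB t C0 c Kr R1 by (intro add_nonneg_nonneg mult_nonneg_nonneg) auto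
    obtain \<epsilon> where \<epsilon>: "0 < \<epsilon>" "\<epsilon> * (2 * L * k * w) \<le> \<delta> / 8"
      using ex_mult_le[OF _ \<delta>8(1), of "2 * L * k * w"] L0 k w by auto
    have ln0: "0 \<le> ln (1 + 2 / \<epsilon>)" using \<epsilon> by simp
    obtain \<beta>0 where \<beta>0: "0 < \<beta>0" "2 * L * k * C0 * ln (1 + 2 / \<epsilon>) / \<beta>0 \<le> \<delta> / 8"
      using ex_divide_le[OF _ \<delta>8(1), of "2 * L * k * C0 * ln (1 + 2 / \<epsilon>)"] L0 k C0 ln0 by auto
    \<comment> \<open>At least L + 1, so that the exchange error enters with a factor L / \<beta> of
      at most 1.\<close>
    define \<beta> where "\<beta> = max \<beta>0 (L + 1)"
    have \<beta>: "0 < \<beta>" "L / \<beta> \<le> 1" "2 * L * k * C0 * ln (1 + 2 / \<epsilon>) / \<beta> \<le> \<delta> / 8"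
    proof -
      show b0: "0 < \<beta>" using \<beta>0 by (simp add: \<beta>_def)
      have "L \<le> \<beta>" by (simp add: \<beta>_def)
      then show "L / \<beta> \<le> 1" using b0 by simp
      have "2 * L * k * C0 * ln (1 + 2 / \<epsilon>) / \<beta> \<le> 2 * L * k * C0 * ln (1 + 2 / \<epsilon>) / \<beta>0"
        using \<beta>0 b0 L0 k C0 ln0 by (intro divide_left_mono mult_nonneg_nonneg) (auto simp: \<beta>_def)
      then show "2 * L * k * C0 * ln (1 + 2 / \<epsilon>) / \<beta> \<le> \<delta> / 8" using \<beta>0(2) by linarith
    qed
    obtain h where h: "0 < h" "h * (2 * L) \<le> \<delta> / 8" using ex_mult_le[OF _ \<delta>8(1), of "2 * L"] L0 by auto
    obtain b1 where b1: "0 < b1" "2 * L * B * t * c / b1 \<le> \<delta> / 8"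
      using ex_divide_le[OF _ \<delta>8(1), of "2 * L * B * t * c"] L0 B(1) t c by auto
    define \<kappa> where "\<kappa> = exp (- \<beta> * B)"
    define H where "H z = exp (- \<beta> * min (l (fst z) (snd z)) B)" for z
    have Hc: "continuous_on UNIV H" unfolding H_def
      using continuous_on_min_loss[OF loss(2), of B]
      by (intro continuous_on_exp continuous_on_mult_left) (simp add: split_beta')
    have Hb: "\<kappa> \<le> H z" "H z \<le> 1" for z
      unfolding H_def \<kappa>_def using \<beta>(1) loss(1) B(1) by (auto simp: mult_left_mono)
    have \<kappa>: "0 < \<kappa>" by (simp add: \<kappa>_def)
    have tc: "0 \<le> t * c" using t c by simp
    \<comment> \<open>\<tau> and cc depend on \<beta>, B, b1 and \<delta> but not on n, so the
      domain of Gaussianity is invoked at this one scale \<tau>.\<close>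
    obtain \<tau> cc where T: "0 \<le> \<tau>" "0 \<le> cc" "\<And>p S P Q \<Delta> D w e.
      symmetric_convex p S \<Longrightarrow> prob_space P \<Longrightarrow> prob_space Q \<Longrightarrow>
      sets P = sets (borel_vec p) \<Longrightarrow> sets Q = sets (borel_vec p) \<Longrightarrow>
      \<forall>u s. freq p S \<tau> u \<longrightarrow> \<bar>(\<integral>x. cos (dot p u x + s) \<partial>P) - (\<integral>x. cos (dot p u x + s) \<partial>Q)\<bar> \<le> \<Delta> \<Longrightarrow>
      finite D \<Longrightarrow> \<forall>\<Theta>\<in>D. 0 \<le> w \<Theta> \<Longrightarrow> sum w D = 1 \<Longrightarrow>
      \<forall>\<Theta>\<in>D. \<forall>j. \<Theta> j \<in> S \<and> integrable P (dot p (\<Theta> j)) \<and> integrable Q (dot p (\<Theta> j)) \<and>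
         (\<integral>x. \<bar>dot p (\<Theta> j) x\<bar> \<partial>P) \<le> t * c \<and> (\<integral>x. \<bar>dot p (\<Theta> j) x\<bar> \<partial>Q) \<le> t * c \<Longrightarrow>
      \<bar>e\<bar> \<le> b1 \<Longrightarrow>
      \<bar>(\<integral>x. ln (\<Sum>\<Theta>\<in>D. w \<Theta> * H (tmat_vec p (\<Theta> :: 'k \<Rightarrow> nat \<Rightarrow> real) x, e)) \<partial>P) -
       (\<integral>x. ln (\<Sum>\<Theta>\<in>D. w \<Theta> * H (tmat_vec p \<Theta> x, e)) \<partial>Q)\<bar> \<le> \<delta> / 16 + cc * \<Delta>"
      by (rule log_gibbs_average_universality[OF Hc Hb \<kappa> \<delta>8(2) tc b1(1)]) (rule that)
    define \<Delta> where "\<Delta> = \<delta> / (16 * (cc + 1))"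
    have \<Delta>: "0 < \<Delta>" "cc * \<Delta> \<le> \<delta> / 16"
      unfolding \<Delta>_def using \<delta> T(2) by (auto simp: field_simps)
    have trig: "eventually (\<lambda>n. \<forall>u s. freq (p n) (S n) \<tau> u \<longrightarrow>
      \<bar>(\<integral>x. cos (dot (p n) u x + s) \<partial>law_x n) - (\<integral>x. cos (dot (p n) u x + s) \<partial>Q n)\<bar> \<le> \<Delta>) sequentially"
      unfolding Q_def by (rule domain_of_gaussianity_trig[OF gaussianity law_of_x T(1) \<Delta>(1)])
    have "(\<lambda>n. 4 * L / h * B\<^sup>2 / real n) \<longlonglongrightarrow> 0"
      by (rule tendsto_divide_0[OF tendsto_const]) (rule filterlim_compose[OF filterlim_at_top_imp_at_infinity filterlim_real_sequentially], rule filterlim_ident)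
    then have nlarge: "eventually (\<lambda>n. 4 * L / h * B\<^sup>2 / real n < \<delta> / 8) sequentially"
      by (rule order_tendstoD(2)) (rule \<delta>8(1))
    show "eventually (\<lambda>n. dist \<bar>(\<integral>\<omega>. \<psi> (opt_risk p l r C eps X n \<omega>) \<partial>M n)
               - (\<integral>\<omega>. \<psi> (opt_risk p l r C eps G n \<omega>) \<partial>M n)\<bar> 0 < \<delta>) sequentially"
      using body trig nlarge eventually_ge_at_top[of 1]
    proof eventually_elim
      case (elim n)
      note n = elim(4)
      interpret M: prob_space "M n" by (rule prob_spaces[OF n])
      interpret P: prob_space "law_x n" by (rule law(1)[OF n])
      interpret Q: prob_space "Q n" by (rule Ql(1))
      note [measurable_cong] = law(2)[OF n] Ql(2)[of n]
      have sc: "symmetric_convex (p n) (S n)" using gaussianity n unfolding domain_of_gaussianity_def by blast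
      define \<nu> where "\<nu> = distr (M n) (Pi\<^sub>M {..<n} (\<lambda>_. borel)) (\<lambda>\<omega>. \<lambda>i\<in>{..<n}. eps n i \<omega>)"
      have eps_vec: "(\<lambda>\<omega>. \<lambda>i\<in>{..<n}. eps n i \<omega>) \<in> measurable (M n) (Pi\<^sub>M {..<n} (\<lambda>_. borel))"
        by (intro measurable_restrict eps_m n) auto
      interpret \<nu>: prob_space \<nu> unfolding \<nu>_def by (rule M.prob_space_distr) (rule eps_vec)
      define m where "m e = (\<Sum>i<n. exp (\<bar>e i\<bar> / t)) / real n" for e :: "nat \<Rightarrow> real"
      have m0: "0 \<le> m e" for e unfolding m_def by (intro divide_nonneg_nonneg sum_nonneg) auto
      have mm: "m \<in> borel_measurable (Pi\<^sub>M {..<n} (\<lambda>_. borel))" unfolding m_def[abs_def] by measurable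
      have mi: "integrable \<nu> m" "(\<integral>e. m e \<partial>\<nu>) \<le> c"
      proof -
        have "(\<integral>\<^sup>+e. ennreal (m e) \<partial>\<nu>) = (\<integral>\<^sup>+\<omega>. ennreal (m (\<lambda>i\<in>{..<n}. eps n i \<omega>)) \<partial>M n)"
          unfolding \<nu>_def using mm by (intro nn_integral_distr eps_vec) measurable
        also have "\<dots> = (\<integral>\<^sup>+\<omega>. (\<Sum>i<n. ennreal (1 / real n) * ennreal (exp (\<bar>eps n i \<omega>\<bar> / t))) \<partial>M n)"
        proof (intro nn_integral_cong)
          fix \<omega>
          have "(\<Sum>i<n. ennreal (1 / real n) * ennreal (exp (\<bar>eps n i \<omega>\<bar> / t))) = (\<Sum>i<n. ennreal (1 / real n * exp (\<bar>eps n i \<omega>\<bar> / t)))"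
            by (intro sum.cong refl ennreal_mult[symmetric]) auto
          also have "\<dots> = ennreal (\<Sum>i<n. 1 / real n * exp (\<bar>eps n i \<omega>\<bar> / t))" by (rule sum_ennreal) auto
          also have "(\<Sum>i<n. 1 / real n * exp (\<bar>eps n i \<omega>\<bar> / t)) = m (\<lambda>i\<in>{..<n}. eps n i \<omega>)"
            by (simp add: m_def sum_divide_distrib)
          finally show "ennreal (m (\<lambda>i\<in>{..<n}. eps n i \<omega>)) = (\<Sum>i<n. ennreal (1 / real n) * ennreal (exp (\<bar>eps n i \<omega>\<bar> / t)))" ..
        qed
        also have "\<dots> = (\<Sum>i<n. ennreal (1 / real n) * (\<integral>\<^sup>+\<omega>. ennreal (exp (\<bar>eps n i \<omega>\<bar> / t)) \<partial>M n))"
          using eps_m[OF n] by (subst nn_integral_sum) (auto intro!: sum.cong nn_integral_cmult)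
        also have "\<dots> \<le> (\<Sum>i<n. ennreal (1 / real n) * ennreal c)"
        proof (intro sum_mono mult_left_mono)
          fix i assume "i \<in> {..<n}"
          then have i: "i < n" by simp
          have "(\<integral>\<^sup>+\<omega>. ennreal (exp (\<bar>eps n i \<omega>\<bar> / t)) \<partial>M n) \<le> ennreal (2 * exp 1)"
            by (rule psi2_norm_exp_moment[OF eps_subgaussian[OF n i] tK t eps_m[OF n i]])
          also have "\<dots> \<le> ennreal c" using c unfolding c0_def by (intro ennreal_leI)
          finally show "(\<integral>\<^sup>+\<omega>. ennreal (exp (\<bar>eps n i \<omega>\<bar> / t)) \<partial>M n) \<le> ennreal c" .
        qed auto
        also have "\<dots> = ennreal (real n * (1 / real n * c))"
          using c by (simp add: ennreal_mult[symmetric] ennreal_of_nat_eq_real_of_nat)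
        also have "real n * (1 / real n * c) = c" using n by simp
        finally have le: "(\<integral>\<^sup>+e. ennreal (m e) \<partial>\<nu>) \<le> ennreal c" .
        have mm': "m \<in> borel_measurable \<nu>" using mm by (simp add: \<nu>_def)
        show i: "integrable \<nu> m" using mm' m0 le by (intro integrableI_bounded) (auto intro: order_le_less_trans)
        have "ennreal (\<integral>e. m e \<partial>\<nu>) \<le> ennreal c" using le nn_integral_eq_integral[OF i] m0 by simp
        then show "(\<integral>e. m e \<partial>\<nu>) \<le> c" using c by (subst (asm) ennreal_le_iff) auto
      qed
      \<comment> \<open>The bound of \<open>finite_universality_bound\<close> as a function of m. It
        is affine with nonnegative slope \<gamma>, so integration over the noise replaces m by its
        mean, which is at most c.\<close>
      define Sm where "Sm x = 2 * (L * (A / B * (k * c + x))) + 2 * (L * (\<epsilon> * k * w)) +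
        2 * (L * (k * C0 * ln (1 + 2 / \<epsilon>) / \<beta>)) + 2 * (L * h) +
        (L / \<beta> * (\<delta> / 8) + 2 * L * B * t / b1 * x + 4 * L / h * B\<^sup>2 / real n)" for x
      define \<gamma> where "\<gamma> = 2 * (L * (A / B)) + 2 * L * B * t / b1"
      have Sm: "Sm x = Sm 0 + \<gamma> * x" for x by (simp add: Sm_def \<gamma>_def algebra_simps)
      have \<gamma>0: "0 \<le> \<gamma>" unfolding \<gamma>_def using L0 A(1) B(1) t b1 by (intro add_nonneg_nonneg) auto
      have Smc: "Sm c < \<delta>"
      proof -
        have e1: "2 * (L * (A / B * (k * c + c))) = 2 * L * A * (k * c + c) / B" by simp
        have e2: "2 * (L * (\<epsilon> * k * w)) = \<epsilon> * (2 * L * k * w)" by simp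
        have e3: "2 * (L * (k * C0 * ln (1 + 2 / \<epsilon>) / \<beta>)) = 2 * L * k * C0 * ln (1 + 2 / \<epsilon>) / \<beta>" by simp
        have e4: "2 * (L * h) = h * (2 * L)" by simp
        have e5: "2 * L * B * t / b1 * c = 2 * L * B * t * c / b1" by simp
        have e6: "L / \<beta> * (\<delta> / 8) \<le> 1 * (\<delta> / 8)" using \<beta>(2) \<delta> by (intro mult_right_mono) auto
        show ?thesis unfolding Sm_def e1 e2 e3 e4 e5
          using B(2) \<epsilon>(2) \<beta>(3) h(2) b1(2) e6 elim(3) \<delta> by linarith
      qed
      have fixed: "\<bar>(\<integral>Y. \<psi> (Min (emp_risk n (p n) l (r n) e Y ` D' n i)) \<partial>Pi\<^sub>M {..<n} (\<lambda>_. law_x n)) -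
          (\<integral>Y. \<psi> (Min (emp_risk n (p n) l (r n) e Y ` D' n i)) \<partial>Pi\<^sub>M {..<n} (\<lambda>_. Q n))\<bar> \<le> Sm (m e)" for e i
      proof -
        have Dbody: "D n i j \<subseteq> exp_body (p n) t c R1 (law_x n) (Q n)" for j using D(3)[OF n, of i j] elim(1) by blast
        have DC: "\<Theta> j \<in> C n j" if "\<Theta> \<in> D' n i" for \<Theta> j using that D(3)[OF n, of i j] by (auto simp: D'_def)
        have rlip: "\<bar>r n \<Theta> - r n \<Theta>'\<bar> \<le> Kr * frob_norm (p n) (\<lambda>j i. \<Theta> j i - \<Theta>' j i)"
          if "\<Theta> \<in> D' n i" "\<Theta>' \<in> D' n i" for \<Theta> \<Theta>'
          using DC[OF that(1)] DC[OF that(2)] Rv[OF n]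
          by (intro Kr(2)[OF n] frobC[OF n]) blast+
        have swap: "\<bar>(\<integral>x. ln (\<Sum>\<Theta>\<in>N. w \<Theta> * exp (- \<beta> * min (l (tmat_vec (p n) \<Theta> x) e') B)) \<partial>law_x n) -
           (\<integral>x. ln (\<Sum>\<Theta>\<in>N. w \<Theta> * exp (- \<beta> * min (l (tmat_vec (p n) \<Theta> x) e') B)) \<partial>Q n)\<bar> \<le> \<delta> / 8"
          if N: "N \<subseteq> D' n i" and w: "\<And>\<Theta>. \<Theta> \<in> N \<Longrightarrow> 0 \<le> w \<Theta>" "sum w N = 1" and e': "\<bar>e'\<bar> \<le> b1" for N w e'
        proof -
          have ab: "\<Theta> j \<in> S n \<and> integrable (law_x n) (dot (p n) (\<Theta> j)) \<and> integrable (Q n) (dot (p n) (\<Theta> j)) \<and>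
            (\<integral>x. \<bar>dot (p n) (\<Theta> j) x\<bar> \<partial>law_x n) \<le> t * c \<and> (\<integral>x. \<bar>dot (p n) (\<Theta> j) x\<bar> \<partial>Q n) \<le> t * c" if "\<Theta> \<in> N" for \<Theta> j
          proof -
            have CC: "\<Theta> j \<in> C n j" using DC that N by blast
            then have "\<Theta> j \<in> exp_body (p n) t c R1 (law_x n) (Q n)" using elim(1) by blast
            then have mom: "(\<integral>\<^sup>+x. ennreal (exp (\<bar>dot (p n) (\<Theta> j) x\<bar> / t)) \<partial>law_x n) \<le> ennreal c"
              "(\<integral>\<^sup>+x. ennreal (exp (\<bar>dot (p n) (\<Theta> j) x\<bar> / t)) \<partial>Q n) \<le> ennreal c" by (auto simp: exp_body_def)
            have cp: "0 \<le> c" using c by simp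
            have dm: "dot (p n) (\<Theta> j) \<in> borel_measurable (law_x n)" "dot (p n) (\<Theta> j) \<in> borel_measurable (Q n)" by measurable
            show ?thesis
              using exp_moment_abs[OF mom(1) t cp dm(1)] exp_moment_abs[OF mom(2) t cp dm(2)] CC contained[OF n, of j] by blast
          qed
          have fN: "finite N" using D'fin[OF n, of i] N finite_subset by blast
          have "\<bar>(\<integral>x. ln (\<Sum>\<Theta>\<in>N. w \<Theta> * H (tmat_vec (p n) \<Theta> x, e')) \<partial>law_x n) -
           (\<integral>x. ln (\<Sum>\<Theta>\<in>N. w \<Theta> * H (tmat_vec (p n) \<Theta> x, e')) \<partial>Q n)\<bar> \<le> \<delta> / 16 + cc * \<Delta>"
            by (rule T(3)[OF sc law(1)[OF n] Ql(1) law(2)[OF n] Ql(2) elim(2) fN _ w(2) _ e']) (use w(1) ab in blast)+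
          then show ?thesis using \<Delta>(2) unfolding H_def fst_conv snd_conv by linarith
        qed
        have \<delta>80: "0 \<le> \<delta> / 8" using \<delta> by simp
        show ?thesis unfolding Sm_def w_def m_def k_def D'_def
          by (rule finite_universality_bound[where G=Gb and A=A and KB=KB and Kr=Kr and B=B and \<beta>=\<beta> and \<epsilon>=\<epsilon> and h=h and \<zeta>="\<delta> / 8",
              OF law(1)[OF n] Ql(1) law(2)[OF n] Ql(2) n pn[OF n] t c(1) R1(3) D(1)[OF n] D(2)[OF n] Dbody loss(2) loss(1) A
                B(1) KB(1) KB(2) less_imp_le[OF Kr(1)] rlip[unfolded D'_def] L Gb \<epsilon>(1) \<beta>(1) h(1) b1(1) \<delta>80 swap[unfolded D'_def]])
      qed
      have bound: "\<bar>(\<integral>\<omega>. \<psi> (Min (emp_risk n (p n) l (r n) (\<lambda>i. eps n i \<omega>) (\<lambda>i. X n i \<omega>) ` D' n i)) \<partial>M n) -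
         (\<integral>\<omega>. \<psi> (Min (emp_risk n (p n) l (r n) (\<lambda>i. eps n i \<omega>) (\<lambda>i. G n i \<omega>) ` D' n i)) \<partial>M n)\<bar> \<le> Sm c" for i
      proof -
        define FP where "FP = (\<lambda>e. \<integral>Y. \<psi> (Min (emp_risk n (p n) l (r n) e Y ` D' n i)) \<partial>Pi\<^sub>M {..<n} (\<lambda>_. law_x n))"
        define FQ where "FQ = (\<lambda>e. \<integral>Y. \<psi> (Min (emp_risk n (p n) l (r n) e Y ` D' n i)) \<partial>Pi\<^sub>M {..<n} (\<lambda>_. Q n))"
        have GQ: "distr (M n) (borel_vec (p n)) (G n i) = Q n" if "i < n" for i unfolding Q_def by (rule G_iid(2)[OF n that])
        have iX: "(\<integral>\<omega>. \<psi> (Min (emp_risk n (p n) l (r n) (\<lambda>i. eps n i \<omega>) (\<lambda>i. X n i \<omega>) ` D' n i)) \<partial>M n) = (\<integral>e. FP e \<partial>\<nu>)"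
          unfolding FP_def \<nu>_def
          by (rule iid_data_integral(1)[OF prob_spaces[OF n] n X_iid(1)[OF n] X_iid(2)[OF n] eps_indep(1)[OF n] loss(2) D'fin[OF n] \<psi>m Gb])
        have mX: "FP \<in> borel_measurable (Pi\<^sub>M {..<n} (\<lambda>_. borel))"
          unfolding FP_def
          by (rule iid_data_integral(2)[OF prob_spaces[OF n] n X_iid(1)[OF n] X_iid(2)[OF n] eps_indep(1)[OF n] loss(2) D'fin[OF n] \<psi>m Gb])
        have iG: "(\<integral>\<omega>. \<psi> (Min (emp_risk n (p n) l (r n) (\<lambda>i. eps n i \<omega>) (\<lambda>i. G n i \<omega>) ` D' n i)) \<partial>M n) = (\<integral>e. FQ e \<partial>\<nu>)"
          unfolding FQ_def \<nu>_def
          by (rule iid_data_integral(1)[OF prob_spaces[OF n] n G_iid(1)[OF n] GQ eps_indep(2)[OF n] loss(2) D'fin[OF n] \<psi>m Gb])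
        have mG: "FQ \<in> borel_measurable (Pi\<^sub>M {..<n} (\<lambda>_. borel))"
          unfolding FQ_def
          by (rule iid_data_integral(2)[OF prob_spaces[OF n] n G_iid(1)[OF n] GQ eps_indep(2)[OF n] loss(2) D'fin[OF n] \<psi>m Gb])
        have sn: "sets \<nu> = sets (Pi\<^sub>M {..<n} (\<lambda>_. borel))" by (simp add: \<nu>_def)
        have FPm: "FP \<in> borel_measurable \<nu>" "FQ \<in> borel_measurable \<nu>"
          using mX mG by (simp_all cong: measurable_cong_sets add: sn)
        have Gb0: "0 \<le> Gb" using Gb[of 0] by linarith
        have Fb: "\<bar>\<integral>Y. \<psi> (Min (emp_risk n (p n) l (r n) e Y ` D' n i)) \<partial>Pi\<^sub>M {..<n} (\<lambda>_. N)\<bar> \<le> Gb" if "prob_space N" for N e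
        proof -
          interpret NN: prob_space "Pi\<^sub>M {..<n} (\<lambda>_. N)" by (rule prob_space_PiM) (rule that)
          have g: "- Gb \<le> \<psi> x" "\<psi> x \<le> Gb" for x using Gb[of x] by linarith+
          have "- Gb \<le> (\<integral>Y. \<psi> (Min (emp_risk n (p n) l (r n) e Y ` D' n i)) \<partial>Pi\<^sub>M {..<n} (\<lambda>_. N))"
            "(\<integral>Y. \<psi> (Min (emp_risk n (p n) l (r n) e Y ` D' n i)) \<partial>Pi\<^sub>M {..<n} (\<lambda>_. N)) \<le> Gb"
            by (rule NN.integral_between[OF g]; use Gb0 in simp)+
          then show ?thesis by linarith
        qed
        have Fb2: "\<bar>FP e\<bar> \<le> Gb" "\<bar>FQ e\<bar> \<le> Gb" for e
          unfolding FP_def FQ_def by (rule Fb[OF law(1)[OF n]]) (rule Fb[OF Ql(1)[of n]])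
        have iF: "integrable \<nu> FP" "integrable \<nu> FQ"
          by (rule \<nu>.integrable_const_bound[of _ Gb]; simp add: FPm Fb2)+
        have "\<bar>(\<integral>e. FP e \<partial>\<nu>) - (\<integral>e. FQ e \<partial>\<nu>)\<bar> = \<bar>\<integral>e. FP e - FQ e \<partial>\<nu>\<bar>" by (simp add: iF)
        also have "\<dots> \<le> (\<integral>e. \<bar>FP e - FQ e\<bar> \<partial>\<nu>)"
          using integral_norm_bound[of \<nu> "\<lambda>e. FP e - FQ e"] by simp
        also have "\<dots> \<le> (\<integral>e. Sm 0 + \<gamma> * m e \<partial>\<nu>)"
        proof (rule integral_mono)
          show "integrable \<nu> (\<lambda>e. \<bar>FP e - FQ e\<bar>)" by (intro integrable_abs Bochner_Integration.integrable_diff iF)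
          show "integrable \<nu> (\<lambda>e. Sm 0 + \<gamma> * m e)" using mi(1) by simp
          show "\<bar>FP e - FQ e\<bar> \<le> Sm 0 + \<gamma> * m e" for e using fixed[of e i] unfolding FP_def FQ_def Sm[of "m e"] .
        qed
        also have "\<dots> = Sm 0 + \<gamma> * (\<integral>e. m e \<partial>\<nu>)" using mi(1) by (simp add: \<nu>.prob_space)
        also have "\<dots> \<le> Sm 0 + \<gamma> * c" using mi(2) \<gamma>0 by (intro add_left_mono mult_left_mono)
        finally show ?thesis unfolding iX iG Sm[of c] .
      qed
      \<comment> \<open>n is fixed while the finite sets exhaust the constraint sets; the bound
        passes to the limit because it is the same for all i.\<close>
      have "(\<lambda>i. \<bar>(\<integral>\<omega>. \<psi> (Min (emp_risk n (p n) l (r n) (\<lambda>i. eps n i \<omega>) (\<lambda>i. X n i \<omega>) ` D' n i)) \<partial>M n) -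
         (\<integral>\<omega>. \<psi> (Min (emp_risk n (p n) l (r n) (\<lambda>i. eps n i \<omega>) (\<lambda>i. G n i \<omega>) ` D' n i)) \<partial>M n)\<bar>)
        \<longlonglongrightarrow> \<bar>(\<integral>\<omega>. \<psi> (opt_risk p l r C eps X n \<omega>) \<partial>M n) - (\<integral>\<omega>. \<psi> (opt_risk p l r C eps G n \<omega>) \<partial>M n)\<bar>"
        by (intro tendsto_rabs tendsto_diff limM(1)[OF n _ \<psi>c Gb] Xm Gm n)
      then have "\<bar>(\<integral>\<omega>. \<psi> (opt_risk p l r C eps X n \<omega>) \<partial>M n) - (\<integral>\<omega>. \<psi> (opt_risk p l r C eps G n \<omega>) \<partial>M n)\<bar> \<le> Sm c"
        by (rule LIMSEQ_le_const2) (use bound in blast)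
      then show ?case using Smc by (simp add: dist_real_def)
    qed
  qed
  show ?thesis
  proof (intro conjI allI impI)
    fix \<psi> :: "real \<Rightarrow> real" assume "bounded (range \<psi>)" "\<exists>L. L-lipschitz_on UNIV \<psi>"
    then show "(\<lambda>n. \<bar>(\<integral>\<omega>. \<psi> (opt_risk p l r C eps X n \<omega>) \<partial>M n)
               - (\<integral>\<omega>. \<psi> (opt_risk p l r C eps G n \<omega>) \<partial>M n)\<bar>) \<longlonglongrightarrow> 0" by (rule main)
  next
    fix \<rho> :: real
    define a where "a n = (\<integral>\<omega>. min 1 \<bar>opt_risk p l r C eps X n \<omega> - \<rho>\<bar> \<partial>M n)" for n
    define b where "b n = (\<integral>\<omega>. min 1 \<bar>opt_risk p l r C eps G n \<omega> - \<rho>\<bar> \<partial>M n)" for n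
    \<comment> \<open>The function whose expectation characterizes convergence to \<rho> in
      probability.\<close>
    have "1-lipschitz_on UNIV (\<lambda>y. min 1 \<bar>y - \<rho>\<bar>)"
      by (intro lipschitz_onI) (auto simp: dist_real_def min_def)
    moreover have "bounded (range (\<lambda>y. min 1 \<bar>y - \<rho>\<bar>))" by (rule boundedI[of _ 1]) auto
    ultimately have "(\<lambda>n. \<bar>a n - b n\<bar>) \<longlonglongrightarrow> 0" unfolding a_def b_def by (intro main) auto
    then have ab: "(\<lambda>n. a n - b n) \<longlonglongrightarrow> 0" by (rule tendsto_rabs_zero_cancel)
    have om: "opt_risk p l r C eps X n \<in> borel_measurable (M n)" "opt_risk p l r C eps G n \<in> borel_measurable (M n)" if "n \<ge> 1" for n
      using Xm Gm that by (auto intro!: limM(2)[where \<psi>="\<lambda>_. 0" and Gb=0])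
    have "a \<longlonglongrightarrow> 0 \<longleftrightarrow> b \<longlonglongrightarrow> 0"
      using tendsto_add[OF ab, of b 0] tendsto_diff[OF _ ab, of a 0] by auto
    moreover have "converges_in_prob M (opt_risk p l r C eps X) \<rho> \<longleftrightarrow> a \<longlonglongrightarrow> 0"
      unfolding a_def[abs_def] by (rule converges_in_prob_iff_expectation[OF prob_spaces om(1)])
    moreover have "converges_in_prob M (opt_risk p l r C eps G) \<rho> \<longleftrightarrow> b \<longlonglongrightarrow> 0"
      unfolding b_def[abs_def] by (rule converges_in_prob_iff_expectation[OF prob_spaces om(2)])
    ultimately show "converges_in_prob M (opt_risk p l r C eps X) \<rho> \<longleftrightarrow> converges_in_prob M (opt_risk p l r C eps G) \<rho>"
      by simp
  qed
qed

end
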